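(* Let $c,L\in[0,\infty)$, $\lambda\in(L,\infty)$, $M\in\mathbb{N}\cap\big((\sqrt{\lambda}+\sqrt{L})^2(\sqrt{\lambda}-\sqrt{L})^{-2},\infty\big)$, $\Theta=\cup_{n\in\mathbb{N}}\mathbb{Z}^n$, let $u_d\in C^2(\mathbb{R}^d,\mathbb{R})$, $d\in\mathbb{N}$, and $f_d\in C(\mathbb{R}^d\times\mathbb{R},\mathbb{R})$, $d\in\mathbb{N}$, satisfy for all $d\in\mathbb{N}$, $x\in\mathbb{R}^d$ that $$(\Delta u_d)(x)=f_d(x,u_d(x)).$$ Let $(\Omega,\mathcal{F},\mathbb{P})$ be a probability space, let $W^{d,\theta}\colon[0,\infty)\times\Omega\to\mathbb{R}^d$, $\theta\in\Theta$, $d\in\mathbb{N}$, be independent standard Brownian motions, let $R^\theta\colon\Omega\to[0,\infty)$, $\theta\in\Theta$, be i.i.d. random variables, and assume that $(R^\theta)_{\theta\in\Theta}$ and $(W^{d,\theta})_{(d,\theta)\in\mathbb{N}\times\Theta}$ are independent. Assume for all $d\in\mathbb{N}$, $x=(x_1,\ldots,x_d)\in\mathbb{R}^d$, $v,w\in\mathbb{R}$, $\varepsilon\in(0,\infty)$ that $|f_d(x,v)-f_d(x,w)-\lambda(v-w)|\le L|v-w|$, $|f_d(x,0)|\le c\,d^c\big[1+\sum_{j=1}^d|x_j|\big]^c$, $\sup_{y=(y_1,\ldots,y_d)\in\mathbb{R}^d}\big[|u_d(y)|\exp(-\varepsilon\sum_{j=1}^d|y_j|)\big]<\infty$, and $\mathbb{P}(R^0\ge\varepsilon)=e^{-\lambda\varepsilon}$.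 Let $U^{d,\theta}_n=(U^{d,\theta}_n(x))_{x\in\mathbb{R}^d}\colon\mathbb{R}^d\times\Omega\to\mathbb{R}$, $\theta\in\Theta$, $d,n\in\mathbb{N}_0$, satisfy for all $d,n\in\mathbb{N}$, $\theta\in\Theta$, $x\in\mathbb{R}^d$ that $U^{d,\theta}_0(x)=0$ and $$\begin{aligned} U^{d,\theta}_n(x)={}&\frac{-1}{\lambda M^n}\left[\sum_{m=1}^{M^n}f_d\big(x+\sqrt2\,W^{d,(\theta,0,m)}_{R^{(\theta,0,m)}},0\big)\right]\\ &+\sum_{k=1}^{n-1}\frac{1}{\lambda M^{(n-k)}}\Bigg[\sum_{m=1}^{M^{(n-k)}}\bigg(\lambda\Big[U^{d,(\theta,k,m)}_k\big(x+\sqrt2\,W^{d,(\theta,k,m)}_{R^{(\theta,k,m)}}\big)-U^{d,(\theta,k,-m)}_{k-1}\big(x+\sqrt2\,W^{d,(\theta,k,m)}_{R^{(\theta,k,m)}}\big)\Big]\\ &\qquad-\Big[f_d\Big(x+\sqrt2\,W^{d,(\theta,k,m)}_{R^{(\theta,k,m)}},U^{d,(\theta,k,m)}_k\big(x+\sqrt2\,W^{d,(\theta,k,m)}_{R^{(\theta,k,m)}}\big)\Big)\\ &\qquad\quad-f_d\Big(x+\sqrt2\,W^{d,(\theta,k,m)}_{R^{(\theta,k,m)}},U^{d,(\theta,k,-m)}_{k-1}\big(x+\sqrt2\,W^{d,(\theta,k,m)}_{R^{(\theta,k,m)}}\big)\Big)\Big]\bigg)\Bigg], \end{aligned}$$ and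 let $\mathfrak{C}_{d,n}\in\mathbb{R}$, $d,n\in\mathbb{N}_0$, satisfy for all $d,n\in\mathbb{N}_0$ that $\mathfrak{C}_{d,n}\le(d+1)M^n+\sum_{k=1}^{n-1}M^{(n-k)}(d+1+\mathfrak{C}_{d,k}+\mathfrak{C}_{d,k-1})$. Then there exist $\kappa\in\mathbb{R}$ and $\mathfrak{N}\colon(0,1]\times\mathbb{N}\to\mathbb{N}$ such that for all $\varepsilon\in(0,1]$, $d\in\mathbb{N}$ it holds that $$\mathfrak{C}_{d,\mathfrak{N}_{\varepsilon,d}}\le\kappa\,d^\kappa\varepsilon^{-\kappa}\qquad\text{and}\qquad\sup_{x\in[-c,c]^d}\Big(\mathbb{E}\big[|u_d(x)-U^{d,0}_{\mathfrak{N}_{\varepsilon,d}}(x)|^2\big]\Big)^{1/2}\le\varepsilon.$$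
   Context: $\mathbb{N}=\{1,2,3,\ldots\}$ and $\mathbb{N}_0=\mathbb{N}\cup\{0\}$. $\Theta$ is an index set of finite integer tuples (with $0\in\mathbb{Z}^1\subseteq\Theta$); for $\theta=(\theta_1,\ldots,\theta_j)\in\Theta$ and integers $k,m$, $(\theta,k,m)=(\theta_1,\ldots,\theta_j,k,m)\in\Theta$ denotes concatenation. $W^{d,\theta}_{R^{\theta}}$ denotes the random variable $\omega\mapsto W^{d,\theta}_{R^\theta(\omega)}(\omega)$, and $U(Y)$ for a random field $U$ and a random variable $Y$ denotes $\omega\mapsto U(Y(\omega),\omega)$. Empty sums are zero. $\mathfrak{N}_{\varepsilon,d}=\mathfrak{N}(\varepsilon,d)$. $\Delta$ is the Laplacian. ($\mathfrak{C}_{d,n}$ models the computational cost of sampling one realization of $U^{d,0}_n(x)$.) *)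

theory Defs
  imports "HOL-Probability.Probability"
begin

text \<open>
  Since the dimension \<open>d\<close> is quantified inside the statement, a point of $d$-dimensional Euclidean
  space is an extensional function on the index set \<open>{1..d}\<close>. The topology is the one of the
  function type \<open>nat \<Rightarrow> real\<close> (coordinatewise convergence), restricted to this carrier.
\<close>

definition Rd :: "nat \<Rightarrow> (nat \<Rightarrow> real) set" where
  "Rd d = ({1..d} \<rightarrow>\<^sub>E UNIV)"

abbreviation borel_Rd :: "nat \<Rightarrow> (nat \<Rightarrow> real) measure" where
  "borel_Rd d \<equiv> Pi\<^sub>M {1..d} (\<lambda>_. borel)"

definition partial_deriv :: "nat \<Rightarrow> ((nat \<Rightarrow> real) \<Rightarrow> real) \<Rightarrow> (nat \<Rightarrow> real) \<Rightarrow> real" where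
  "partial_deriv i g x = deriv (\<lambda>t. g (x(i := t))) (x i)"

text \<open>\<open>C_diff d k g\<close>: all partial derivatives of \<open>g\<close> up to order \<open>k\<close> exist and are continuous.\<close>

primrec C_diff :: "nat \<Rightarrow> nat \<Rightarrow> ((nat \<Rightarrow> real) \<Rightarrow> real) \<Rightarrow> bool" where
  "C_diff d 0 g \<longleftrightarrow> continuous_on (Rd d) g"
| "C_diff d (Suc k) g \<longleftrightarrow> continuous_on (Rd d) g \<and>
     (\<forall>i\<in>{1..d}. (\<forall>x\<in>Rd d. (\<lambda>t. g (x(i := t))) differentiable at (x i)) \<and>
                 C_diff d k (partial_deriv i g))"

definition Laplacian :: "nat \<Rightarrow> ((nat \<Rightarrow> real) \<Rightarrow> real) \<Rightarrow> (nat \<Rightarrow> real) \<Rightarrow> real" where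
  "Laplacian d g x = (\<Sum>i=1..d. partial_deriv i (partial_deriv i g) x)"

text \<open>
  Every sample path is continuous, whereas the start in the origin is only required almost surely.
\<close>

definition std_brownian_motion ::
    "'w measure \<Rightarrow> nat \<Rightarrow> (real \<Rightarrow> 'w \<Rightarrow> nat \<Rightarrow> real) \<Rightarrow> bool" where
  "std_brownian_motion P d B \<longleftrightarrow>
     (\<forall>t\<ge>0. B t \<in> measurable P (borel_Rd d)) \<and>
     (AE \<omega> in P. B 0 \<omega> = (\<lambda>j\<in>{1..d}. 0)) \<and>
     (\<forall>\<omega>\<in>space P. continuous_on {0..} (\<lambda>t. B t \<omega>)) \<and>
     (\<forall>n (t :: nat \<Rightarrow> real). 0 \<le> t 0 \<and> mono t \<longrightarrow>
        prob_space.indep_vars P (\<lambda>_. borel_Rd d)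
          (\<lambda>i \<omega>. \<lambda>j\<in>{1..d}. B (t (Suc i)) \<omega> j - B (t i) \<omega> j) {..<n}) \<and>
     (\<forall>s t. 0 \<le> s \<and> s < t \<longrightarrow>
        distr P (borel_Rd d) (\<lambda>\<omega>. \<lambda>j\<in>{1..d}. B t \<omega> j - B s \<omega> j) =
        Pi\<^sub>M {1..d} (\<lambda>_. density lborel (\<lambda>y. ennreal (normal_density 0 (sqrt (t - s)) y))))"

text \<open>
  Measurable space of paths \<open>[0,\<infinity>) \<rightarrow> Rd d\<close>; the \<open>\<sigma>\<close>-algebra on the sample space that a path-valued
  map generates is the one generated by all its time marginals.
\<close>

abbreviation path_space :: "nat \<Rightarrow> (real \<Rightarrow> nat \<Rightarrow> real) measure" where
  "path_space d \<equiv> Pi\<^sub>M {0..} (\<lambda>_. borel_Rd d)"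

definition sample_path :: "(real \<Rightarrow> 'w \<Rightarrow> nat \<Rightarrow> real) \<Rightarrow> 'w \<Rightarrow> real \<Rightarrow> nat \<Rightarrow> real" where
  "sample_path B \<omega> = (\<lambda>t\<in>{0..}. B t \<omega>)"

text \<open>The concatenation $(\theta,k,m)$ is rendered as \<open>\<theta> @ [k, m]\<close>, the tuple $0$ as \<open>[0]\<close>.\<close>

definition Theta :: "int list set" where
  "Theta = {\<theta>. \<theta> \<noteq> []}"

end

theory Submission
  imports Defs
begin

text \<open>
  Put \<open>F(y, v) = v - f(y, v) / lam\<close>, which is \<open>L / lam\<close>-Lipschitz in \<open>v\<close>, and \<open>Y = x + sqrt 2 * W_R\<close>. Since \<open>R\<close> is
  exponential, the Feynman-Kac formula turns the equation into the fixed point equation \<open>u(x) = E F(Y, u(Y))\<close>,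
  and the scheme is a multilevel Picard iteration for it. The random variables \<open>W^\<theta>_{R^\<theta>}\<close> are i.i.d., so the
  scheme is a fixed functional of an i.i.d. family indexed by tuples, and its mean telescopes to
  \<open>E F(Y, U_{n-1}(Y))\<close>. Let \<open>\<psi>(x)\<^sup>2 = A + (\<Sum>j. x_j ^ (2 * p))\<close> with \<open>A\<close> so large, but polynomial in \<open>d\<close>, that
  \<open>E \<psi>(Y)\<^sup>2 \<le> (lam / L) * \<psi>(x)\<^sup>2\<close> (with a constant such as 2 if \<open>L = 0\<close>). Then the \<open>L2\<close> errors relative to \<open>\<psi>\<close> satisfy
  \<open>e_n \<le> Q * e_{n-1} + O(M^(-n/2)) + Q * (\<Sum>k<n. M^(-(n-k)/2) * (e_k + e_{k-1}))\<close> with \<open>Q = sqrt (L / lam)\<close>, and the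
  condition on \<open>M\<close> says exactly that \<open>Q * (1 + M^(-1/2)) < 1 - M^(-1/2)\<close>, so that \<open>e_n\<close> decays geometrically.
  As the cost grows at most geometrically in \<open>n\<close>, a number of levels logarithmic in \<open>d / \<epsilon>\<close> suffices.
\<close>

section \<open>Second moments\<close>

text \<open>Two obstacles shape the argument. The hypotheses control the growth of \<open>u\<close>
  and, through the equation, of its Laplacian, but say nothing about the gradient or the single
  second derivatives. Hence the Feynman-Kac formula is obtained by integrating \<open>u\<close>
  against the Gaussian kernel: explicit polynomial cutoffs move both derivatives onto the kernel,
  the second derivatives recombine to the Laplacian before the cutoffs are removed, and the heat
  equation of the kernel is integrated in time. Secondly, \<open>u\<close> is only known to grow
  more slowly than every exponential, with constants that may depend on \<open>d\<close> in any way.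
  The error recursion, however, starts from the iterate 0 and so needs
  \<open>\<bar>u x\<bar> \<le> a * \<psi> x\<close> with \<open>a\<close> polynomial in
  \<open>d\<close>. This comes from iterating the fixed point equation: each iteration multiplies
  the rough bound by a fixed factor below 1, so that only the contribution of \<open>f(y, 0)\<close>
  survives, whatever the rough constant was.\<close>

definition L2_le :: "'a measure \<Rightarrow> ('a \<Rightarrow> real) \<Rightarrow> real \<Rightarrow> bool" where
  "L2_le M X b \<longleftrightarrow> X \<in> borel_measurable M \<and> 0 \<le> b \<and>
     (\<integral>\<^sup>+\<omega>. ennreal ((X \<omega>)\<^sup>2) \<partial>M) \<le> ennreal (b\<^sup>2)"

lemma L2_leI:
  assumes "X \<in> borel_measurable M" "0 \<le> b" "(\<integral>\<^sup>+\<omega>. ennreal ((X \<omega>)\<^sup>2) \<partial>M) \<le> ennreal (b\<^sup>2)"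
  shows "L2_le M X b"
  using assms by (simp add: L2_le_def)

lemma L2_leD:
  assumes "L2_le M X b"
  shows "X \<in> borel_measurable M" "0 \<le> b" "(\<integral>\<^sup>+\<omega>. ennreal ((X \<omega>)\<^sup>2) \<partial>M) \<le> ennreal (b\<^sup>2)"
  using assms by (auto simp: L2_le_def)

text \<open>The bound is on the nonnegative integral, which is meaningful for every measurable
  \<open>X\<close>, so integrability is a consequence of it.\<close>

lemma L2_le_integrable_square:
  assumes "L2_le M X b"
  shows "integrable M (\<lambda>\<omega>. (X \<omega>)\<^sup>2)" "(\<integral>\<omega>. (X \<omega>)\<^sup>2 \<partial>M) \<le> b\<^sup>2"
proof -
  have m[measurable]: "X \<in> borel_measurable M" using L2_leD(1)[OF assms] .
  have le: "(\<integral>\<^sup>+\<omega>. ennreal ((X \<omega>)\<^sup>2) \<partial>M) \<le> ennreal (b\<^sup>2)" by (rule L2_leD(3)[OF assms])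
  show i: "integrable M (\<lambda>\<omega>. (X \<omega>)\<^sup>2)"
    by (rule integrableI_bounded) (use le in \<open>auto simp: le_less_trans\<close>)
  show "(\<integral>\<omega>. (X \<omega>)\<^sup>2 \<partial>M) \<le> b\<^sup>2"
    using le nn_integral_eq_integral[OF i] by simp
qed

lemma L2_leI_integral:
  assumes "X \<in> borel_measurable M" "0 \<le> b" "integrable M (\<lambda>\<omega>. (X \<omega>)\<^sup>2)"
    "(\<integral>\<omega>. (X \<omega>)\<^sup>2 \<partial>M) \<le> b\<^sup>2"
  shows "L2_le M X b"
  using assms by (intro L2_leI) (simp_all add: nn_integral_eq_integral)

lemma L2_le_mono:
  assumes "L2_le M X a" "a \<le> b"
  shows "L2_le M X b"
proof -
  have "ennreal (a\<^sup>2) \<le> ennreal (b\<^sup>2)"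
    using assms L2_leD(2)[OF assms(1)] by (intro ennreal_leI power_mono) auto
  then show ?thesis using assms L2_leD[OF assms(1)]
    by (intro L2_leI) (auto intro: order_trans)
qed

lemma L2_le_cmult:
  assumes "L2_le M X b"
  shows "L2_le M (\<lambda>\<omega>. c * X \<omega>) (\<bar>c\<bar> * b)"
proof (rule L2_leI)
  note X[measurable] = L2_leD(1)[OF assms]
  show "(\<lambda>\<omega>. c * X \<omega>) \<in> borel_measurable M" by measurable
  show "0 \<le> \<bar>c\<bar> * b" using L2_leD(2)[OF assms] by simp
  have "(\<integral>\<^sup>+\<omega>. ennreal ((c * X \<omega>)\<^sup>2) \<partial>M) = ennreal (c\<^sup>2) * (\<integral>\<^sup>+\<omega>. ennreal ((X \<omega>)\<^sup>2) \<partial>M)"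
    by (subst nn_integral_cmult[symmetric]) (auto simp: power_mult_distrib ennreal_mult)
  also have "\<dots> \<le> ennreal (c\<^sup>2) * ennreal (b\<^sup>2)"
    by (intro mult_left_mono L2_leD(3)[OF assms]) simp
  finally show "(\<integral>\<^sup>+\<omega>. ennreal ((c * X \<omega>)\<^sup>2) \<partial>M) \<le> ennreal ((\<bar>c\<bar> * b)\<^sup>2)"
    by (simp add: power_mult_distrib ennreal_mult)
qed

text \<open>Minkowski's inequality: Cauchy-Schwarz bounds the mean of the cross term by
  \<open>a * b\<close>.\<close>

lemma L2_le_add:
  assumes "L2_le M X a" "L2_le M Y b"
  shows "L2_le M (\<lambda>\<omega>. X \<omega> + Y \<omega>) (a + b)"
proof (rule L2_leI_integral)
  note X[measurable] = L2_leD(1)[OF assms(1)] and Y[measurable] = L2_leD(1)[OF assms(2)]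
  note ab = L2_leD(2)[OF assms(1)] L2_leD(2)[OF assms(2)]
  note iX = L2_le_integrable_square[OF assms(1)] and iY = L2_le_integrable_square[OF assms(2)]
  show "(\<lambda>\<omega>. X \<omega> + Y \<omega>) \<in> borel_measurable M" by measurable
  show "0 \<le> a + b" using ab by simp
  have iXY: "integrable M (\<lambda>\<omega>. X \<omega> * Y \<omega>)"
  proof (rule Bochner_Integration.integrable_bound)
    show "integrable M (\<lambda>\<omega>. (X \<omega>)\<^sup>2 + (Y \<omega>)\<^sup>2)" using iX iY by simp
    show "AE \<omega> in M. norm (X \<omega> * Y \<omega>) \<le> norm ((X \<omega>)\<^sup>2 + (Y \<omega>)\<^sup>2)"
    proof (rule AE_I2)
      fix \<omega>
      have "0 \<le> (\<bar>X \<omega>\<bar> - \<bar>Y \<omega>\<bar>)\<^sup>2" by simp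
      then have "2 * (\<bar>X \<omega>\<bar> * \<bar>Y \<omega>\<bar>) \<le> (X \<omega>)\<^sup>2 + (Y \<omega>)\<^sup>2"
        by (simp add: power2_diff)
      moreover have "0 \<le> \<bar>X \<omega>\<bar> * \<bar>Y \<omega>\<bar>" by simp
      ultimately show "norm (X \<omega> * Y \<omega>) \<le> norm ((X \<omega>)\<^sup>2 + (Y \<omega>)\<^sup>2)"
        unfolding real_norm_def abs_mult by linarith
    qed
  qed auto
  have "(\<integral>\<^sup>+\<omega>. ennreal \<bar>X \<omega>\<bar> * ennreal \<bar>Y \<omega>\<bar> \<partial>M)\<^sup>2
      \<le> (\<integral>\<^sup>+\<omega>. ennreal \<bar>X \<omega>\<bar> ^ 2 \<partial>M) * (\<integral>\<^sup>+\<omega>. ennreal \<bar>Y \<omega>\<bar> ^ 2 \<partial>M)"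
    by (rule Cauchy_Schwarz_nn_integral) measurable
  also have "\<dots> \<le> ennreal (a\<^sup>2) * ennreal (b\<^sup>2)"
    using L2_leD(3)[OF assms(1)] L2_leD(3)[OF assms(2)]
    by (intro mult_mono) (auto simp: ennreal_power)
  also have "\<dots> = (ennreal (a * b))\<^sup>2" using ab
    by (simp add: ennreal_power power_mult_distrib ennreal_mult)
  also have "(\<integral>\<^sup>+\<omega>. ennreal \<bar>X \<omega>\<bar> * ennreal \<bar>Y \<omega>\<bar> \<partial>M) = ennreal (\<integral>\<omega>. \<bar>X \<omega> * Y \<omega>\<bar> \<partial>M)"
    using integrable_abs[OF iXY]
    by (subst nn_integral_eq_integral[symmetric]) (auto simp: ennreal_mult abs_mult)
  finally have "(\<integral>\<omega>. \<bar>X \<omega> * Y \<omega>\<bar> \<partial>M)\<^sup>2 \<le> (a * b)\<^sup>2"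
    using ab by (simp add: ennreal_power integral_nonneg_AE)
  then have "(\<integral>\<omega>. \<bar>X \<omega> * Y \<omega>\<bar> \<partial>M) \<le> a * b"
    by (rule power2_le_imp_le) (use ab in auto)
  moreover have "(\<integral>\<omega>. X \<omega> * Y \<omega> \<partial>M) \<le> (\<integral>\<omega>. \<bar>X \<omega> * Y \<omega>\<bar> \<partial>M)"
    using iXY by (intro integral_mono) auto
  ultimately have XY: "(\<integral>\<omega>. X \<omega> * Y \<omega> \<partial>M) \<le> a * b" by linarith
  have e: "(\<lambda>\<omega>. (X \<omega> + Y \<omega>)\<^sup>2) = (\<lambda>\<omega>. (X \<omega>)\<^sup>2 + (Y \<omega>)\<^sup>2 + 2 * (X \<omega> * Y \<omega>))"
    by (auto simp: power2_sum)
  show "integrable M (\<lambda>\<omega>. (X \<omega> + Y \<omega>)\<^sup>2)" unfolding e using iX iY iXY by simp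
  have "(\<integral>\<omega>. (X \<omega> + Y \<omega>)\<^sup>2 \<partial>M) = (\<integral>\<omega>. (X \<omega>)\<^sup>2 \<partial>M) + (\<integral>\<omega>. (Y \<omega>)\<^sup>2 \<partial>M) + 2 * (\<integral>\<omega>. X \<omega> * Y \<omega> \<partial>M)"
    unfolding e using iX iY iXY by simp
  also have "\<dots> \<le> a\<^sup>2 + b\<^sup>2 + 2 * (a * b)" using iX iY XY by linarith
  finally show "(\<integral>\<omega>. (X \<omega> + Y \<omega>)\<^sup>2 \<partial>M) \<le> (a + b)\<^sup>2" by (simp add: power2_sum)
qed

lemma L2_le_diff:
  assumes "L2_le M X a" "L2_le M Y b"
  shows "L2_le M (\<lambda>\<omega>. X \<omega> - Y \<omega>) (a + b)"
  using L2_le_add[OF assms(1) L2_le_cmult[OF assms(2), of "-1"]] by simp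

lemma L2_le_zero: "L2_le M (\<lambda>_. 0) 0"
  by (simp add: L2_le_def)

lemma L2_le_sum:
  assumes "finite S" "\<And>i. i \<in> S \<Longrightarrow> L2_le M (X i) (b i)"
  shows "L2_le M (\<lambda>\<omega>. \<Sum>i\<in>S. X i \<omega>) (\<Sum>i\<in>S. b i)"
  using assms by induction (auto simp: L2_le_zero intro!: L2_le_add)

lemma L2_le_bound:
  assumes "L2_le M Y b" "X \<in> borel_measurable M" "\<And>\<omega>. \<omega> \<in> space M \<Longrightarrow> \<bar>X \<omega>\<bar> \<le> \<bar>Y \<omega>\<bar>"
  shows "L2_le M X b"
proof (rule L2_leI)
  have "(\<integral>\<^sup>+\<omega>. ennreal ((X \<omega>)\<^sup>2) \<partial>M) \<le> (\<integral>\<^sup>+\<omega>. ennreal ((Y \<omega>)\<^sup>2) \<partial>M)"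
    by (intro nn_integral_mono ennreal_leI) (use assms(3) in \<open>simp add: abs_le_square_iff\<close>)
  then show "(\<integral>\<^sup>+\<omega>. ennreal ((X \<omega>)\<^sup>2) \<partial>M) \<le> ennreal (b\<^sup>2)"
    using L2_leD(3)[OF assms(1)] by (rule order_trans)
qed (use assms L2_leD in auto)

lemma L2_le_distr:
  assumes "f \<in> measurable M N" "X \<in> borel_measurable N"
  shows "L2_le (distr M N f) X b \<longleftrightarrow> L2_le M (\<lambda>\<omega>. X (f \<omega>)) b"
  using assms unfolding L2_le_def by (auto simp: nn_integral_distr)

text \<open>Tonelli's theorem in the form of conditioning. It lets the sampling point be frozen
  while the norm is taken over the noise independent of it.\<close>

lemma L2_le_pair:
  assumes "sigma_finite_measure B" "X \<in> borel_measurable (A \<Otimes>\<^sub>M B)"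
    and inner: "\<And>y. y \<in> space A \<Longrightarrow> L2_le B (\<lambda>w. X (y, w)) (g y)"
    and outer: "L2_le A g b"
  shows "L2_le (A \<Otimes>\<^sub>M B) X b"
proof (rule L2_leI)
  interpret sigma_finite_measure B by fact
  note X[measurable] = assms(2)
  have "(\<integral>\<^sup>+\<omega>. ennreal ((X \<omega>)\<^sup>2) \<partial>(A \<Otimes>\<^sub>M B)) = (\<integral>\<^sup>+y. \<integral>\<^sup>+w. ennreal ((X (y, w))\<^sup>2) \<partial>B \<partial>A)"
    by (subst nn_integral_fst[symmetric]) auto
  also have "\<dots> \<le> (\<integral>\<^sup>+y. ennreal ((g y)\<^sup>2) \<partial>A)"
    by (intro nn_integral_mono L2_leD(3)[OF inner]) auto
  also have "\<dots> \<le> ennreal (b\<^sup>2)" by (rule L2_leD(3)[OF outer])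
  finally show "(\<integral>\<^sup>+\<omega>. ennreal ((X \<omega>)\<^sup>2) \<partial>(A \<Otimes>\<^sub>M B)) \<le> ennreal (b\<^sup>2)" .
qed (use assms L2_leD(2)[OF outer] in auto)

context prob_space
begin

lemma L2_le_const: "L2_le M (\<lambda>_. c) \<bar>c\<bar>"
  by (rule L2_leI) (auto simp: emeasure_space_1)

text \<open>All three parts come from the variance identity: the variance is nonnegative and at most
  the second moment.\<close>

lemma L2_le_mean:
  assumes "L2_le M X b"
  shows "integrable M X" "\<bar>expectation X\<bar> \<le> b" "L2_le M (\<lambda>\<omega>. X \<omega> - expectation X) b"
proof -
  note X[measurable] = L2_leD(1)[OF assms]
  note sq = L2_le_integrable_square[OF assms]
  show i: "integrable M X" using square_integrable_imp_integrable[OF X sq(1)] .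
  have v: "expectation (\<lambda>\<omega>. (X \<omega> - expectation X)\<^sup>2) = expectation (\<lambda>\<omega>. (X \<omega>)\<^sup>2) - (expectation X)\<^sup>2"
    using variance_eq[OF i sq(1)] .
  have "0 \<le> expectation (\<lambda>\<omega>. (X \<omega> - expectation X)\<^sup>2)" by (rule integral_nonneg_AE) auto
  with v sq(2) have "(expectation X)\<^sup>2 \<le> b\<^sup>2" by linarith
  then show "\<bar>expectation X\<bar> \<le> b" using L2_leD(2)[OF assms] by (simp add: power2_le_iff_abs_le)
  show "L2_le M (\<lambda>\<omega>. X \<omega> - expectation X) b"
  proof (rule L2_leI_integral)
    show "integrable M (\<lambda>\<omega>. (X \<omega> - expectation X)\<^sup>2)"
      using i sq(1) by (simp add: power2_diff)
    show "expectation (\<lambda>\<omega>. (X \<omega> - expectation X)\<^sup>2) \<le> b\<^sup>2"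
      using v sq(2) zero_le_power2[of "expectation X"] by linarith
  qed (use L2_leD(2)[OF assms] in auto)
qed

text \<open>Off-diagonal covariances vanish by independence, so the second moment of the centred sum
  is at most \<open>card S * b\<^sup>2\<close>; averaging then gains the square root of the sample
  size.\<close>

lemma L2_le_indep_average:
  fixes X :: "'i \<Rightarrow> 'a \<Rightarrow> real"
  assumes S: "finite S" "S \<noteq> {}" and ind: "indep_vars (\<lambda>_. borel) X S"
    and b: "\<And>i. i \<in> S \<Longrightarrow> L2_le M (X i) b"
    and h: "\<And>i. i \<in> S \<Longrightarrow> expectation (X i) = h"
  shows "L2_le M (\<lambda>\<omega>. (\<Sum>i\<in>S. X i \<omega>) / card S - h) (b / sqrt (card S))"
proof -
  have b0: "0 \<le> b" using S b L2_leD(2) by blast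
  have c: "L2_le M (\<lambda>\<omega>. X i \<omega> - h) b" if "i \<in> S" for i
    using L2_le_mean(3)[OF b[OF that]] h[OF that] by simp
  have m[measurable]: "X i \<in> borel_measurable M" if "i \<in> S" for i using b[OF that] L2_leD(1) by blast
  have iX: "integrable M (X i)" if "i \<in> S" for i using L2_le_mean(1)[OF b[OF that]] .
  have cross: "integrable M (\<lambda>\<omega>. (X i \<omega> - h) * (X j \<omega> - h)) \<and>
     expectation (\<lambda>\<omega>. (X i \<omega> - h) * (X j \<omega> - h)) \<le> (if i = j then b\<^sup>2 else 0)" if ij: "i \<in> S" "j \<in> S" for i j
  proof (cases "i = j")
    case True
    then show ?thesis using L2_le_integrable_square[OF c[OF ij(1)]] by (simp add: power2_eq_square)
  next
    case False
    have ij': "indep_vars (\<lambda>_. borel) (\<lambda>i \<omega>. X i \<omega> - h) {i, j}"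
      by (rule indep_vars_compose2[OF indep_vars_subset[OF ind]]) (use ij in auto)
    have z: "expectation (\<lambda>\<omega>. X i \<omega> - h) = 0" if "i \<in> S" for i
      using iX[OF that] h[OF that] by (simp add: prob_space)
    have i': "integrable M (\<lambda>\<omega>. X l \<omega> - h)" if "l \<in> {i, j}" for l using iX ij that by auto
    show ?thesis
      using indep_vars_integrable[OF _ ij' i'] indep_vars_lebesgue_integral[OF _ ij' i'] ij z False by simp
  qed
  have e: "(\<lambda>\<omega>. (\<Sum>i\<in>S. X i \<omega> - h)\<^sup>2) = (\<lambda>\<omega>. \<Sum>i\<in>S. \<Sum>j\<in>S. (X i \<omega> - h) * (X j \<omega> - h))"
    by (simp add: power2_eq_square sum_product)
  have "expectation (\<lambda>\<omega>. (\<Sum>i\<in>S. X i \<omega> - h)\<^sup>2)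
      = (\<Sum>i\<in>S. \<Sum>j\<in>S. expectation (\<lambda>\<omega>. (X i \<omega> - h) * (X j \<omega> - h)))"
    unfolding e using cross by (simp add: Bochner_Integration.integral_sum)
  also have "\<dots> \<le> (\<Sum>i\<in>S. \<Sum>j\<in>S. if i = j then b\<^sup>2 else 0)"
    using cross by (intro sum_mono) auto
  also have "\<dots> = card S * b\<^sup>2" using S by simp
  also have "\<dots> = (sqrt (card S) * b)\<^sup>2" by (simp add: power_mult_distrib)
  finally have le: "expectation (\<lambda>\<omega>. (\<Sum>i\<in>S. X i \<omega> - h)\<^sup>2) \<le> (sqrt (card S) * b)\<^sup>2" .
  have "L2_le M (\<lambda>\<omega>. \<Sum>i\<in>S. X i \<omega> - h) (sqrt (card S) * b)"
  proof (rule L2_leI_integral)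
    show "integrable M (\<lambda>\<omega>. (\<Sum>i\<in>S. X i \<omega> - h)\<^sup>2)" unfolding e using cross by auto
  qed (use le b0 in auto)
  from L2_le_cmult[OF this, of "1 / card S"]
  have "L2_le M (\<lambda>\<omega>. (1 / card S) * (\<Sum>i\<in>S. X i \<omega> - h)) (sqrt (card S) * b / card S)"
    by simp
  moreover have "(1 / card S) * (\<Sum>i\<in>S. X i \<omega> - h) = (\<Sum>i\<in>S. X i \<omega>) / card S - h" for \<omega>
    using S by (simp add: sum_subtractf diff_divide_distrib)
  moreover have "sqrt (card S) * b / card S = b / sqrt (card S)"
    using S by (simp add: field_simps)
  ultimately show ?thesis by simp
qed

end

section \<open>The multilevel Picard scheme\<close>

lemma measurable_coord: "j \<in> {1..d} \<Longrightarrow> (\<lambda>y. y j) \<in> borel_measurable (borel_Rd d)"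
  by (rule measurable_component_singleton)

text \<open>The restriction to \<open>{1..d}\<close> puts the sum into \<open>Rd d\<close> for
  arbitrary arguments, so evaluating at a random point leaves no membership condition.\<close>

definition translate :: "nat \<Rightarrow> (nat \<Rightarrow> real) \<Rightarrow> (nat \<Rightarrow> real) \<Rightarrow> nat \<Rightarrow> real" where
  "translate d x y = (\<lambda>j\<in>{1..d}. x j + y j)"

lemma translate_in_Rd[simp]: "translate d x y \<in> Rd d"
  by (auto simp: translate_def Rd_def)

lemma space_borel_Rd: "space (borel_Rd d) = Rd d"
  by (simp add: space_PiM Rd_def)

lemma measurable_translate[measurable (raw)]:
  assumes "f \<in> measurable M (borel_Rd d)" "g \<in> measurable M (borel_Rd d)"
  shows "(\<lambda>x. translate d (f x) (g x)) \<in> measurable M (borel_Rd d)"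
proof -
  have "(\<lambda>x. f x j) \<in> borel_measurable M" "(\<lambda>x. g x j) \<in> borel_measurable M" if "j \<in> {1..d}" for j
    using measurable_compose[OF assms(1) measurable_component_singleton[OF that]]
      measurable_compose[OF assms(2) measurable_component_singleton[OF that]] by auto
  then show ?thesis unfolding translate_def by (intro measurable_restrict) auto
qed

lemma measurable_const_Rd: "x \<in> Rd d \<Longrightarrow> (\<lambda>_. x) \<in> measurable A (borel_Rd d)"
  by (rule measurable_const) (simp only: space_borel_Rd)

text \<open>The noise in the subtree below \<open>\<eta>\<close>, reindexed by \<open>Theta\<close>.
  Being extensional, it is again a point of the product space, so the same functional can be applied
  to it recursively.\<close>

definition subfamily :: "int list \<Rightarrow> (int list \<Rightarrow> 'a) \<Rightarrow> int list \<Rightarrow> 'a" where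
  "subfamily \<eta> z = (\<lambda>\<xi>\<in>Theta. z (\<eta> @ \<xi>))"

lemma append_in_Theta: "\<xi> \<in> Theta \<Longrightarrow> \<eta> @ \<xi> \<in> Theta"
  by (auto simp: Theta_def)

lemma pair_in_Theta[simp]: "[k, m] \<in> Theta"
  by (simp add: Theta_def)

lemma subfamily_subfamily: "subfamily \<eta> (subfamily \<theta> z) = subfamily (\<theta> @ \<eta>) z"
  by (auto simp: subfamily_def append_in_Theta fun_eq_iff)

locale mlp_scheme =
  fixes d :: nat and \<mu> :: "(nat \<Rightarrow> real) measure" and F :: "(nat \<Rightarrow> real) \<Rightarrow> real \<Rightarrow> real" and M :: nat
  assumes prob_mu: "prob_space \<mu>" and sets_mu[measurable_cong]: "sets \<mu> = sets (borel_Rd d)"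
    and F_meas: "(\<lambda>(x, v). F x v) \<in> borel_measurable (borel_Rd d \<Otimes>\<^sub>M borel)"
    and M_pos: "1 \<le> M"
begin

abbreviation Pi_mu :: "(int list \<Rightarrow> nat \<Rightarrow> real) measure" where
  "Pi_mu \<equiv> Pi\<^sub>M Theta (\<lambda>_. \<mu>)"

text \<open>The summand is written out because the recursive calls have to be visible here;
  \<open>incr\<close> names it afterwards. As in the scheme, both iterates of a summand share the
  point sampled at \<open>[k, m]\<close>, while the coarser one takes its noise from below
  \<open>[k, - m]\<close>. Level 0 has no coarser iterate. The factor \<open>1 / lam\<close> of the
  scheme is part of \<open>F\<close>.\<close>

fun Phi :: "nat \<Rightarrow> (nat \<Rightarrow> real) \<Rightarrow> (int list \<Rightarrow> nat \<Rightarrow> real) \<Rightarrow> real" where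
  "Phi n x z = (\<Sum>k\<in>{0..<n}. (\<Sum>m\<in>{1..M ^ (n - k)}.
     let y = translate d x (z [int k, int m]) in
     if k = 0 then F y 0
     else F y (Phi k y (subfamily [int k, int m] z)) - F y (Phi (k - 1) y (subfamily [int k, - int m] z)))
       / real (M ^ (n - k)))"

declare Phi.simps[simp del]

definition incr :: "nat \<Rightarrow> nat \<Rightarrow> (nat \<Rightarrow> real) \<Rightarrow> (int list \<Rightarrow> nat \<Rightarrow> real) \<Rightarrow> real" where
  "incr k m x z = (let y = translate d x (z [int k, int m]) in
     if k = 0 then F y 0
     else F y (Phi k y (subfamily [int k, int m] z)) - F y (Phi (k - 1) y (subfamily [int k, - int m] z)))"

lemma Phi_eq: "Phi n x z = (\<Sum>k\<in>{0..<n}. (\<Sum>m\<in>{1..M ^ (n - k)}. incr k m x z) / real (M ^ (n - k)))"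
  by (subst Phi.simps) (simp only: incr_def)

lemma Phi_0: "Phi 0 x z = 0"
  by (simp add: Phi.simps)

lemma prob_Pi_mu: "prob_space Pi_mu"
  by (intro prob_space_PiM prob_mu)

sublocale mu: prob_space \<mu> by (rule prob_mu)
sublocale P: prob_space Pi_mu by (rule prob_Pi_mu)

lemma space_mu: "space \<mu> = Rd d"
  using sets_eq_imp_space_eq[OF sets_mu] space_borel_Rd by metis

lemma measurable_F[measurable (raw)]:
  assumes "f \<in> measurable A (borel_Rd d)" "g \<in> borel_measurable A"
  shows "(\<lambda>x. F (f x) (g x)) \<in> borel_measurable A"
  using measurable_compose[OF measurable_Pair[OF assms] F_meas] by simp

lemma measurable_incr_aux:
  assumes "y \<in> measurable A (borel_Rd d)" "p \<in> borel_measurable A" "q \<in> borel_measurable A"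
  shows "(\<lambda>w. if k = (0::nat) then F (y w) 0 else F (y w) (p w) - F (y w) (q w)) \<in> borel_measurable A"
  using borel_measurable_diff[OF measurable_F[OF assms(1,2)] measurable_F[OF assms(1,3)]]
    measurable_F[OF assms(1) borel_measurable_const[of 0]]
  by (cases "k = 0") auto

lemma measurable_subfamily:
  assumes "J \<subseteq> Theta" "(@) \<eta> ` Theta \<subseteq> J"
  shows "subfamily \<eta> \<in> measurable (Pi\<^sub>M J (\<lambda>_. \<mu>)) Pi_mu"
  unfolding subfamily_def using assms
  by (intro measurable_restrict measurable_component_singleton) auto

lemma measurable_subfamily'[measurable]: "subfamily \<eta> \<in> measurable Pi_mu Pi_mu"
  by (rule measurable_subfamily) (auto simp: append_in_Theta)

lemma measurable_coordinate: "\<eta> \<in> J \<Longrightarrow> (\<lambda>z. z \<eta>) \<in> measurable (Pi\<^sub>M J (\<lambda>_. \<mu>)) (borel_Rd d)"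
  using measurable_component_singleton[of \<eta> J "\<lambda>_. \<mu>"]
  unfolding measurable_cong_sets[OF refl sets_mu] by blast

lemma measurable_coordinate'[measurable]: "(\<lambda>z. z [k, m]) \<in> measurable Pi_mu (borel_Rd d)"
  by (rule measurable_coordinate) simp

text \<open>Joint measurability in the point and the noise is required because the recursion
  evaluates \<open>Phi\<close> at a random point.\<close>

lemma measurable_Phi: "(\<lambda>(x, z). Phi n x z) \<in> borel_measurable (borel_Rd d \<Otimes>\<^sub>M Pi_mu)"
proof (induction n rule: less_induct)
  case (less n)
  have c: "(\<lambda>w. Phi k (f w) (g w)) \<in> borel_measurable A"
    if "k < n" "f \<in> measurable A (borel_Rd d)" "g \<in> measurable A Pi_mu" for k f g and A :: "'c measure"
    using measurable_compose[OF measurable_Pair[OF that(2,3)] less[OF that(1)]] by simp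
  have "(\<lambda>w. incr k m (fst w) (snd w)) \<in> borel_measurable (borel_Rd d \<Otimes>\<^sub>M Pi_mu)" if k: "k < n" for k m
  proof -
    have s: "(\<lambda>w. translate d (fst w) (snd w [int k, int m])) \<in> measurable (borel_Rd d \<Otimes>\<^sub>M Pi_mu) (borel_Rd d)"
      by measurable
    have g: "(\<lambda>w. subfamily \<eta> (snd w)) \<in> measurable (borel_Rd d \<Otimes>\<^sub>M Pi_mu) Pi_mu" for \<eta>
      by measurable
    have "k - 1 < n" using k by simp
    then show ?thesis unfolding incr_def Let_def
      by (intro measurable_incr_aux s c[OF k s g] c[OF _ s g])
  qed
  then show ?case
    unfolding Phi_eq split_beta by (intro borel_measurable_sum borel_measurable_divide) auto
qed

lemma measurable_Phi_compose[measurable (raw)]: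
  assumes "f \<in> measurable A (borel_Rd d)" "g \<in> measurable A Pi_mu"
  shows "(\<lambda>w. Phi n (f w) (g w)) \<in> borel_measurable A"
  using measurable_compose[OF measurable_Pair[OF assms] measurable_Phi] by simp

lemma indep_coordinates: "P.indep_vars (\<lambda>_. \<mu>) (\<lambda>i z. z i) Theta"
proof (subst P.indep_vars_iff_distr_eq_PiM')
  show "Theta \<noteq> {}" using pair_in_Theta by blast
  have "distr Pi_mu Pi_mu (\<lambda>z. \<lambda>i\<in>Theta. z i) = distr Pi_mu Pi_mu (\<lambda>z. z)"
    by (intro distr_cong) (auto simp: space_PiM PiE_def extensional_restrict)
  also have "\<dots> = Pi_mu" by (simp add: distr_id2)
  also have "\<dots> = Pi\<^sub>M Theta (\<lambda>i. distr Pi_mu \<mu> (\<lambda>z. z i))"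
    by (intro PiM_cong refl distr_PiM_component[symmetric] prob_mu)
  finally show "distr Pi_mu Pi_mu (\<lambda>z. \<lambda>i\<in>Theta. z i) = Pi\<^sub>M Theta (\<lambda>i. distr Pi_mu \<mu> (\<lambda>z. z i))" .
qed auto

text \<open>Every tuple \<open>\<eta>' @ \<xi>\<close> with \<open>\<xi>\<close> in
  \<open>Theta\<close> is longer than \<open>\<eta>\<close>, so the two components read disjoint
  coordinates and are independent. The two prefixes may differ, which covers the noise below
  \<open>[k, m]\<close> as well as below \<open>[k, - m]\<close>, next to the point sampled at
  \<open>[k, m]\<close>.\<close>

lemma law_coordinate_subfamily:
  assumes "\<eta> \<noteq> []" "length \<eta> = length \<eta>'"
  shows "distr Pi_mu (\<mu> \<Otimes>\<^sub>M Pi_mu) (\<lambda>z. (z \<eta>, subfamily \<eta>' z)) = \<mu> \<Otimes>\<^sub>M Pi_mu"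
proof -
  have \<eta>: "\<eta> \<in> Theta" using assms by (simp add: Theta_def)
  let ?B = "(@) \<eta>' ` Theta"
  have disj: "{\<eta>} \<inter> ?B = {}" using assms by (auto simp: Theta_def)
  have "P.indep_var (Pi\<^sub>M {\<eta>} (\<lambda>_. \<mu>)) (\<lambda>z. restrict (\<lambda>i. z i) {\<eta>}) (Pi\<^sub>M ?B (\<lambda>_. \<mu>)) (\<lambda>z. restrict (\<lambda>i. z i) ?B)"
    by (rule P.indep_var_restrict[OF indep_coordinates disj]) (use \<eta> append_in_Theta in auto)
  then have eq: "distr Pi_mu (Pi\<^sub>M {\<eta>} (\<lambda>_. \<mu>) \<Otimes>\<^sub>M Pi\<^sub>M ?B (\<lambda>_. \<mu>)) (\<lambda>z. (restrict z {\<eta>}, restrict z ?B))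
      = distr Pi_mu (Pi\<^sub>M {\<eta>} (\<lambda>_. \<mu>)) (\<lambda>z. restrict z {\<eta>}) \<Otimes>\<^sub>M distr Pi_mu (Pi\<^sub>M ?B (\<lambda>_. \<mu>)) (\<lambda>z. restrict z ?B)"
    unfolding P.indep_var_distribution_eq by simp
  have r: "(\<lambda>z. restrict z {\<eta>}) \<in> measurable Pi_mu (Pi\<^sub>M {\<eta>} (\<lambda>_. \<mu>))"
    "(\<lambda>z. restrict z ?B) \<in> measurable Pi_mu (Pi\<^sub>M ?B (\<lambda>_. \<mu>))"
    by (rule measurable_restrict_subset; use \<eta> append_in_Theta in auto)+
  have e: "(\<lambda>w. w \<eta>) \<in> measurable (Pi\<^sub>M {\<eta>} (\<lambda>_. \<mu>)) \<mu>"
    by (rule measurable_component_singleton) simp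
  have sb: "subfamily \<eta>' \<in> measurable (Pi\<^sub>M ?B (\<lambda>_. \<mu>)) Pi_mu"
    by (rule measurable_subfamily) (auto simp: append_in_Theta)
  have se: "subfamily \<eta>' (restrict z ?B) = subfamily \<eta>' z" for z :: "int list \<Rightarrow> nat \<Rightarrow> real"
    by (auto simp: subfamily_def fun_eq_iff)
  have d1: "distr (distr Pi_mu (Pi\<^sub>M {\<eta>} (\<lambda>_. \<mu>)) (\<lambda>z. restrict z {\<eta>})) \<mu> (\<lambda>w. w \<eta>) = distr Pi_mu \<mu> (\<lambda>z. z \<eta>)"
    by (subst distr_distr[OF e r(1)]) (simp add: comp_def)
  have d2: "distr (distr Pi_mu (Pi\<^sub>M ?B (\<lambda>_. \<mu>)) (\<lambda>z. restrict z ?B)) Pi_mu (subfamily \<eta>') = distr Pi_mu Pi_mu (subfamily \<eta>')"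
    by (subst distr_distr[OF sb r(2)]) (simp add: comp_def se)
  have m12: "(\<lambda>(v, w). (v \<eta>, subfamily \<eta>' w)) \<in> measurable (Pi\<^sub>M {\<eta>} (\<lambda>_. \<mu>) \<Otimes>\<^sub>M Pi\<^sub>M ?B (\<lambda>_. \<mu>)) (\<mu> \<Otimes>\<^sub>M Pi_mu)"
    unfolding split_beta by (intro measurable_Pair measurable_compose[OF measurable_fst e] measurable_compose[OF measurable_snd sb])
  have m0: "(\<lambda>z. (restrict z {\<eta>}, restrict z ?B)) \<in> measurable Pi_mu (Pi\<^sub>M {\<eta>} (\<lambda>_. \<mu>) \<Otimes>\<^sub>M Pi\<^sub>M ?B (\<lambda>_. \<mu>))"
    by (intro measurable_Pair r)
  have "distr Pi_mu (\<mu> \<Otimes>\<^sub>M Pi_mu) (\<lambda>z. (z \<eta>, subfamily \<eta>' z))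
      = distr (distr Pi_mu (Pi\<^sub>M {\<eta>} (\<lambda>_. \<mu>) \<Otimes>\<^sub>M Pi\<^sub>M ?B (\<lambda>_. \<mu>)) (\<lambda>z. (restrict z {\<eta>}, restrict z ?B)))
          (\<mu> \<Otimes>\<^sub>M Pi_mu) (\<lambda>(v, w). (v \<eta>, subfamily \<eta>' w))"
    by (subst distr_distr[OF m12 m0]) (simp add: comp_def se)
  also have "\<dots> = distr Pi_mu \<mu> (\<lambda>z. z \<eta>) \<Otimes>\<^sub>M distr Pi_mu Pi_mu (subfamily \<eta>')"
    unfolding eq d1[symmetric] d2[symmetric]
  proof (rule pair_measure_distr[symmetric])
    interpret D: prob_space "distr Pi_mu (Pi\<^sub>M ?B (\<lambda>_. \<mu>)) (\<lambda>z. restrict z ?B)" by (rule P.prob_space_distr[OF r(2)])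
    interpret D': prob_space "distr (distr Pi_mu (Pi\<^sub>M ?B (\<lambda>_. \<mu>)) (\<lambda>z. restrict z ?B)) Pi_mu (subfamily \<eta>')"
      by (rule D.prob_space_distr) (use sb in simp)
    show "sigma_finite_measure (distr (distr Pi_mu (Pi\<^sub>M ?B (\<lambda>_. \<mu>)) (\<lambda>z. restrict z ?B)) Pi_mu (subfamily \<eta>'))" ..
  qed (use e sb in simp_all)
  finally have "distr Pi_mu (\<mu> \<Otimes>\<^sub>M Pi_mu) (\<lambda>z. (z \<eta>, subfamily \<eta>' z))
      = distr Pi_mu \<mu> (\<lambda>z. z \<eta>) \<Otimes>\<^sub>M distr Pi_mu Pi_mu (subfamily \<eta>')" .
  moreover have "distr Pi_mu \<mu> (\<lambda>z. z \<eta>) = \<mu>"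
    by (intro distr_PiM_component prob_mu \<eta>)
  moreover have "distr Pi_mu Pi_mu (subfamily \<eta>') = Pi_mu"
    unfolding subfamily_def
    by (rule distr_PiM_reindex[where M="\<lambda>_. \<mu>"]) (auto simp: prob_mu append_in_Theta inj_on_def)
  ultimately show ?thesis by simp
qed

lemma indep_incr:
  assumes x: "x \<in> Rd d"
  shows "P.indep_vars (\<lambda>_. borel) (\<lambda>m. incr k m x) {1..N}"
proof -
  \<comment> \<open>The coordinates that \<open>incr k m x\<close> reads: the sampling point and
    everything below \<open>[k, m]\<close> and \<open>[k, - m]\<close>. For positive
    \<open>m\<close> these sets are pairwise disjoint, since the second entry of a tuple determines
    \<open>m\<close> up to its sign.\<close>
  define K where "K m = insert [int k, int m] ((@) [int k, int m] ` Theta \<union> (@) [int k, - int m] ` Theta)" for m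
  have K: "K m \<subseteq> Theta" for m by (auto simp: K_def Theta_def)
  have disj: "disjoint_family_on K {1..N}"
    by (auto simp: disjoint_family_on_def K_def)
  have [measurable]: "incr k m x \<in> borel_measurable (Pi\<^sub>M (K m) (\<lambda>_. \<mu>))" for m
  proof -
    have [measurable]: "(\<lambda>_. x) \<in> measurable (Pi\<^sub>M (K m) (\<lambda>_. \<mu>)) (borel_Rd d)"
      by (rule measurable_const_Rd[OF x])
    have [measurable]: "(\<lambda>z. z [int k, int m]) \<in> measurable (Pi\<^sub>M (K m) (\<lambda>_. \<mu>)) (borel_Rd d)"
      by (rule measurable_coordinate) (simp add: K_def)
    have s: "(\<lambda>w. translate d x (w [int k, int m])) \<in> measurable (Pi\<^sub>M (K m) (\<lambda>_. \<mu>)) (borel_Rd d)"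
      by measurable
    have g: "subfamily [int k, int m] \<in> measurable (Pi\<^sub>M (K m) (\<lambda>_. \<mu>)) Pi_mu"
      "subfamily [int k, - int m] \<in> measurable (Pi\<^sub>M (K m) (\<lambda>_. \<mu>)) Pi_mu"
      by (rule measurable_subfamily; use K in \<open>auto simp: K_def\<close>)+
    show ?thesis unfolding incr_def Let_def
      by (intro measurable_incr_aux s measurable_Phi_compose[OF s] g)
  qed
  have "P.indep_vars (\<lambda>m. Pi\<^sub>M (K m) (\<lambda>_. \<mu>)) (\<lambda>m z. restrict (\<lambda>i. z i) (K m)) {1..N}"
    by (rule P.indep_vars_restrict[OF indep_coordinates K disj])
  then have "P.indep_vars (\<lambda>_. borel) (\<lambda>m z. incr k m x (restrict (\<lambda>i. z i) (K m))) {1..N}"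
    by (rule P.indep_vars_compose2) auto
  moreover have "incr k m x (restrict (\<lambda>i. z i) (K m)) = incr k m x z" for m z
  proof -
    have "subfamily [int k, int m] (restrict z (K m)) = subfamily [int k, int m] z"
      "subfamily [int k, - int m] (restrict z (K m)) = subfamily [int k, - int m] z"
      by (auto simp: subfamily_def fun_eq_iff K_def)
    moreover have "[int k, int m] \<in> K m" by (simp add: K_def)
    ultimately show ?thesis by (cases "k = 0") (simp_all add: incr_def Let_def)
  qed
  ultimately show ?thesis by simp
qed

text \<open>The bias-variance decomposition: the expectations of the increments telescope to
  \<open>E F(Y, Phi (n - 1) Y)\<close>, and every level contributes the standard deviation of an average of
  \<open>M ^ (n - k)\<close> independent copies.\<close>

theorem L2_error:
  fixes u \<psi> :: "(nat \<Rightarrow> real) \<Rightarrow> real" and q s K a r :: real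
  assumes u[measurable]: "u \<in> borel_measurable (borel_Rd d)"
    and q: "0 \<le> q" and s: "0 \<le> s" and K: "0 \<le> K" and a: "0 \<le> a" and r: "0 < r"
    and \<psi>[measurable]: "\<psi> \<in> borel_measurable (borel_Rd d)" and \<psi>0: "\<And>x. 0 \<le> \<psi> x"
    and \<psi>L2: "\<And>x. x \<in> Rd d \<Longrightarrow> L2_le \<mu> (\<lambda>y. \<psi> (translate d x y)) (s * \<psi> x)"
    and lip: "\<And>y v w. y \<in> Rd d \<Longrightarrow> \<bar>F y v - F y w\<bar> \<le> q * \<bar>v - w\<bar>"
    and F0: "\<And>y. y \<in> Rd d \<Longrightarrow> \<bar>F y 0\<bar> \<le> K * \<psi> y"
    and ufix: "\<And>x. x \<in> Rd d \<Longrightarrow> u x = (\<integral>y. F (translate d x y) (u (translate d x y)) \<partial>\<mu>)"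
    and ub: "\<And>x. x \<in> Rd d \<Longrightarrow> \<bar>u x\<bar> \<le> a * \<psi> x"
    and rec: "\<And>n. 1 \<le> n \<Longrightarrow>
      (\<Sum>k\<in>{0..<n}. (if k = 0 then s * K else q * s * a * (r ^ k + r ^ (k - 1))) / sqrt (real (M ^ (n - k))))
        + q * s * a * r ^ (n - 1) \<le> a * r ^ n"
    and x: "x \<in> Rd d"
  shows "L2_le Pi_mu (\<lambda>z. Phi n x z - u x) (a * r ^ n * \<psi> x)"
  using x
proof (induction n arbitrary: x rule: less_induct)
  case (less n)
  note x = less.prems
  show ?case
  proof (cases "n = 0")
    case True
    have "L2_le Pi_mu (\<lambda>z. - u x) (a * \<psi> x)"
      by (rule L2_le_mono[OF P.L2_le_const]) (use ub[OF x] in simp)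
    then show ?thesis using True by (simp add: Phi_0)
  next
    case False
    \<comment> \<open>\<open>b k * \<psi> x\<close> will bound the norm of a single increment of
      level \<open>k\<close>. Level 0 is not a difference of iterates, so there the size
      \<open>K\<close> of \<open>F y 0\<close> enters instead of the errors.\<close>
    define b where "b k = (if k = 0 then s * K else q * s * a * (r ^ k + r ^ (k - 1)))" for k :: nat
    have cx: "(\<lambda>_. x) \<in> measurable A (borel_Rd d)" for A :: "'c measure"
      by (rule measurable_const_Rd[OF x])
    have t2: "(\<lambda>y. translate d x y) \<in> measurable \<mu> (borel_Rd d)"
      by (rule measurable_translate[OF cx measurable_ident_sets[OF sets_mu]])
    have t1: "(\<lambda>w. translate d x (fst w)) \<in> measurable (\<mu> \<Otimes>\<^sub>M Pi_mu) (borel_Rd d)"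
      by (rule measurable_compose[OF measurable_fst t2])
    have uY: "(\<lambda>y. u (translate d x y)) \<in> borel_measurable \<mu>" using measurable_compose[OF t2 u] .
    \<comment> \<open>Subtracting the common value \<open>F Y (u Y)\<close> from both terms of an
      increment makes each of them comparable to an error \<open>Phi k Y - u Y\<close>, to which the
      Lipschitz bound and the induction hypothesis apply.\<close>
    define H where "H k w = F (translate d x (fst w)) (Phi k (translate d x (fst w)) (snd w))
        - F (translate d x (fst w)) (u (translate d x (fst w)))" for k w
    have H_meas: "H k \<in> borel_measurable (\<mu> \<Otimes>\<^sub>M Pi_mu)" for k unfolding H_def
      by (intro borel_measurable_diff measurable_F t1 measurable_Phi_compose measurable_snd
          measurable_compose[OF t1 u])
    \<comment> \<open>The inner norm, with the sampling point \<open>Y\<close> frozen, is at most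
      \<open>q * a * r ^ k * \<psi> Y\<close> by the induction hypothesis at \<open>Y\<close>;
      averaging \<open>\<psi> Y\<close> afterwards costs the factor \<open>s\<close>.\<close>
    have H: "L2_le (\<mu> \<Otimes>\<^sub>M Pi_mu) (H k) (q * s * a * r ^ k * \<psi> x)" if k: "k < n" for k
    proof (rule L2_le_pair[OF P.sigma_finite_measure_axioms H_meas])
      have "L2_le \<mu> (\<lambda>y. (q * a * r ^ k) * \<psi> (translate d x y)) (\<bar>q * a * r ^ k\<bar> * (s * \<psi> x))"
        by (rule L2_le_cmult[OF \<psi>L2[OF x]])
      then show "L2_le \<mu> (\<lambda>y. (q * a * r ^ k) * \<psi> (translate d x y)) (q * s * a * r ^ k * \<psi> x)"
        using q a r by (simp add: mult_ac)
    next
      fix y assume "y \<in> space \<mu>"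
      let ?Y = "translate d x y"
      have Y: "?Y \<in> Rd d" by simp
      have "L2_le Pi_mu (\<lambda>z. q * (Phi k ?Y z - u ?Y)) (\<bar>q\<bar> * (a * r ^ k * \<psi> ?Y))"
        by (rule L2_le_cmult[OF less.IH[OF k Y]])
      then show "L2_le Pi_mu (\<lambda>z. H k (y, z)) (q * a * r ^ k * \<psi> ?Y)"
      proof (rule L2_le_bound[THEN L2_le_mono])
        show "(\<lambda>z. H k (y, z)) \<in> borel_measurable Pi_mu"
          by (rule measurable_compose[OF measurable_Pair1'[OF \<open>y \<in> space \<mu>\<close>] H_meas])
        show "\<bar>H k (y, z)\<bar> \<le> \<bar>q * (Phi k ?Y z - u ?Y)\<bar>" for z
          using lip[OF Y, of "Phi k ?Y z" "u ?Y"] q by (simp add: H_def abs_mult)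
        show "\<bar>q\<bar> * (a * r ^ k * \<psi> ?Y) \<le> q * a * r ^ k * \<psi> ?Y" using q by (simp add: mult_ac)
      qed
    qed
    \<comment> \<open>\<open>H j\<close> at the point sampled at \<open>[k, m]\<close>, with the
      noise from below \<open>[k, m]\<close> if \<open>j = k\<close> and from below
      \<open>[k, - m]\<close> otherwise. By \<open>law\<close> both variants are distributed like
      \<open>H j\<close>.\<close>
    define Hz where "Hz k m j z = H j (z [int k, m], subfamily [int k, (if j = k then m else - m)] z)" for k j and m :: int and z
    have law: "distr Pi_mu (\<mu> \<Otimes>\<^sub>M Pi_mu) (\<lambda>z. (z [k, m], subfamily [k, m'] z)) = \<mu> \<Otimes>\<^sub>M Pi_mu" for k m m'
      by (rule law_coordinate_subfamily) auto
    have pm: "(\<lambda>z. (z [k, m], subfamily [k, m'] z)) \<in> measurable Pi_mu (\<mu> \<Otimes>\<^sub>M Pi_mu)" for k m m'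
      by (intro measurable_Pair measurable_subfamily' measurable_component_singleton) simp
    have Hz: "L2_le Pi_mu (Hz k m j) (q * s * a * r ^ j * \<psi> x)" if "j < n" for k j m
      using H[OF that] L2_le_distr[OF pm H_meas, of "int k" m "if j = k then m else - m" j "q * s * a * r ^ j * \<psi> x"]
      unfolding Hz_def[abs_def] law by simp
    define g where "g k = (\<integral>w. H k w \<partial>(\<mu> \<Otimes>\<^sub>M Pi_mu))" for k
    have EHz: "(\<integral>z. Hz k m j z \<partial>Pi_mu) = g j" for k j m
      using integral_distr[OF pm H_meas, of "int k" m "if j = k then m else - m" j]
      unfolding Hz_def[abs_def] g_def law by simp
    have incr_H: "incr k m x z = Hz k (int m) k z - Hz k (int m) (k - 1) z" if "k \<noteq> 0" for k m z
    proof -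
      have "k - 1 \<noteq> k" using that by simp
      then show ?thesis using that unfolding incr_def Hz_def H_def Let_def by simp
    qed
    have F0L: "L2_le \<mu> (\<lambda>y. F (translate d x y) 0) (s * K * \<psi> x)"
    proof (rule L2_le_mono[OF L2_le_bound[OF L2_le_cmult[OF \<psi>L2[OF x], of K]]])
      show "(\<lambda>y. F (translate d x y) 0) \<in> borel_measurable \<mu>" by (intro measurable_F t2 borel_measurable_const)
      show "\<bar>F (translate d x y) 0\<bar> \<le> \<bar>K * \<psi> (translate d x y)\<bar>" for y
        using F0[of "translate d x y"] by simp
    qed (use K in \<open>simp add: mult_ac\<close>)
    have FuL: "L2_le \<mu> (\<lambda>y. F (translate d x y) (u (translate d x y))) ((K + q * a) * (s * \<psi> x))"
    proof (rule L2_le_mono[OF L2_le_bound[OF L2_le_cmult[OF \<psi>L2[OF x], of "K + q * a"]]])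
      show "(\<lambda>y. F (translate d x y) (u (translate d x y))) \<in> borel_measurable \<mu>"
        by (intro measurable_F t2 uY)
      fix y
      let ?Y = "translate d x y"
      have "\<bar>F ?Y (u ?Y)\<bar> \<le> \<bar>F ?Y 0\<bar> + q * \<bar>u ?Y\<bar>" using lip[of ?Y "u ?Y" 0] by simp
      also have "\<dots> \<le> K * \<psi> ?Y + q * (a * \<psi> ?Y)"
        by (intro add_mono F0 mult_left_mono ub q) auto
      also have "\<dots> = \<bar>(K + q * a) * \<psi> ?Y\<bar>" using K q a \<psi>0[of ?Y] by (simp add: algebra_simps)
      finally show "\<bar>F ?Y (u ?Y)\<bar> \<le> \<bar>(K + q * a) * \<psi> ?Y\<bar>" .
    qed (use K q a in simp)
    have incr0: "incr 0 m x z = F (translate d x (z [0, int m])) 0" for m z by (simp add: incr_def)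
    have zm: "(\<lambda>z. z [k, m]) \<in> measurable Pi_mu \<mu>" for k m by (rule measurable_component_singleton) simp
    have law1: "distr Pi_mu \<mu> (\<lambda>z. z [k, m]) = \<mu>" for k m by (rule distr_PiM_component[OF prob_mu]) simp
    \<comment> \<open>At level 0 nothing cancels the mean of \<open>F Y (u Y)\<close>, which is
      \<open>u x\<close> by the fixed point equation. This is how \<open>u x\<close> enters the
      telescoping sum.\<close>
    have g0: "(\<integral>y. F (translate d x y) 0 \<partial>\<mu>) = g 0 + u x"
    proof -
      interpret PP: pair_sigma_finite \<mu> Pi_mu ..
      have f: "distr (\<mu> \<Otimes>\<^sub>M Pi_mu) \<mu> fst = \<mu>" by (rule P.distr_pair_fst)
      have m: "(\<lambda>y. F (translate d x y) 0 - F (translate d x y) (u (translate d x y))) \<in> borel_measurable \<mu>"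
        using L2_leD(1)[OF F0L] L2_leD(1)[OF FuL] by simp
      have "g 0 = (\<integral>y. F (translate d x y) 0 - F (translate d x y) (u (translate d x y)) \<partial>\<mu>)"
        using integral_distr[OF measurable_fst m, of Pi_mu] unfolding f g_def H_def Phi_0 by simp
      also have "\<dots> = (\<integral>y. F (translate d x y) 0 \<partial>\<mu>) - u x"
        using mu.L2_le_mean(1)[OF F0L] mu.L2_le_mean(1)[OF FuL] ufix[OF x] by simp
      finally show ?thesis by simp
    qed
    define e where "e k = (if k = 0 then g 0 + u x else g k - g (k - 1))" for k
    have incr_L2: "L2_le Pi_mu (incr k m x) (b k * \<psi> x)" if k: "k < n" for k m
    proof (cases "k = 0")
      case True
      show ?thesis
        using F0L L2_le_distr[OF zm L2_leD(1)[OF F0L], of 0 "int m" "s * K * \<psi> x"]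
        unfolding law1 True incr0[abs_def] b_def by simp
    next
      case False
      then have "L2_le Pi_mu (\<lambda>z. Hz k (int m) k z - Hz k (int m) (k - 1) z)
          (q * s * a * r ^ k * \<psi> x + q * s * a * r ^ (k - 1) * \<psi> x)"
        using k by (intro L2_le_diff Hz) auto
      moreover have "incr k m x = (\<lambda>z. Hz k (int m) k z - Hz k (int m) (k - 1) z)"
        by (rule ext) (rule incr_H[OF False])
      moreover have "q * s * a * r ^ k * \<psi> x + q * s * a * r ^ (k - 1) * \<psi> x = b k * \<psi> x"
        using False by (simp add: b_def algebra_simps)
      ultimately show ?thesis by simp
    qed
    have incr_E: "(\<integral>z. incr k m x z \<partial>Pi_mu) = e k" if k: "k < n" for k m
    proof (cases "k = 0")
      case True
      show ?thesis
        using integral_distr[OF zm L2_leD(1)[OF F0L], of 0 "int m"] g0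
        unfolding law1 True incr0[abs_def] e_def by simp
    next
      case False
      then show ?thesis
        using P.L2_le_mean(1)[OF Hz, of k k "int m"] P.L2_le_mean(1)[OF Hz, of "k - 1" k "int m"] k
        unfolding incr_H[OF False] by (simp add: EHz e_def)
    qed
    have avg: "L2_le Pi_mu (\<lambda>z. (\<Sum>m\<in>{1..M ^ (n - k)}. incr k m x z) / real (M ^ (n - k)) - e k)
        (b k * \<psi> x / sqrt (real (M ^ (n - k))))" if k: "k < n" for k
    proof -
      have "L2_le Pi_mu (\<lambda>z. (\<Sum>m\<in>{1..M ^ (n - k)}. incr k m x z) / real (card {1..M ^ (n - k)}) - e k)
        (b k * \<psi> x / sqrt (real (card {1..M ^ (n - k)})))"
        by (rule P.L2_le_indep_average[OF _ _ indep_incr[OF x]])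
          (use M_pos k in \<open>auto simp: incr_L2 incr_E Suc_le_eq\<close>)
      then show ?thesis by simp
    qed
    have tel: "(\<Sum>k\<in>{0..<n}. e k) = g (n - 1) + u x"
    proof -
      have "(\<Sum>k\<in>{0..<Suc j}. e k) = g j + u x" for j
        by (induction j) (auto simp: e_def)
      from this[of "n - 1"] show ?thesis using False by simp
    qed
    have PPp: "prob_space (\<mu> \<Otimes>\<^sub>M Pi_mu)"
      by (intro prob_space_pair prob_mu prob_Pi_mu)
    have g_le: "\<bar>g (n - 1)\<bar> \<le> q * s * a * r ^ (n - 1) * \<psi> x"
      unfolding g_def by (rule prob_space.L2_le_mean(2)[OF PPp H]) (use False in simp)
    \<comment> \<open>Each level is centred at its mean. Beyond \<open>u x\<close>, the telescoped
      means leave only the constant \<open>g (n - 1)\<close>, which is the bias.\<close>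
    have "L2_le Pi_mu (\<lambda>z. (\<Sum>k\<in>{0..<n}. (\<Sum>m\<in>{1..M ^ (n - k)}. incr k m x z) / real (M ^ (n - k)) - e k) + g (n - 1))
       ((\<Sum>k\<in>{0..<n}. b k * \<psi> x / sqrt (real (M ^ (n - k)))) + \<bar>g (n - 1)\<bar>)"
      by (intro L2_le_add L2_le_sum avg P.L2_le_const) auto
    moreover have "(\<Sum>k\<in>{0..<n}. (\<Sum>m\<in>{1..M ^ (n - k)}. incr k m x z) / real (M ^ (n - k)) - e k) + g (n - 1)
        = Phi n x z - u x" for z
      unfolding Phi_eq[of n] sum_subtractf tel by simp
    moreover have "(\<Sum>k\<in>{0..<n}. b k * \<psi> x / sqrt (real (M ^ (n - k)))) + \<bar>g (n - 1)\<bar> \<le> a * r ^ n * \<psi> x"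
    proof -
      have "(\<Sum>k\<in>{0..<n}. b k * \<psi> x / sqrt (real (M ^ (n - k)))) + \<bar>g (n - 1)\<bar>
          \<le> (\<Sum>k\<in>{0..<n}. b k * \<psi> x / sqrt (real (M ^ (n - k)))) + q * s * a * r ^ (n - 1) * \<psi> x"
        using g_le by simp
      also have "\<dots> = ((\<Sum>k\<in>{0..<n}. b k / sqrt (real (M ^ (n - k)))) + q * s * a * r ^ (n - 1)) * \<psi> x"
        by (simp add: distrib_right sum_distrib_right)
      also have "\<dots> \<le> a * r ^ n * \<psi> x"
        using rec[of n] False \<psi>0[of x] unfolding b_def by (intro mult_right_mono) auto
      finally show ?thesis .
    qed
    ultimately show ?thesis by (auto intro: L2_le_mono)
  qed
qed

end

section \<open>Brownian motion at an exponential time\<close>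

text \<open>Paths are only separately measurable in \<open>\<omega>\<close>; continuity in time makes the evaluation at a random
  time a limit of evaluations on grids.\<close>

lemma measurable_continuous_paths:
  fixes X :: "real \<Rightarrow> 'a \<Rightarrow> nat \<Rightarrow> real"
  assumes X: "\<And>t. 0 \<le> t \<Longrightarrow> X t \<in> measurable G (borel_Rd d)"
    and cont: "\<And>\<omega>. \<omega> \<in> space G \<Longrightarrow> continuous_on {0..} (\<lambda>t. X t \<omega>)"
  shows "(\<lambda>p. X (max 0 (fst p)) (snd p)) \<in> measurable (borel \<Otimes>\<^sub>M G) (borel_Rd d)"
proof (rule measurable_PiM_single')
  show "(\<lambda>p. X (max 0 (fst p)) (snd p)) \<in> space (borel \<Otimes>\<^sub>M G) \<rightarrow> (\<Pi>\<^sub>E i\<in>{1..d}. space borel)"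
  proof
    fix p :: "real \<times> 'a" assume "p \<in> space (borel \<Otimes>\<^sub>M G)"
    then have "snd p \<in> space G" by (auto simp: space_pair_measure)
    with measurable_space[OF X, of "max 0 (fst p)" "snd p"]
    show "X (max 0 (fst p)) (snd p) \<in> (\<Pi>\<^sub>E i\<in>{1..d}. space borel)" by (simp add: space_PiM)
  qed
  fix j assume j: "j \<in> {1..d}"
  \<comment> \<open>The largest multiple of \<open>1 / (n + 1)\<close> that does not exceed the
    time: it takes countably many values and converges to the time. The \<open>max 0\<close> extends
    the paths to negative times, so that evaluation is defined on the whole line.\<close>
  define \<tau> where "\<tau> n t = real (nat \<lfloor>max 0 t * real (Suc n)\<rfloor>) / real (Suc n)" for n and t :: real
  show "(\<lambda>p. X (max 0 (fst p)) (snd p) j) \<in> borel_measurable (borel \<Otimes>\<^sub>M G)"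
  proof (rule borel_measurable_LIMSEQ_real)
    fix n
    have m: "(\<lambda>p. X (real i / real (Suc n)) (snd p) j) \<in> borel_measurable (borel \<Otimes>\<^sub>M G)" for i :: nat
      by (rule measurable_compose[OF measurable_snd measurable_compose[OF X measurable_component_singleton[OF j]]]) simp
    have "(\<lambda>p. nat \<lfloor>max 0 (fst p) * real (Suc n)\<rfloor>) \<in> measurable (borel \<Otimes>\<^sub>M G) (count_space UNIV)"
      by measurable
    from measurable_compose_countable[OF m this]
    show "(\<lambda>p. X (\<tau> n (fst p)) (snd p) j) \<in> borel_measurable (borel \<Otimes>\<^sub>M G)" unfolding \<tau>_def .
  next
    fix p :: "real \<times> 'a" assume "p \<in> space (borel \<Otimes>\<^sub>M G)"
    then have \<omega>: "snd p \<in> space G" by (auto simp: space_pair_measure)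
    have c: "continuous_on {0..} (\<lambda>t. X t (snd p) j)"
      by (rule continuous_on_product_then_coordinatewise[OF cont[OF \<omega>]])
    have lim: "(\<lambda>n. \<tau> n (fst p)) \<longlonglongrightarrow> max 0 (fst p)"
    proof (rule LIMSEQ_I)
      fix e :: real assume "0 < e"
      then obtain n0 where n0: "inverse (real (Suc n0)) < e" using reals_Archimedean by blast
      show "\<exists>no. \<forall>n\<ge>no. norm (\<tau> n (fst p) - max 0 (fst p)) < e"
      proof (intro exI allI impI)
        fix n assume "n0 \<le> n"
        define N where "N = real (Suc n)"
        define a where "a = max 0 (fst p)"
        have "inverse N \<le> inverse (real (Suc n0))"
          unfolding N_def using \<open>n0 \<le> n\<close> by (intro le_imp_inverse_le) auto
        with n0 have "inverse N < e" by linarith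
        then have N: "0 < N" "inverse N < e" by (simp_all add: N_def)
        have a: "0 \<le> a * N" using N by (simp add: a_def)
        have fl: "real (nat \<lfloor>a * N\<rfloor>) = of_int \<lfloor>a * N\<rfloor>" using a by simp
        have "a * N - 1 < of_int \<lfloor>a * N\<rfloor>" "of_int \<lfloor>a * N\<rfloor> \<le> a * N" by linarith+
        moreover have "(a - inverse N) * N = a * N - 1" using N by (simp add: algebra_simps)
        ultimately have "a - inverse N < of_int \<lfloor>a * N\<rfloor> / N" "of_int \<lfloor>a * N\<rfloor> / N \<le> a"
          using N(1) by (simp_all add: pos_less_divide_eq pos_divide_le_eq)
        then show "norm (\<tau> n (fst p) - max 0 (fst p)) < e"
          using N fl unfolding \<tau>_def N_def[symmetric] a_def[symmetric] by simp
      qed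
    qed
    have "\<tau> n (fst p) \<in> {0..}" for n by (simp add: \<tau>_def)
    then show "(\<lambda>n. X (\<tau> n (fst p)) (snd p) j) \<longlonglongrightarrow> X (max 0 (fst p)) (snd p) j"
      by (intro continuous_on_tendsto_compose[OF c lim]) auto
  qed
qed

text \<open>A finite intersection of sets from both families splits into one event of
  \<open>V1\<close> and one of \<open>V2\<close>; independence of these two factors the probability,
  and independence inside each family does the rest.\<close>

lemma (in prob_space) indep_sets_combine:
  fixes F1 F2 :: "'b \<Rightarrow> 'a set set"
  assumes F1: "indep_sets F1 I" and F2: "indep_sets F2 I"
    and V: "indep_set (sets V1) (sets V2)" "space V1 = space M" "space V2 = space M"
    and sub: "\<And>i. i \<in> I \<Longrightarrow> F1 i \<subseteq> sets V1" "\<And>i. i \<in> I \<Longrightarrow> F2 i \<subseteq> sets V2"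
  shows "indep_sets (\<lambda>(b, i). if b then F1 i else F2 i) (UNIV \<times> I)"
proof -
  define E where "E = (\<lambda>(b, i). if b then F1 i else F2 i)"
  have ev: "E bi \<subseteq> events" if "bi \<in> UNIV \<times> I" for bi
  proof -
    have "\<forall>i\<in>I. F1 i \<subseteq> events" "\<forall>i\<in>I. F2 i \<subseteq> events"
      using F1 F2 unfolding indep_sets_def by blast+
    then show ?thesis using that by (cases bi) (simp add: E_def)
  qed
  have pr: "prob (\<Inter>j\<in>J. A j) = (\<Prod>j\<in>J. prob (A j))"
    if J: "J \<subseteq> UNIV \<times> I" "finite J" and A: "\<forall>j\<in>J. A j \<in> E j" and J0: "J \<noteq> {}" for A J
  proof -
    define J1 where "J1 = {i. (True, i) \<in> J}"
    define J2 where "J2 = {i. (False, i) \<in> J}"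
    have eqJ: "J = Pair True ` J1 \<union> Pair False ` J2"
    proof (rule set_eqI)
      fix bi :: "bool \<times> 'b"
      show "bi \<in> J \<longleftrightarrow> bi \<in> Pair True ` J1 \<union> Pair False ` J2"
        by (cases bi; cases "fst bi") (auto simp: J1_def J2_def)
    qed
    have fin: "finite J1" "finite J2"
      using J(2) unfolding eqJ by (auto dest!: finite_imageD simp: inj_on_def)
    have sI: "J1 \<subseteq> I" "J2 \<subseteq> I" using J(1) by (auto simp: J1_def J2_def)
    have A1: "A (True, i) \<in> F1 i" if "i \<in> J1" for i using A that by (auto simp: J1_def E_def)
    have A2: "A (False, i) \<in> F2 i" if "i \<in> J2" for i using A that by (auto simp: J2_def E_def)
    \<comment> \<open>Intersecting relative to the whole space covers an empty \<open>J1\<close> as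
      well, where \<open>S1\<close> is \<open>space M\<close> and the product is 1.\<close>
    define S1 where "S1 = {\<omega>\<in>space M. \<forall>i\<in>J1. \<omega> \<in> A (True, i)}"
    define S2 where "S2 = {\<omega>\<in>space M. \<forall>i\<in>J2. \<omega> \<in> A (False, i)}"
    have sV1: "A (True, i) \<in> sets V1" if "i \<in> J1" for i using A1[OF that] sub(1) sI that by blast
    have sV2: "A (False, i) \<in> sets V2" if "i \<in> J2" for i using A2[OF that] sub(2) sI that by blast
    have sp1: "A (True, i) \<subseteq> space M" if "i \<in> J1" for i using sets.sets_into_space[OF sV1[OF that]] V by simp
    have sp2: "A (False, i) \<subseteq> space M" if "i \<in> J2" for i using sets.sets_into_space[OF sV2[OF that]] V by simp
    have "{\<omega> \<in> space V1. \<omega> \<in> A (True, i)} = A (True, i)" if "i \<in> J1" for i using sp1[OF that] V by auto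
    then have S1: "S1 \<in> sets V1" unfolding S1_def V(2)[symmetric]
      by (intro sets.sets_Collect_finite_All fin) (simp add: sV1)
    have "{\<omega> \<in> space V2. \<omega> \<in> A (False, i)} = A (False, i)" if "i \<in> J2" for i using sp2[OF that] V by auto
    then have S2: "S2 \<in> sets V2" unfolding S2_def V(3)[symmetric]
      by (intro sets.sets_Collect_finite_All fin) (simp add: sV2)
    have p1: "prob S1 = (\<Prod>i\<in>J1. prob (A (True, i)))"
    proof (cases "J1 = {}")
      case False
      then have "S1 = (\<Inter>i\<in>J1. A (True, i))" using sp1 by (auto simp: S1_def)
      then show ?thesis using indep_setsD[OF F1 sI(1) False fin(1), of "\<lambda>i. A (True, i)"] A1 by simp
    qed (simp add: S1_def prob_space)
    have p2: "prob S2 = (\<Prod>i\<in>J2. prob (A (False, i)))"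
    proof (cases "J2 = {}")
      case False
      then have "S2 = (\<Inter>i\<in>J2. A (False, i))" using sp2 by (auto simp: S2_def)
      then show ?thesis using indep_setsD[OF F2 sI(2) False fin(2), of "\<lambda>i. A (False, i)"] A2 by simp
    qed (simp add: S2_def prob_space)
    have "(\<Inter>j\<in>J. A j) \<subseteq> space M"
      using J0 sp1 sp2 unfolding eqJ by blast
    then have "(\<Inter>j\<in>J. A j) = S1 \<inter> S2" unfolding eqJ S1_def S2_def by auto
    then have "prob (\<Inter>j\<in>J. A j) = prob S1 * prob S2" using indep_setD[OF V(1) S1 S2] by simp
    also have "\<dots> = (\<Prod>j\<in>J. prob (A j))"
      unfolding p1 p2 eqJ
      by (subst prod.union_disjoint) (use fin in \<open>auto simp: prod.reindex inj_on_def\<close>)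
    finally show ?thesis .
  qed
  show ?thesis unfolding E_def[symmetric]
    by (rule indep_setsI[OF ev]) (blast intro: pr)+
qed

section \<open>Gaussian laws and Brownian motion at an independent random time\<close>

abbreviation gauss :: "real \<Rightarrow> real \<Rightarrow> real measure" where
  "gauss m \<sigma> \<equiv> density lborel (\<lambda>y. ennreal (normal_density m \<sigma> y))"

text \<open>The law of \<open>x + sqrt 2 * W_t\<close>. The variance \<open>2 * t\<close> belongs to
  the semigroup generated by the full Laplacian rather than by half of it.\<close>

definition heat_measure :: "nat \<Rightarrow> real \<Rightarrow> (nat \<Rightarrow> real) \<Rightarrow> (nat \<Rightarrow> real) measure" where
  "heat_measure d t x = Pi\<^sub>M {1..d} (\<lambda>j. gauss (x j) (sqrt (2 * t)))"

lemma distr_gauss_affine: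
  assumes "0 < \<sigma>" "0 < a"
  shows "distr (gauss m \<sigma>) borel (\<lambda>y. b + a * y) = gauss (b + a * m) (a * \<sigma>)"
proof -
  interpret prob_space "gauss m \<sigma>" by (rule prob_space_normal_density[OF assms(1)])
  have "distributed (gauss m \<sigma>) lborel (\<lambda>y. y) (normal_density m \<sigma>)"
    by (auto simp: distributed_def distr_id2)
  from normal_density_affine[OF this, of a b] assms
  have "distr (gauss m \<sigma>) lborel (\<lambda>y. b + a * y) = gauss (b + a * m) (a * \<sigma>)"
    by (simp add: distributed_def)
  moreover have "distr (gauss m \<sigma>) borel (\<lambda>y. b + a * y) = distr (gauss m \<sigma>) lborel (\<lambda>y. b + a * y)"
    by (rule distr_cong) auto
  ultimately show ?thesis by simp
qed

text \<open>A product measure is determined by its values on boxes, and the affine map acts on each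
  coordinate separately.\<close>

lemma distr_product_gauss_affine:
  assumes s: "0 < s" and c: "0 < c"
  shows "distr (Pi\<^sub>M {1..d} (\<lambda>_. gauss 0 s)) (borel_Rd d) (\<lambda>w. translate d x (\<lambda>j\<in>{1..d}. c * w j))
    = Pi\<^sub>M {1..d} (\<lambda>j. gauss (x j) (c * s))"
proof (rule product_sigma_finite.PiM_eqI)
  let ?G = "gauss 0 s"
  let ?f = "\<lambda>w. translate d x (\<lambda>j\<in>{1..d}. c * w j)"
  have pG: "prob_space ?G" using s by (intro prob_space_normal_density) simp
  have pG': "prob_space (gauss (x j) (c * s))" for j using s c by (intro prob_space_normal_density) simp
  show "product_sigma_finite (\<lambda>j. gauss (x j) (c * s))"
    unfolding product_sigma_finite_def using pG' prob_space_imp_sigma_finite by blast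
  interpret G: product_sigma_finite "\<lambda>_::nat. ?G"
    unfolding product_sigma_finite_def using pG prob_space_imp_sigma_finite by blast
  show "sets (distr (Pi\<^sub>M {1..d} (\<lambda>_. ?G)) (borel_Rd d) ?f) = sets (Pi\<^sub>M {1..d} (\<lambda>j. gauss (x j) (c * s)))"
    unfolding sets_distr by (rule sets_PiM_cong) auto
  fix A assume "\<And>i. i \<in> {1..d} \<Longrightarrow> A i \<in> sets (gauss (x i) (c * s))"
  then have A: "A i \<in> sets borel" if "i \<in> {1..d}" for i using that by auto
  have mm: "?f \<in> measurable (Pi\<^sub>M {1..d} (\<lambda>_. ?G)) (borel_Rd d)"
    unfolding translate_def by (rule measurable_restrict) simp
  have pre: "(\<lambda>y. x i + c * y) -` A i \<in> sets borel" if "i \<in> {1..d}" for i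
    using measurable_sets[of "\<lambda>y. x i + c * y" borel borel, OF _ A[OF that]] by simp
  have AP: "Pi\<^sub>E {1..d} A \<in> sets (borel_Rd d)" using A by (intro sets_PiM_I_finite) auto
  have "emeasure (distr (Pi\<^sub>M {1..d} (\<lambda>_. ?G)) (borel_Rd d) ?f) (Pi\<^sub>E {1..d} A)
     = emeasure (Pi\<^sub>M {1..d} (\<lambda>_. ?G)) (Pi\<^sub>E {1..d} (\<lambda>i. (\<lambda>y. x i + c * y) -` A i))"
    by (subst emeasure_distr[OF mm AP], rule arg_cong[where f="emeasure _"])
       (auto simp: translate_def space_PiM PiE_def Pi_def extensional_def)
  also have "\<dots> = (\<Prod>i\<in>{1..d}. emeasure ?G ((\<lambda>y. x i + c * y) -` A i))"
    using pre by (intro G.emeasure_PiM) auto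
  also have "\<dots> = (\<Prod>i\<in>{1..d}. emeasure (gauss (x i) (c * s)) (A i))"
  proof (rule prod.cong[OF refl])
    fix i assume i: "i \<in> {1..d}"
    have "gauss (x i) (c * s) = distr ?G borel (\<lambda>y. x i + c * y)"
      using distr_gauss_affine[OF s c, of 0 "x i"] by simp
    then show "emeasure ?G ((\<lambda>y. x i + c * y) -` A i) = emeasure (gauss (x i) (c * s)) (A i)"
      using A[OF i] by (simp add: emeasure_distr)
  qed
  finally show "emeasure (distr (Pi\<^sub>M {1..d} (\<lambda>_. ?G)) (borel_Rd d) ?f) (Pi\<^sub>E {1..d} A)
    = (\<Prod>i\<in>{1..d}. emeasure (gauss (x i) (c * s)) (A i))" .
qed simp

text \<open>The factor \<open>sqrt 2\<close> is included so that \<open>translate d x\<close> of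
  this variable is the sampling point of the scheme.\<close>

definition stopped :: "nat \<Rightarrow> (real \<Rightarrow> 'w \<Rightarrow> nat \<Rightarrow> real) \<Rightarrow> ('w \<Rightarrow> real) \<Rightarrow> 'w \<Rightarrow> nat \<Rightarrow> real" where
  "stopped d B T \<omega> = (\<lambda>j\<in>{1..d}. sqrt 2 * B (T \<omega>) \<omega> j)"

lemma measurable_scaled:
  assumes "f \<in> measurable G (borel_Rd d)"
  shows "(\<lambda>p. \<lambda>j\<in>{1..d}. sqrt 2 * f p j) \<in> measurable G (borel_Rd d)"
proof (rule measurable_restrict)
  fix j assume "j \<in> {1..d}"
  from measurable_compose[OF assms measurable_component_singleton[OF this]]
  show "(\<lambda>p. sqrt 2 * f p j) \<in> measurable G borel" by simp
qed

lemma measurable_stopped: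
  assumes X: "\<And>t. 0 \<le> t \<Longrightarrow> B t \<in> measurable G (borel_Rd d)"
    and cont: "\<And>\<omega>. \<omega> \<in> space G \<Longrightarrow> continuous_on {0..} (\<lambda>t. B t \<omega>)"
    and T: "T \<in> borel_measurable G" "\<And>\<omega>. \<omega> \<in> space G \<Longrightarrow> 0 \<le> T \<omega>"
  shows "stopped d B T \<in> measurable G (borel_Rd d)"
proof -
  have "(\<lambda>\<omega>. (T \<omega>, \<omega>)) \<in> measurable G (borel \<Otimes>\<^sub>M G)" by (intro measurable_Pair T measurable_ident_sets[OF refl])
  from measurable_scaled[OF measurable_compose[OF this measurable_continuous_paths[OF X cont]]]
  have "(\<lambda>\<omega>. \<lambda>j\<in>{1..d}. sqrt 2 * B (max 0 (T \<omega>)) \<omega> j) \<in> measurable G (borel_Rd d)" by simp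
  moreover have "stopped d B T \<omega> = (\<lambda>j\<in>{1..d}. sqrt 2 * B (max 0 (T \<omega>)) \<omega> j)" if "\<omega> \<in> space G" for \<omega>
    using T(2)[OF that] by (simp add: stopped_def)
  ultimately show ?thesis by (subst measurable_cong) auto
qed

abbreviation path_algebra :: "'w measure \<Rightarrow> nat \<Rightarrow> (real \<Rightarrow> 'w \<Rightarrow> nat \<Rightarrow> real) \<Rightarrow> 'w measure" where
  "path_algebra P d B \<equiv> vimage_algebra (space P) (sample_path B) (path_space d)"

lemma std_brownian_motionD:
  assumes "std_brownian_motion P d B"
  shows "0 \<le> t \<Longrightarrow> B t \<in> measurable P (borel_Rd d)"
    and "AE \<omega> in P. B 0 \<omega> = (\<lambda>j\<in>{1..d}. 0)"
    and "\<omega> \<in> space P \<Longrightarrow> continuous_on {0..} (\<lambda>t. B t \<omega>)"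
    and "0 < t \<Longrightarrow> distr P (borel_Rd d) (\<lambda>\<omega>. \<lambda>j\<in>{1..d}. B t \<omega> j - B 0 \<omega> j) = Pi\<^sub>M {1..d} (\<lambda>_. gauss 0 (sqrt t))"
proof -
  note bm = assms[unfolded std_brownian_motion_def]
  show "0 \<le> t \<Longrightarrow> B t \<in> measurable P (borel_Rd d)" using bm[THEN conjunct1] by blast
  show "AE \<omega> in P. B 0 \<omega> = (\<lambda>j\<in>{1..d}. 0)" by (rule bm[THEN conjunct2, THEN conjunct1])
  show "\<omega> \<in> space P \<Longrightarrow> continuous_on {0..} (\<lambda>t. B t \<omega>)"
    using bm[THEN conjunct2, THEN conjunct2, THEN conjunct1] by blast
  assume "0 < t"
  with bm[THEN conjunct2, THEN conjunct2, THEN conjunct2, THEN conjunct2, rule_format, of 0 t]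
  show "distr P (borel_Rd d) (\<lambda>\<omega>. \<lambda>j\<in>{1..d}. B t \<omega> j - B 0 \<omega> j) = Pi\<^sub>M {1..d} (\<lambda>_. gauss 0 (sqrt t))"
    by (simp only: order_refl simp_thms diff_zero)
qed

lemma measurable_sample_path:
  assumes "std_brownian_motion P d B"
  shows "sample_path B \<in> measurable P (path_space d)"
  unfolding sample_path_def by (rule measurable_restrict, rule std_brownian_motionD(1)[OF assms]) simp

lemma measurable_ident_path_algebra:
  assumes "std_brownian_motion P d B"
  shows "(\<lambda>\<omega>. \<omega>) \<in> measurable P (path_algebra P d B)"
proof (rule measurable_vimage_algebra2)
  show "(\<lambda>\<omega>. sample_path B \<omega>) \<in> measurable P (path_space d)" by (rule measurable_sample_path[OF assms])
qed simp

lemma measurable_path_algebra: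
  assumes bm: "std_brownian_motion P d B" and t: "0 \<le> t"
  shows "B t \<in> measurable (path_algebra P d B) (borel_Rd d)"
proof -
  have "sample_path B \<in> measurable (path_algebra P d B) (path_space d)"
    by (rule measurable_vimage_algebra1) (use measurable_space[OF measurable_sample_path[OF bm]] in auto)
  from measurable_compose[OF this measurable_component_singleton[of t]]
  have "(\<lambda>\<omega>. sample_path B \<omega> t) \<in> measurable (path_algebra P d B) (borel_Rd d)" using t by simp
  moreover have "(\<lambda>\<omega>. sample_path B \<omega> t) = B t" using t by (auto simp: sample_path_def)
  ultimately show ?thesis by simp
qed

text \<open>The definition of Brownian motion prescribes laws of increments only. Since the motion
  starts in the origin almost surely, \<open>B t\<close> agrees with the increment from time 0
  outside a null set.\<close>

lemma (in prob_space) law_brownian_motion: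
  assumes bm: "std_brownian_motion M d B" and t: "0 < t"
  shows "distr M (borel_Rd d) (\<lambda>\<omega>. translate d x (\<lambda>j\<in>{1..d}. sqrt 2 * B t \<omega> j)) = heat_measure d t x"
proof -
  let ?I = "\<lambda>\<omega>. \<lambda>j\<in>{1..d}. B t \<omega> j - B 0 \<omega> j"
  let ?a = "\<lambda>w. translate d x (\<lambda>j\<in>{1..d}. sqrt 2 * w j)"
  have c: "(\<lambda>\<omega>. B t \<omega> j) \<in> borel_measurable M" "(\<lambda>\<omega>. B 0 \<omega> j) \<in> borel_measurable M" if "j \<in> {1..d}" for j
    using measurable_compose[OF std_brownian_motionD(1)[OF bm] measurable_component_singleton[OF that]] t by auto
  have I: "?I \<in> measurable M (borel_Rd d)" by (rule measurable_restrict) (intro borel_measurable_diff c)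
  have a: "?a \<in> measurable (borel_Rd d) (borel_Rd d)"
    unfolding translate_def by (rule measurable_restrict) simp
  have m: "(\<lambda>\<omega>. ?a (B t \<omega>)) \<in> measurable M (borel_Rd d)"
    using measurable_compose[OF std_brownian_motionD(1)[OF bm] a] t by simp
  have "distr M (borel_Rd d) (\<lambda>\<omega>. ?a (B t \<omega>)) = distr M (borel_Rd d) (\<lambda>\<omega>. ?a (?I \<omega>))"
  proof (rule distr_cong_AE)
    show "AE \<omega> in M. ?a (B t \<omega>) = ?a (?I \<omega>)"
      using std_brownian_motionD(2)[OF bm]
    proof eventually_elim
      case (elim \<omega>)
      then have "B 0 \<omega> j = 0" if "j \<in> {1..d}" for j using that by simp
      then show ?case by (auto simp: translate_def fun_eq_iff)
    qed
  qed (use m measurable_compose[OF I a] in auto)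
  also have "\<dots> = distr (distr M (borel_Rd d) ?I) (borel_Rd d) ?a"
    unfolding distr_distr[OF a I] comp_def ..
  also have "\<dots> = heat_measure d t x"
    unfolding std_brownian_motionD(4)[OF bm t] heat_measure_def
    using distr_product_gauss_affine[of "sqrt t" "sqrt 2" d x] t by (simp add: real_sqrt_mult del: One_nat_def)
  finally show ?thesis .
qed

context prob_space
begin

context
  fixes d B T lam
  assumes bm: "std_brownian_motion M d B" and lam: "0 < lam"
    and T0: "\<And>\<omega>. \<omega> \<in> space M \<Longrightarrow> 0 \<le> T \<omega>"
    and T: "distributed M lborel T (exponential_density lam)"
    and ind: "indep_set (sets (vimage_algebra (space M) T borel)) (sets (path_algebra M d B))"
begin

text \<open>The path is represented by the identity into the sample space equipped with the
  \<sigma>-algebra of the path. There every path is continuous, so evaluation at a random time is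
  jointly measurable; this continuity would be lost on the product space of all paths.\<close>

lemma law_time_and_path:
  "distr M (borel \<Otimes>\<^sub>M path_algebra M d B) (\<lambda>\<omega>. (T \<omega>, \<omega>))
    = density lborel (exponential_density lam) \<Otimes>\<^sub>M distr M (path_algebra M d B) (\<lambda>\<omega>. \<omega>)"
  (is "?P = ?E \<Otimes>\<^sub>M ?Q")
proof -
  let ?G = "path_algebra M d B"
  have Tm[measurable]: "T \<in> borel_measurable M" using distributed_measurable[OF T] by simp
  have E: "distr M borel T = ?E"
    using distributed_distr_eq_density[OF T] by (simp cong: distr_cong)
  have idG: "(\<lambda>\<omega>. \<omega>) \<in> measurable M ?G"
    by (rule measurable_ident_path_algebra[OF bm])
  have pm: "(\<lambda>\<omega>. (T \<omega>, \<omega>)) \<in> measurable M (borel \<Otimes>\<^sub>M ?G)" by (intro measurable_Pair Tm idG)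
  have "distr M borel T \<Otimes>\<^sub>M ?Q = ?P"
  proof (rule pair_measure_eqI)
    show "sigma_finite_measure (distr M borel T)"
      by (intro prob_space_imp_sigma_finite prob_space_distr Tm)
    show "sigma_finite_measure ?Q"
      by (intro prob_space_imp_sigma_finite prob_space_distr idG)
    show "sets (distr M borel T \<Otimes>\<^sub>M ?Q) = sets ?P"
      unfolding sets_distr by (rule sets_pair_measure_cong) auto
    fix A C assume "A \<in> sets (distr M borel T)" "C \<in> sets ?Q"
    then have A: "A \<in> sets borel" and C: "C \<in> sets ?G" by auto
    have Csub: "C \<subseteq> space M" using sets.sets_into_space[OF C] by simp
    have CM: "C \<in> events" using measurable_sets[OF idG C] Csub by (simp add: Int_absorb2)
    have "emeasure ?P (A \<times> C) = emeasure M ((T -` A \<inter> space M) \<inter> C)"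
      by (subst emeasure_distr[OF pm]) (use A C in \<open>auto intro!: arg_cong[where f="emeasure M"]\<close>)
    also have "\<dots> = ennreal (prob (T -` A \<inter> space M) * prob C)"
      using indep_setD[OF ind in_vimage_algebra[OF A] C] by (simp add: emeasure_eq_measure)
    also have "\<dots> = emeasure (distr M borel T) A * emeasure ?Q C"
      using A C Csub CM idG
      by (simp add: emeasure_distr emeasure_eq_measure ennreal_mult Int_absorb2)
    finally show "emeasure (distr M borel T) A * emeasure ?Q C = emeasure ?P (A \<times> C)" by simp
  qed
  then show ?thesis using E by simp
qed

text \<open>The product law allows the time to be frozen, and at a fixed positive time the position
  is Gaussian. The distinction on \<open>t\<close> is there because \<open>heat_measure\<close> is
  meant for positive times; the exponential law does not charge the others.\<close>

lemma stopped_law: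
  assumes h[measurable]: "h \<in> borel_measurable (borel_Rd d)"
  shows nn_integral_stopped: "(\<integral>\<^sup>+\<omega>. ennreal (h (translate d x (stopped d B T \<omega>))) \<partial>M)
      = (\<integral>\<^sup>+t. (if 0 < t then \<integral>\<^sup>+y. ennreal (h y) \<partial>heat_measure d t x else 0) \<partial>density lborel (exponential_density lam))"
      (is ?nn)
    and integral_stopped: "integrable M (\<lambda>\<omega>. h (translate d x (stopped d B T \<omega>))) \<Longrightarrow>
      (\<integral>\<omega>. h (translate d x (stopped d B T \<omega>)) \<partial>M)
      = (\<integral>t. (if 0 < t then \<integral>y. h y \<partial>heat_measure d t x else 0) \<partial>density lborel (exponential_density lam))"
      (is "?i \<Longrightarrow> ?eq")
proof -
  let ?G = "path_algebra M d B"
  let ?E = "density lborel (\<lambda>x. ennreal (exponential_density lam x))"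
  let ?Q = "distr M ?G (\<lambda>\<omega>. \<omega>)"
  have Tm: "T \<in> borel_measurable M" using distributed_measurable[OF T] by simp
  have idG: "(\<lambda>\<omega>. \<omega>) \<in> measurable M ?G"
    by (rule measurable_ident_path_algebra[OF bm])
  have pm: "(\<lambda>\<omega>. (T \<omega>, \<omega>)) \<in> measurable M (borel \<Otimes>\<^sub>M ?G)" by (intro measurable_Pair Tm idG)
  define k where "k p = translate d x (\<lambda>j\<in>{1..d}. sqrt 2 * B (max 0 (fst p)) (snd p) j)" for p
  have k: "k \<in> measurable (borel \<Otimes>\<^sub>M ?G) (borel_Rd d)"
  proof -
    have a: "(\<lambda>w. translate d x (\<lambda>j\<in>{1..d}. sqrt 2 * w j)) \<in> measurable (borel_Rd d) (borel_Rd d)"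
      unfolding translate_def by (rule measurable_restrict) simp
    have "(\<lambda>p. B (max 0 (fst p)) (snd p)) \<in> measurable (borel \<Otimes>\<^sub>M ?G) (borel_Rd d)"
      by (rule measurable_continuous_paths[OF measurable_path_algebra[OF bm] std_brownian_motionD(3)[OF bm]]) auto
    from measurable_compose[OF this a] show ?thesis by (simp add: k_def[abs_def])
  qed
  have hk: "(\<lambda>p. h (k p)) \<in> borel_measurable (borel \<Otimes>\<^sub>M ?G)" by (rule measurable_compose[OF k h])
  have hk': "(\<lambda>p. h (k p)) \<in> borel_measurable (?E \<Otimes>\<^sub>M ?Q)"
    using hk by (subst measurable_cong_sets[OF sets_pair_measure_cong refl]) auto
  have kT: "h (k (T \<omega>, \<omega>)) = h (translate d x (stopped d B T \<omega>))" if "\<omega> \<in> space M" for \<omega>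
    using T0[OF that] by (simp add: k_def stopped_def)
  have AEpos: "AE t in ?E. 0 < t"
  proof (subst AE_density)
    have "AE t in lborel. t \<noteq> (0::real)" by (rule AE_lborel_singleton)
    then show "AE t in lborel. 0 < ennreal (exponential_density lam t) \<longrightarrow> 0 < t"
      by eventually_elim (auto simp: erlang_density_def)
  qed simp
  have ht: "(\<integral>\<^sup>+\<omega>. ennreal (h (k (t, \<omega>))) \<partial>?Q) = (\<integral>\<^sup>+y. ennreal (h y) \<partial>heat_measure d t x)"
    "(\<integral>\<omega>. h (k (t, \<omega>)) \<partial>?Q) = (\<integral>y. h y \<partial>heat_measure d t x)" if t: "0 < t" for t
  proof -
    have m: "(\<lambda>\<omega>. translate d x (\<lambda>j\<in>{1..d}. sqrt 2 * B t \<omega> j)) \<in> measurable M (borel_Rd d)"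
      using measurable_compose[OF measurable_compose[OF idG measurable_Pair1'[of t borel ?G]] k] t
      by (simp add: k_def max_def)
    have m2: "(\<lambda>\<omega>. h (k (t, \<omega>))) \<in> borel_measurable ?G"
      by (rule measurable_compose[OF measurable_Pair1' hk]) simp
    have e: "k (t, \<omega>) = translate d x (\<lambda>j\<in>{1..d}. sqrt 2 * B t \<omega> j)" for \<omega>
      using t by (simp add: k_def max_def)
    have nn: "integral\<^sup>N (distr M N f) g = (\<integral>\<^sup>+\<omega>. g (f \<omega>) \<partial>M)"
      if "f \<in> measurable M N" "g \<in> borel_measurable N" for f g and N :: "'c measure"
      using that by (simp add: nn_integral_distr)
    have h': "(\<lambda>y. ennreal (h y)) \<in> borel_measurable (borel_Rd d)" using h by simp
    have m2': "(\<lambda>\<omega>. ennreal (h (k (t, \<omega>)))) \<in> borel_measurable ?G" using m2 by simp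
    show "(\<integral>\<^sup>+\<omega>. ennreal (h (k (t, \<omega>))) \<partial>?Q) = (\<integral>\<^sup>+y. ennreal (h y) \<partial>heat_measure d t x)"
      unfolding law_brownian_motion[OF bm t, symmetric] nn[OF idG m2'] nn[OF m h'] unfolding e ..
    show "(\<integral>\<omega>. h (k (t, \<omega>)) \<partial>?Q) = (\<integral>y. h y \<partial>heat_measure d t x)"
      unfolding law_brownian_motion[OF bm t, symmetric] integral_distr[OF idG m2] integral_distr[OF m h] unfolding e ..
  qed
  interpret Q: prob_space ?Q by (rule prob_space_distr[OF idG])
  interpret E: prob_space ?E by (rule prob_space_exponential_density[OF lam])
  interpret EQ: pair_sigma_finite ?E ?Q ..
  have "(\<integral>\<^sup>+\<omega>. ennreal (h (translate d x (stopped d B T \<omega>))) \<partial>M) = (\<integral>\<^sup>+\<omega>. ennreal (h (k (T \<omega>, \<omega>))) \<partial>M)"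
    by (rule nn_integral_cong) (simp add: kT)
  also have "\<dots> = (\<integral>\<^sup>+p. ennreal (h (k p)) \<partial>(?E \<Otimes>\<^sub>M ?Q))"
    unfolding law_time_and_path[symmetric] using hk by (subst nn_integral_distr[OF pm]) auto
  also have "\<dots> = (\<integral>\<^sup>+t. \<integral>\<^sup>+\<omega>. ennreal (h (k (t, \<omega>))) \<partial>?Q \<partial>?E)"
    using hk' by (subst Q.nn_integral_fst[symmetric]) auto
  also have "\<dots> = (\<integral>\<^sup>+t. (if 0 < t then \<integral>\<^sup>+y. ennreal (h y) \<partial>heat_measure d t x else 0) \<partial>?E)"
    by (rule nn_integral_cong_AE) (use AEpos in eventually_elim, simp add: ht del: One_nat_def)
  finally show ?nn .
  assume i: ?i
  have "integrable M (\<lambda>\<omega>. h (k (T \<omega>, \<omega>))) \<longleftrightarrow> ?i"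
    by (rule Bochner_Integration.integrable_cong[OF refl]) (rule kT)
  with i have i': "integrable (?E \<Otimes>\<^sub>M ?Q) (\<lambda>p. h (k p))"
    unfolding law_time_and_path[symmetric] using integrable_distr_eq[OF pm hk] by simp
  have "(\<integral>\<omega>. h (translate d x (stopped d B T \<omega>)) \<partial>M) = (\<integral>\<omega>. h (k (T \<omega>, \<omega>)) \<partial>M)"
    by (rule Bochner_Integration.integral_cong) (simp_all add: kT)
  also have "\<dots> = (\<integral>p. h (k p) \<partial>(?E \<Otimes>\<^sub>M ?Q))"
    unfolding law_time_and_path[symmetric] by (subst integral_distr[OF pm hk]) auto
  also have "\<dots> = (\<integral>t. \<integral>\<omega>. h (k (t, \<omega>)) \<partial>?Q \<partial>?E)"
    using EQ.integral_fst'[OF i'] by simp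
  also have "\<dots> = (\<integral>t. (if 0 < t then \<integral>y. h y \<partial>heat_measure d t x else 0) \<partial>?E)"
  proof (rule integral_cong_AE)
    show "AE t in ?E. (\<integral>\<omega>. h (k (t, \<omega>)) \<partial>?Q) = (if 0 < t then \<integral>y. h y \<partial>heat_measure d t x else 0)"
      using AEpos by eventually_elim (simp add: ht del: One_nat_def)
    show m: "(\<lambda>t. \<integral>\<omega>. h (k (t, \<omega>)) \<partial>?Q) \<in> borel_measurable ?E"
      using Q.borel_measurable_lebesgue_integral[of "\<lambda>t \<omega>. h (k (t, \<omega>))" ?E] hk' by (simp add: split_beta)
    \<comment> \<open>The right-hand integrand agrees for positive times with the inner integral of
      Fubini's theorem and so inherits its measurability.\<close>
    define g where "g = (\<lambda>t. \<integral>\<omega>. h (k (t, \<omega>)) \<partial>?Q)"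
    have "(\<lambda>t. if 0 < t then \<integral>y. h y \<partial>heat_measure d t x else 0) = (\<lambda>t. if 0 < t then g t else 0)"
      by (auto simp: ht g_def simp del: One_nat_def)
    moreover have "g \<in> borel_measurable ?E" unfolding g_def by (rule m)
    ultimately show "(\<lambda>t. if 0 < t then \<integral>y. h y \<partial>heat_measure d t x else 0) \<in> borel_measurable ?E"
      by simp
  qed
  finally show ?eq .
qed

end

end

text \<open>The formula of \<open>nn_integral_stopped\<close> involves neither the motion nor the
  time variable, only \<open>d\<close> and \<open>lam\<close>. It is applied to indicators, with the
  starting point 0.\<close>

lemma (in prob_space) distr_stopped_eqI:
  assumes bm: "std_brownian_motion M d B" "std_brownian_motion M d B'" and lam: "0 < lam"
    and T0: "\<And>\<omega>. \<omega> \<in> space M \<Longrightarrow> 0 \<le> T \<omega>" "\<And>\<omega>. \<omega> \<in> space M \<Longrightarrow> 0 \<le> T' \<omega>"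
    and T: "distributed M lborel T (exponential_density lam)" "distributed M lborel T' (exponential_density lam)"
    and ind: "indep_set (sets (vimage_algebra (space M) T borel)) (sets (path_algebra M d B))"
      "indep_set (sets (vimage_algebra (space M) T' borel)) (sets (path_algebra M d B'))"
  shows "distr M (borel_Rd d) (stopped d B T) = distr M (borel_Rd d) (stopped d B' T')"
proof (rule measure_eqI)
  fix A assume "A \<in> sets (distr M (borel_Rd d) (stopped d B T))"
  then have A: "A \<in> sets (borel_Rd d)" by simp
  let ?z = "\<lambda>j\<in>{1..d}. 0 :: real"
  have i: "indicator A \<in> borel_measurable (borel_Rd d)" using A by simp
  have tr: "translate d ?z (stopped d C S \<omega>) = stopped d C S \<omega>" for C S \<omega>
    by (auto simp: translate_def stopped_def fun_eq_iff)
  have tm: "T \<in> borel_measurable M" "T' \<in> borel_measurable M"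
    using distributed_measurable[OF T(1)] distributed_measurable[OF T(2)] by simp_all
  have m: "stopped d B T \<in> measurable M (borel_Rd d)"
    by (rule measurable_stopped[OF std_brownian_motionD(1)[OF bm(1)] std_brownian_motionD(3)[OF bm(1)] tm(1) T0(1)])
  have m': "stopped d B' T' \<in> measurable M (borel_Rd d)"
    by (rule measurable_stopped[OF std_brownian_motionD(1)[OF bm(2)] std_brownian_motionD(3)[OF bm(2)] tm(2) T0(2)])
  have e: "emeasure (distr M (borel_Rd d) f) A = (\<integral>\<^sup>+\<omega>. ennreal (indicator A (f \<omega>)) \<partial>M)"
    if "f \<in> measurable M (borel_Rd d)" for f
  proof -
    have "emeasure (distr M (borel_Rd d) f) A = (\<integral>\<^sup>+\<omega>. indicator (f -` A \<inter> space M) \<omega> \<partial>M)"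
      using that A measurable_sets[OF that A] by (simp add: emeasure_distr del: One_nat_def)
    also have "\<dots> = (\<integral>\<^sup>+\<omega>. ennreal (indicator A (f \<omega>)) \<partial>M)"
      by (intro nn_integral_cong) (auto split: split_indicator)
    finally show ?thesis .
  qed
  show "emeasure (distr M (borel_Rd d) (stopped d B T)) A = emeasure (distr M (borel_Rd d) (stopped d B' T')) A"
    unfolding e[OF m] e[OF m']
    using nn_integral_stopped[OF bm(1) lam T0(1) T(1) ind(1) i, of ?z]
      nn_integral_stopped[OF bm(2) lam T0(2) T(2) ind(2) i, of ?z]
    unfolding tr by simp
qed simp

text \<open>The events of all \<open>R \<theta>\<close> and of all paths form one independent
  family, indexed by pairs. Grouping the two members that belong to \<open>\<theta>\<close> gives
  independent \<sigma>-algebras, and the stopped position is measurable with respect to its own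
  group.\<close>

lemma (in prob_space) indep_stopped:
  assumes bm: "\<And>\<theta>. \<theta> \<in> I \<Longrightarrow> std_brownian_motion M d (W \<theta>)"
    and R0: "\<And>\<theta> \<omega>. \<theta> \<in> I \<Longrightarrow> \<omega> \<in> space M \<Longrightarrow> 0 \<le> R \<theta> \<omega>"
    and indR: "indep_vars (\<lambda>_. borel) R I"
    and indW: "indep_vars (\<lambda>_. path_space d) (\<lambda>\<theta>. sample_path (W \<theta>)) I"
    and ind: "indep_set (sets VR) (sets VW)" "space VR = space M" "space VW = space M"
    and VR: "\<And>\<theta>. \<theta> \<in> I \<Longrightarrow> R \<theta> \<in> measurable VR borel"
    and VW: "\<And>\<theta>. \<theta> \<in> I \<Longrightarrow> sample_path (W \<theta>) \<in> measurable VW (path_space d)"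
  shows "indep_vars (\<lambda>_. borel_Rd d) (\<lambda>\<theta>. stopped d (W \<theta>) (R \<theta>)) I"
proof -
  define F1 where "F1 \<theta> = {R \<theta> -` A \<inter> space M | A. A \<in> sets borel}" for \<theta>
  define F2 where "F2 \<theta> = {sample_path (W \<theta>) -` A \<inter> space M | A. A \<in> sets (path_space d)}" for \<theta>
  define E where "E = (\<lambda>(b, \<theta>). if b then F1 \<theta> else F2 \<theta>)"
  have Rm: "R \<theta> \<in> borel_measurable M" if "\<theta> \<in> I" for \<theta>
    using indR that by (auto simp: indep_vars_def2)
  have i1: "indep_sets F1 I" using indR unfolding indep_vars_def2 F1_def by blast
  have i2: "indep_sets F2 I" using indW unfolding indep_vars_def2 F2_def by blast
  have s1: "F1 \<theta> \<subseteq> sets VR" if "\<theta> \<in> I" for \<theta>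
    using measurable_sets[OF VR[OF that]] ind(2) by (auto simp: F1_def)
  have s2: "F2 \<theta> \<subseteq> sets VW" if "\<theta> \<in> I" for \<theta>
    using measurable_sets[OF VW[OF that]] ind(3) by (auto simp: F2_def)
  have iE: "indep_sets E (UNIV \<times> I)"
    unfolding E_def by (rule indep_sets_combine[OF i1 i2 ind s1 s2])
  have UI: "UNIV \<times> I = (\<Union>\<theta>\<in>I. UNIV \<times> {\<theta>})" by auto
  have vI: "Int_stable {f -` A \<inter> space M | A. A \<in> sets N}" for f :: "'a \<Rightarrow> 'c" and N :: "'c measure"
  proof (rule Int_stableI)
    fix a b assume "a \<in> {f -` A \<inter> space M | A. A \<in> sets N}" "b \<in> {f -` A \<inter> space M | A. A \<in> sets N}"
    then obtain A B where "a = f -` A \<inter> space M" "A \<in> sets N" "b = f -` B \<inter> space M" "B \<in> sets N" by auto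
    then have "a \<inter> b = f -` (A \<inter> B) \<inter> space M" "A \<inter> B \<in> sets N" by auto
    then show "a \<inter> b \<in> {f -` A \<inter> space M | A. A \<in> sets N}" by blast
  qed
  have "Int_stable (F1 \<theta>)" "Int_stable (F2 \<theta>)" for \<theta>
    unfolding F1_def F2_def by (rule vI)+
  then have IE: "Int_stable (E bi)" for bi by (cases bi) (simp add: E_def)
  have iG: "indep_sets (\<lambda>\<theta>. sigma_sets (space M) (\<Union>i\<in>UNIV \<times> {\<theta>}. E i)) I"
    by (rule indep_sets_collect_sigma[OF iE[unfolded UI] IE]) (auto simp: disjoint_family_on_def)
  \<comment> \<open>The \<sigma>-algebra generated by \<open>R \<theta>\<close> together with the
    path of \<open>W \<theta>\<close>.\<close>
  define G where "G \<theta> = sigma (space M) (\<Union>i\<in>UNIV \<times> {\<theta>}. E i)" for \<theta>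
  have sub: "(\<Union>i\<in>UNIV \<times> {\<theta>}. E i) \<subseteq> Pow (space M)" for \<theta>
    by (auto simp: E_def F1_def F2_def split: if_splits)
  have spG: "space (G \<theta>) = space M" for \<theta> unfolding G_def by (rule space_measure_of[OF sub])
  have seG: "sets (G \<theta>) = sigma_sets (space M) (\<Union>i\<in>UNIV \<times> {\<theta>}. E i)" for \<theta>
    unfolding G_def by (rule sets_measure_of[OF sub])
  have UE: "(\<Union>i\<in>UNIV \<times> {\<theta>}. E i) = F1 \<theta> \<union> F2 \<theta>" for \<theta>
    by (auto simp: E_def split: if_splits)
  have Z: "stopped d (W \<theta>) (R \<theta>) \<in> measurable (G \<theta>) (borel_Rd d)" if \<theta>: "\<theta> \<in> I" for \<theta>
  proof (rule measurable_stopped)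
    show "R \<theta> \<in> borel_measurable (G \<theta>)"
    proof (rule measurableI)
      fix A :: "real set" assume "A \<in> sets borel"
      then have "R \<theta> -` A \<inter> space M \<in> F1 \<theta>" by (auto simp: F1_def)
      then show "R \<theta> -` A \<inter> space (G \<theta>) \<in> sets (G \<theta>)" unfolding spG seG UE by blast
    qed simp
    fix t :: real assume t: "0 \<le> t"
    have sp: "sample_path (W \<theta>) \<in> measurable (G \<theta>) (path_space d)"
    proof (rule measurableI)
      show "sample_path (W \<theta>) \<omega> \<in> space (path_space d)" if "\<omega> \<in> space (G \<theta>)" for \<omega>
        using measurable_space[OF measurable_sample_path[OF bm[OF \<theta>]]] that spG by auto
      fix A assume "A \<in> sets (path_space d)"
      then have "sample_path (W \<theta>) -` A \<inter> space M \<in> F2 \<theta>" by (auto simp: F2_def)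
      then show "sample_path (W \<theta>) -` A \<inter> space (G \<theta>) \<in> sets (G \<theta>)" unfolding spG seG UE by blast
    qed
    have tm: "t \<in> {0..}" using t by simp
    have "(\<lambda>\<omega>. sample_path (W \<theta>) \<omega> t) \<in> measurable (G \<theta>) (borel_Rd d)"
      by (rule measurable_compose[OF sp measurable_component_singleton[OF tm]])
    moreover have "(\<lambda>\<omega>. sample_path (W \<theta>) \<omega> t) = W \<theta> t" using t by (auto simp: sample_path_def)
    ultimately show "W \<theta> t \<in> measurable (G \<theta>) (borel_Rd d)" by simp
  qed (use R0[OF \<theta>] std_brownian_motionD(3)[OF bm[OF \<theta>]] spG in auto)
  show ?thesis unfolding indep_vars_def2
  proof (intro conjI ballI)
    show "stopped d (W \<theta>) (R \<theta>) \<in> measurable M (borel_Rd d)" if "\<theta> \<in> I" for \<theta>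
      by (rule measurable_stopped[OF std_brownian_motionD(1)[OF bm[OF that]] std_brownian_motionD(3)[OF bm[OF that]] Rm[OF that] R0[OF that]])
    show "indep_sets (\<lambda>\<theta>. {stopped d (W \<theta>) (R \<theta>) -` A \<inter> space M |A. A \<in> sets (borel_Rd d)}) I"
    proof (rule indep_sets_mono_sets[OF iG])
      fix \<theta> assume "\<theta> \<in> I"
      show "{stopped d (W \<theta>) (R \<theta>) -` A \<inter> space M |A. A \<in> sets (borel_Rd d)}
          \<subseteq> sigma_sets (space M) (\<Union>i\<in>UNIV \<times> {\<theta>}. E i)"
        using measurable_sets[OF Z[OF \<open>\<theta> \<in> I\<close>]] unfolding seG[symmetric] spG by blast
    qed
  qed
qed

section \<open>The Feynman-Kac formula\<close>

text \<open>Continuity refers to the topology of all functions on the naturals, probability to the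
  product \<sigma>-algebra over \<open>{1..d}\<close>. On \<open>Rd d\<close> the remaining
  coordinates are constantly \<open>undefined\<close>, hence measurable.\<close>

lemma measurable_borel_Rd_ident: "(\<lambda>x. x) \<in> measurable (borel_Rd d) (restrict_space borel (Rd d))"
proof (rule measurable_restrict_space2)
  show "(\<lambda>x. x) \<in> measurable (borel_Rd d) borel"
  proof (rule measurable_coordinatewise_then_product)
    fix i :: nat
    show "(\<lambda>x. x i) \<in> borel_measurable (borel_Rd d)"
    proof (cases "i \<in> {1..d}")
      case True then show ?thesis by (rule measurable_component_singleton)
    next
      case False
      then have "x i = undefined" if "x \<in> space (borel_Rd d)" for x :: "nat \<Rightarrow> real"
        using that by (auto simp: space_PiM PiE_def extensional_def)
      then show ?thesis by (subst measurable_cong[where g="\<lambda>_. undefined"]) auto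
    qed
  qed
qed (simp add: space_borel_Rd del: One_nat_def)

lemma continuous_on_Rd_measurable:
  fixes g :: "(nat \<Rightarrow> real) \<Rightarrow> real"
  assumes "continuous_on (Rd d) g"
  shows "g \<in> borel_measurable (borel_Rd d)"
  using measurable_compose[OF measurable_borel_Rd_ident borel_measurable_continuous_on_restrict[OF assms]] .

lemma continuous_on_Rd_prod_measurable:
  fixes f :: "(nat \<Rightarrow> real) \<times> real \<Rightarrow> real"
  assumes "continuous_on (Rd d \<times> UNIV) f"
  shows "f \<in> borel_measurable (borel_Rd d \<Otimes>\<^sub>M borel)"
proof -
  have m: "(\<lambda>x. x) \<in> measurable (borel_Rd d) borel"
    using measurable_restrict_space2_iff[THEN iffD1, OF measurable_borel_Rd_ident] by blast
  have "(\<lambda>p. (fst p, snd p)) \<in> measurable (borel_Rd d \<Otimes>\<^sub>M borel) (borel \<Otimes>\<^sub>M (borel :: real measure))"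
    by (intro measurable_Pair measurable_compose[OF measurable_fst m] measurable_snd)
  then have "(\<lambda>p. p) \<in> measurable (borel_Rd d \<Otimes>\<^sub>M (borel :: real measure)) borel"
    by (simp add: borel_prod del: One_nat_def)
  then have "(\<lambda>p. p) \<in> measurable (borel_Rd d \<Otimes>\<^sub>M (borel :: real measure)) (restrict_space borel (Rd d \<times> UNIV))"
    by (rule measurable_restrict_space2[rotated]) (auto simp: space_pair_measure space_borel_Rd simp del: One_nat_def)
  from measurable_compose[OF this borel_measurable_continuous_on_restrict[OF assms]] show ?thesis by simp
qed

section \<open>Exponential moments of Gaussian measures\<close>

lemma normal_density_exp:
  assumes "0 < \<sigma>"
  shows "normal_density m \<sigma> y * exp (b * y) = exp (b * m + b\<^sup>2 * \<sigma>\<^sup>2 / 2) * normal_density (m + b * \<sigma>\<^sup>2) \<sigma> y"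
proof -
  \<comment> \<open>Completing the square: an exponential tilt shifts the mean by
    \<open>b * \<sigma>\<^sup>2\<close>.\<close>
  have "- (y - m)\<^sup>2 / (2 * \<sigma>\<^sup>2) + b * y = (b * m + b\<^sup>2 * \<sigma>\<^sup>2 / 2) + - (y - (m + b * \<sigma>\<^sup>2))\<^sup>2 / (2 * \<sigma>\<^sup>2)"
    using assms by (simp add: field_simps power2_eq_square)
  then have "exp (- (y - m)\<^sup>2 / (2 * \<sigma>\<^sup>2)) * exp (b * y)
    = exp (b * m + b\<^sup>2 * \<sigma>\<^sup>2 / 2) * exp (- (y - (m + b * \<sigma>\<^sup>2))\<^sup>2 / (2 * \<sigma>\<^sup>2))"
    by (simp add: exp_add[symmetric])
  then show ?thesis by (simp add: normal_density_def mult_ac)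
qed

lemma has_bochner_integral_gauss_exp:
  assumes "0 < \<sigma>"
  shows "has_bochner_integral (gauss m \<sigma>) (\<lambda>y. exp (b * y)) (exp (b * m + b\<^sup>2 * \<sigma>\<^sup>2 / 2))"
proof -
  have "has_bochner_integral lborel (\<lambda>y. exp (b * m + b\<^sup>2 * \<sigma>\<^sup>2 / 2) * normal_density (m + b * \<sigma>\<^sup>2) \<sigma> y)
     (exp (b * m + b\<^sup>2 * \<sigma>\<^sup>2 / 2) * 1)"
    by (intro has_bochner_integral_mult_right)
      (use assms in \<open>simp add: has_bochner_integral_iff\<close>)
  then show ?thesis
    unfolding normal_density_exp[OF assms, symmetric]
    by (intro has_bochner_integral_density) auto
qed

lemma gauss_exp_abs:
  assumes "0 < \<sigma>"
  shows "integrable (gauss m \<sigma>) (\<lambda>y. exp (b * \<bar>y\<bar>))"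
    and "(\<integral>y. exp (b * \<bar>y\<bar>) \<partial>gauss m \<sigma>) \<le> 2 * exp (\<bar>b\<bar> * \<bar>m\<bar> + b\<^sup>2 * \<sigma>\<^sup>2 / 2)"
proof -
  note p = has_bochner_integral_gauss_exp[OF assms, of m b]
  note n = has_bochner_integral_gauss_exp[OF assms, of m "- b"]
  have i: "integrable (gauss m \<sigma>) (\<lambda>y. exp (b * y) + exp (- b * y))"
    using p n by (auto simp: has_bochner_integral_iff)
  have le: "exp (b * \<bar>y\<bar>) \<le> exp (b * y) + exp (- b * y)" for y :: real
    by (cases "0 \<le> y") (auto simp: abs_if)
  show i': "integrable (gauss m \<sigma>) (\<lambda>y. exp (b * \<bar>y\<bar>))"
  proof (rule Bochner_Integration.integrable_bound[OF i])
    show "AE y in gauss m \<sigma>. norm (exp (b * \<bar>y\<bar>)) \<le> norm (exp (b * y) + exp (- b * y))"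
    proof (rule AE_I2)
      fix y :: real
      have "0 \<le> exp (b * y) + exp (- b * y)" by (simp add: add_nonneg_nonneg)
      then show "norm (exp (b * \<bar>y\<bar>)) \<le> norm (exp (b * y) + exp (- b * y))" using le[of y] by simp
    qed
  qed simp
  have "(\<integral>y. exp (b * \<bar>y\<bar>) \<partial>gauss m \<sigma>) \<le> (\<integral>y. exp (b * y) + exp (- b * y) \<partial>gauss m \<sigma>)"
    by (rule integral_mono[OF i' i le])
  also have "\<dots> = exp (b * m + b\<^sup>2 * \<sigma>\<^sup>2 / 2) + exp (- b * m + b\<^sup>2 * \<sigma>\<^sup>2 / 2)"
    using p n by (simp add: has_bochner_integral_iff)
  also have "\<dots> \<le> 2 * exp (\<bar>b\<bar> * \<bar>m\<bar> + b\<^sup>2 * \<sigma>\<^sup>2 / 2)"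
  proof -
    have "\<bar>b * m\<bar> = \<bar>b\<bar> * \<bar>m\<bar>" by (rule abs_mult)
    then have "exp (b * m + b\<^sup>2 * \<sigma>\<^sup>2 / 2) \<le> exp (\<bar>b\<bar> * \<bar>m\<bar> + b\<^sup>2 * \<sigma>\<^sup>2 / 2)"
      "exp (- b * m + b\<^sup>2 * \<sigma>\<^sup>2 / 2) \<le> exp (\<bar>b\<bar> * \<bar>m\<bar> + b\<^sup>2 * \<sigma>\<^sup>2 / 2)"
      by (auto simp only: exp_le_cancel_iff add_le_cancel_right)
    then show ?thesis by linarith
  qed
  finally show "(\<integral>y. exp (b * \<bar>y\<bar>) \<partial>gauss m \<sigma>) \<le> 2 * exp (\<bar>b\<bar> * \<bar>m\<bar> + b\<^sup>2 * \<sigma>\<^sup>2 / 2)" .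
qed

lemma sets_PiM_gauss[simp, measurable_cong]: "sets (Pi\<^sub>M I (\<lambda>j. gauss (m j) (s j))) = sets (Pi\<^sub>M I (\<lambda>_. borel))"
  by (rule sets_PiM_cong) auto

lemma sets_heat_measure[measurable_cong]: "sets (heat_measure d t x) = sets (borel_Rd d)"
  unfolding heat_measure_def by (rule sets_PiM_gauss)

lemma space_heat_measure: "space (heat_measure d t x) = Rd d"
  using sets_eq_imp_space_eq[OF sets_heat_measure] space_borel_Rd by metis

lemma product_sigma_finite_gauss:
  assumes "\<And>j. 0 < s j" shows "product_sigma_finite (\<lambda>j. gauss (m j) (s j))"
  unfolding product_sigma_finite_def
  using assms prob_space_normal_density prob_space_imp_sigma_finite by blast

lemma prob_space_heat_measure: "0 < t \<Longrightarrow> prob_space (heat_measure d t x)"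
  unfolding heat_measure_def by (intro prob_space_PiM prob_space_normal_density) simp

definition l1norm :: "nat \<Rightarrow> (nat \<Rightarrow> real) \<Rightarrow> real" where
  "l1norm d y = (\<Sum>j=1..d. \<bar>y j\<bar>)"

lemma exp_bound_nonneg:
  assumes "\<bar>h\<bar> \<le> C * exp (b * l)" shows "0 \<le> (C :: real)"
  using order_trans[OF abs_ge_zero assms] by (simp add: zero_le_mult_iff)

lemma zero_in_Rd: "(\<lambda>j\<in>{1..d}. 0) \<in> Rd d"
  by (auto simp: Rd_def)

lemma l1norm_nonneg[simp]: "0 \<le> l1norm d y"
  by (simp add: l1norm_def sum_nonneg)

lemma l1norm_component: "j \<in> {1..d} \<Longrightarrow> \<bar>y j\<bar> \<le> l1norm d y"
  unfolding l1norm_def by (rule member_le_sum) auto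

lemma l1norm_translate: "l1norm d (translate d x y) \<le> l1norm d x + l1norm d y"
  unfolding l1norm_def sum.distrib[symmetric] by (rule sum_mono) (simp add: translate_def)

lemma product_gauss_exp_l1norm:
  assumes "\<And>j. 0 < s j"
  shows "integrable (Pi\<^sub>M {1..d} (\<lambda>j. gauss (m j) (s j))) (\<lambda>y. exp (b * l1norm d y))"
    and "(\<integral>y. exp (b * l1norm d y) \<partial>Pi\<^sub>M {1..d} (\<lambda>j. gauss (m j) (s j)))
      = (\<Prod>j\<in>{1..d}. \<integral>y. exp (b * \<bar>y\<bar>) \<partial>gauss (m j) (s j))"
proof -
  interpret product_sigma_finite "\<lambda>j. gauss (m j) (s j)" by (rule product_sigma_finite_gauss[OF assms])
  have e: "exp (b * l1norm d y) = (\<Prod>j\<in>{1..d}. exp (b * \<bar>y j\<bar>))" for y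
    by (simp add: l1norm_def sum_distrib_left exp_sum)
  show "integrable (Pi\<^sub>M {1..d} (\<lambda>j. gauss (m j) (s j))) (\<lambda>y. exp (b * l1norm d y))"
    unfolding e by (intro product_integrable_prod gauss_exp_abs assms) simp
  show "(\<integral>y. exp (b * l1norm d y) \<partial>Pi\<^sub>M {1..d} (\<lambda>j. gauss (m j) (s j)))
      = (\<Prod>j\<in>{1..d}. \<integral>y. exp (b * \<bar>y\<bar>) \<partial>gauss (m j) (s j))"
    unfolding e by (intro product_integral_prod gauss_exp_abs assms) simp
qed

lemma heat_measure_exp_l1norm:
  assumes t: "0 < t" and b: "0 \<le> b"
  shows "integrable (heat_measure d t x) (\<lambda>y. exp (b * l1norm d y))"
    and "(\<integral>y. exp (b * l1norm d y) \<partial>heat_measure d t x) \<le> 2 ^ d * exp (b * l1norm d x + d * b\<^sup>2 * t)"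
proof -
  have s: "0 < sqrt (2 * t)" using t by simp
  show "integrable (heat_measure d t x) (\<lambda>y. exp (b * l1norm d y))"
    unfolding heat_measure_def by (rule product_gauss_exp_l1norm(1)[OF s])
  have "(\<integral>y. exp (b * l1norm d y) \<partial>heat_measure d t x)
      = (\<Prod>j\<in>{1..d}. \<integral>y. exp (b * \<bar>y\<bar>) \<partial>gauss (x j) (sqrt (2 * t)))"
    unfolding heat_measure_def by (rule product_gauss_exp_l1norm(2)[OF s])
  also have "\<dots> \<le> (\<Prod>j\<in>{1..d}. 2 * exp (\<bar>b\<bar> * \<bar>x j\<bar> + b\<^sup>2 * (sqrt (2 * t))\<^sup>2 / 2))"
    by (intro prod_mono conjI gauss_exp_abs(2)[OF s] integral_nonneg_AE) auto
  also have "\<dots> = 2 ^ d * exp (\<Sum>j\<in>{1..d}. b * \<bar>x j\<bar> + b\<^sup>2 * t)"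
    using t b by (simp add: prod.distrib exp_sum)
  also have "(\<Sum>j\<in>{1..d}. b * \<bar>x j\<bar> + b\<^sup>2 * t) = b * l1norm d x + d * b\<^sup>2 * t"
    by (simp add: sum.distrib l1norm_def sum_distrib_left)
  finally show "(\<integral>y. exp (b * l1norm d y) \<partial>heat_measure d t x) \<le> 2 ^ d * exp (b * l1norm d x + d * b\<^sup>2 * t)" .
qed

text \<open>What matters is the growth in time, \<open>real d * b\<^sup>2 * t\<close> in the
  exponent, which a discount \<open>exp (- lam * t)\<close> beats for small \<open>b\<close>. The
  factor \<open>2 ^ d\<close> is harmless: the bound serves integrability and passages to a limit,
  never the final constants.\<close>

lemma integrable_heat_measure_bound:
  assumes t: "0 < t" and h: "h \<in> borel_measurable (borel_Rd d)"
    and b: "\<And>y. y \<in> Rd d \<Longrightarrow> \<bar>h y\<bar> \<le> C * exp (b * l1norm d y)" "0 \<le> b"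
  shows "integrable (heat_measure d t x) h"
    and "\<bar>\<integral>y. h y \<partial>heat_measure d t x\<bar> \<le> C * 2 ^ d * exp (b * l1norm d x + d * b\<^sup>2 * t)"
proof -
  have i: "integrable (heat_measure d t x) (\<lambda>y. C * exp (b * l1norm d y))"
    using heat_measure_exp_l1norm(1)[OF t b(2)] by simp
  have C: "0 \<le> C" by (rule exp_bound_nonneg[OF b(1)[OF zero_in_Rd]])
  show ih: "integrable (heat_measure d t x) h"
  proof (rule Bochner_Integration.integrable_bound[OF i])
    show "h \<in> borel_measurable (heat_measure d t x)"
      using h unfolding measurable_cong_sets[OF sets_heat_measure refl] .
    show "AE y in heat_measure d t x. norm (h y) \<le> norm (C * exp (b * l1norm d y))"
      using b(1) C by (intro AE_I2) (simp add: space_heat_measure)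
  qed
  have "\<bar>\<integral>y. h y \<partial>heat_measure d t x\<bar> \<le> (\<integral>y. \<bar>h y\<bar> \<partial>heat_measure d t x)"
    by (rule integral_abs_bound)
  also have "\<dots> \<le> (\<integral>y. C * exp (b * l1norm d y) \<partial>heat_measure d t x)"
    using ih i b(1) by (intro integral_mono) (auto simp: space_heat_measure)
  also have "\<dots> \<le> C * (2 ^ d * exp (b * l1norm d x + d * b\<^sup>2 * t))"
    using heat_measure_exp_l1norm(2)[OF t b(2)] C by (simp add: mult_left_mono)
  finally show "\<bar>\<integral>y. h y \<partial>heat_measure d t x\<bar> \<le> C * 2 ^ d * exp (b * l1norm d x + d * b\<^sup>2 * t)"
    by (simp add: mult.assoc)
qed

section \<open>The Lebesgue density of the heat measure\<close>

definition heat_density :: "nat \<Rightarrow> real \<Rightarrow> (nat \<Rightarrow> real) \<Rightarrow> (nat \<Rightarrow> real) \<Rightarrow> real" where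
  "heat_density d t x y = (\<Prod>j\<in>{1..d}. normal_density (x j) (sqrt (2 * t)) (y j))"

abbreviation lebesgue_Rd :: "nat \<Rightarrow> (nat \<Rightarrow> real) measure" where
  "lebesgue_Rd d \<equiv> Pi\<^sub>M {1..d} (\<lambda>_. lborel)"

lemma sets_lebesgue_Rd: "sets (lebesgue_Rd d) = sets (borel_Rd d)"
  by (rule sets_PiM_cong) auto

lemma measurable_heat_density: "heat_density d t x \<in> borel_measurable (borel_Rd d)"
  unfolding heat_density_def[abs_def]
proof (rule borel_measurable_prod)
  fix j assume "j \<in> {1..d}"
  from measurable_coord[OF this]
  show "(\<lambda>y. normal_density (x j) (sqrt (2 * t)) (y j)) \<in> borel_measurable (borel_Rd d)"
    by (rule measurable_compose) (rule borel_measurable_normal_density)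
qed

lemma heat_density_nonneg: "0 \<le> heat_density d t x y"
  unfolding heat_density_def by (intro prod_nonneg) auto

text \<open>The later steps differentiate this density, in a single coordinate for Green's identity
  and in time for the heat equation.\<close>

lemma heat_measure_eq_density:
  assumes t: "0 < t"
  shows "heat_measure d t x = density (lebesgue_Rd d) (\<lambda>y. ennreal (heat_density d t x y))"
  unfolding heat_measure_def
proof (rule product_sigma_finite.PiM_eqI[symmetric])
  have s: "0 < sqrt (2 * t)" using t by simp
  interpret product_sigma_finite "\<lambda>j::nat. lborel :: real measure" ..
  show "product_sigma_finite (\<lambda>j. gauss (x j) (sqrt (2 * t)))" by (rule product_sigma_finite_gauss[OF s])
  show "sets (density (lebesgue_Rd d) (\<lambda>y. ennreal (heat_density d t x y))) = sets (Pi\<^sub>M {1..d} (\<lambda>j. gauss (x j) (sqrt (2 * t))))"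
    unfolding sets_density by (rule sets_PiM_cong) auto
  fix A assume "\<And>i. i \<in> {1..d} \<Longrightarrow> A i \<in> sets (gauss (x i) (sqrt (2 * t)))"
  then have A: "A i \<in> sets borel" if "i \<in> {1..d}" for i using that by auto
  have AP: "Pi\<^sub>E {1..d} A \<in> sets (lebesgue_Rd d)" using A by (intro sets_PiM_I_finite) auto
  have hm: "(\<lambda>y. ennreal (heat_density d t x y)) \<in> borel_measurable (lebesgue_Rd d)"
    using measurable_heat_density unfolding measurable_cong_sets[OF sets_lebesgue_Rd refl] by (rule measurable_compose) simp
  have "emeasure (density (lebesgue_Rd d) (\<lambda>y. ennreal (heat_density d t x y))) (Pi\<^sub>E {1..d} A)
     = (\<integral>\<^sup>+y. (\<Prod>j\<in>{1..d}. ennreal (normal_density (x j) (sqrt (2 * t)) (y j)) * indicator (A j) (y j)) \<partial>lebesgue_Rd d)"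
    unfolding emeasure_density[OF hm AP]
  proof (rule nn_integral_cong)
    fix y assume "y \<in> space (lebesgue_Rd d)"
    then have "indicator (Pi\<^sub>E {1..d} A) y = (\<Prod>j\<in>{1..d}. indicator (A j) (y j) :: ennreal)"
    proof (cases "y \<in> Pi\<^sub>E {1..d} A")
      case True
      then show ?thesis by (simp add: PiE_mem del: One_nat_def)
    next
      case False
      with \<open>y \<in> space (lebesgue_Rd d)\<close> obtain j where "j \<in> {1..d}" "y j \<notin> A j"
        by (auto simp: space_PiM PiE_def Pi_def)
      then have "(\<Prod>j\<in>{1..d}. indicator (A j) (y j) :: ennreal) = 0"
        by (intro prod_zero bexI[of _ j]) auto
      then show ?thesis using False by simp
    qed
    then show "ennreal (heat_density d t x y) * indicator (Pi\<^sub>E {1..d} A) y =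
        (\<Prod>j\<in>{1..d}. ennreal (normal_density (x j) (sqrt (2 * t)) (y j)) * indicator (A j) (y j))"
      by (simp add: heat_density_def prod_ennreal[symmetric] prod.distrib)
  qed
  also have "\<dots> = (\<Prod>j\<in>{1..d}. \<integral>\<^sup>+y. ennreal (normal_density (x j) (sqrt (2 * t)) y) * indicator (A j) y \<partial>lborel)"
    using A by (intro product_nn_integral_prod) auto
  also have "\<dots> = (\<Prod>j\<in>{1..d}. emeasure (gauss (x j) (sqrt (2 * t))) (A j))"
    using A by (intro prod.cong refl) (simp add: emeasure_density)
  finally show "emeasure (density (lebesgue_Rd d) (\<lambda>y. ennreal (heat_density d t x y))) (Pi\<^sub>E {1..d} A)
    = (\<Prod>j\<in>{1..d}. emeasure (gauss (x j) (sqrt (2 * t))) (A j))" .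
qed simp

text \<open>The square creates double zeros at the end points. The cutoff is therefore continuously
  differentiable on the line, and two integrations by parts leave no boundary terms.\<close>

definition cutoff :: "real \<Rightarrow> real \<Rightarrow> real" where
  "cutoff R r = (1 - r\<^sup>2 / R\<^sup>2)\<^sup>2 * indicator {-R..R} r"

text \<open>If \<open>n\<close> is the Gaussian density with variance \<open>v\<close>, then \<open>n * cutoff_op v R\<close> is the second derivative of
  \<open>n * cutoff R\<close> inside \<open>{-R..R}\<close>; both \<open>n * cutoff R\<close> and its first derivative vanish at the end points.\<close>

definition cutoff_op :: "real \<Rightarrow> real \<Rightarrow> real \<Rightarrow> real" where
  "cutoff_op v R r = ((r\<^sup>2 / v\<^sup>2 - 1 / v) * (1 - r\<^sup>2 / R\<^sup>2)\<^sup>2 + 8 * r\<^sup>2 * (1 - r\<^sup>2 / R\<^sup>2) / (v * R\<^sup>2)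
     + (12 * r\<^sup>2 / R ^ 4 - 4 / R\<^sup>2)) * indicator {-R..R} r"

lemma measurable_cutoff[measurable]: "cutoff R \<in> borel_measurable borel" "cutoff_op v R \<in> borel_measurable borel"
  unfolding cutoff_def[abs_def] cutoff_op_def[abs_def] by measurable

lemma cutoff_range: "0 \<le> cutoff R r" "cutoff R r \<le> 1"
proof -
  show "0 \<le> cutoff R r" by (simp add: cutoff_def)
  show "cutoff R r \<le> 1"
  proof (cases "\<bar>r\<bar> \<le> R \<and> 0 < R")
    case True
    then have "r\<^sup>2 \<le> R\<^sup>2" by (metis abs_le_square_iff abs_of_pos)
    then have "0 \<le> r\<^sup>2 / R\<^sup>2" "r\<^sup>2 / R\<^sup>2 \<le> 1" using True by (auto simp: divide_le_eq_1)
    then have "(1 - r\<^sup>2 / R\<^sup>2)\<^sup>2 \<le> 1" by (intro power_le_one) auto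
    then show ?thesis by (simp add: cutoff_def indicator_def)
  next
    case False
    then show ?thesis by (cases "R = 0") (auto simp: cutoff_def indicator_def)
  qed
qed

text \<open>The bound does not involve \<open>R\<close>, so it can dominate while \<open>R\<close>
  grows. On the support every term is expressed through \<open>q = r\<^sup>2 / R\<^sup>2\<close>,
  which lies between 0 and 1.\<close>

lemma cutoff_op_bound:
  assumes v: "0 < v" and R: "1 \<le> R"
  shows "\<bar>cutoff_op v R r\<bar> \<le> r\<^sup>2 / v\<^sup>2 + 9 / v * (1 + r\<^sup>2) + 16"
proof (cases "\<bar>r\<bar> \<le> R")
  case True
  have r2: "r\<^sup>2 \<le> R\<^sup>2" using True R by (metis abs_le_square_iff abs_of_nonneg order_trans zero_le_one)
  define q where "q = r\<^sup>2 / R\<^sup>2"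
  have q: "0 \<le> q" "q \<le> 1" using r2 R by (auto simp: q_def divide_le_eq_1)
  have R1: "1 \<le> R\<^sup>2" using R by (simp add: one_le_power)
  have "cutoff_op v R r = (r\<^sup>2 / v\<^sup>2 - 1 / v) * (1 - q)\<^sup>2 + 8 * (q * (1 - q)) / v + (12 * q - 4) / R\<^sup>2"
  proof -
    have ind: "indicator {-R..R} r = (1 :: real)" using True by (auto simp: indicator_def)
    have R0: "R \<noteq> 0" using R by auto
    have "12 * r\<^sup>2 / R ^ 4 = 12 * q / R\<^sup>2"
      using R0 by (simp add: q_def power2_eq_square power4_eq_xxxx)
    moreover have "8 * r\<^sup>2 * (1 - r\<^sup>2 / R\<^sup>2) / (v * R\<^sup>2) = 8 * (q * (1 - q)) / v"
      using R0 v by (simp add: q_def mult_ac)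
    ultimately show ?thesis
      unfolding cutoff_op_def ind by (simp add: q_def[symmetric] diff_divide_distrib)
  qed
  moreover have "\<bar>(r\<^sup>2 / v\<^sup>2 - 1 / v) * (1 - q)\<^sup>2\<bar> \<le> r\<^sup>2 / v\<^sup>2 + 1 / v"
  proof -
    have "\<bar>(r\<^sup>2 / v\<^sup>2 - 1 / v) * (1 - q)\<^sup>2\<bar> \<le> (r\<^sup>2 / v\<^sup>2 + 1 / v) * 1"
      unfolding abs_mult using v q by (intro mult_mono) (auto intro!: power_le_one simp: abs_le_iff)
    then show ?thesis by simp
  qed
  moreover have "\<bar>8 * (q * (1 - q)) / v\<bar> \<le> 8 / v"
  proof -
    have "q * (1 - q) \<le> 1" "0 \<le> q * (1 - q)" using q by (auto intro: mult_le_one)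
    then show ?thesis using v by (simp add: divide_right_mono)
  qed
  moreover have "\<bar>(12 * q - 4) / R\<^sup>2\<bar> \<le> 16"
  proof -
    have "\<bar>(12 * q - 4) / R\<^sup>2\<bar> = \<bar>12 * q - 4\<bar> / R\<^sup>2" using R1 by (simp add: abs_divide)
    also have "\<dots> \<le> 16 / 1" using q R1 by (intro frac_le) auto
    finally show ?thesis by simp
  qed
  moreover have "1 / v + 8 / v \<le> 9 / v * (1 + r\<^sup>2)"
  proof -
    have "9 / v * 1 \<le> 9 / v * (1 + r\<^sup>2)" using v by (intro mult_left_mono) auto
    then show ?thesis by (simp add: add_divide_distrib[symmetric])
  qed
  ultimately show ?thesis by linarith
next
  case False
  then have "r \<notin> {-R..R}" by auto
  then show ?thesis using v by (simp add: cutoff_op_def)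
qed

text \<open>All terms that carry a derivative of the cutoff vanish in the limit. What remains is the
  second derivative of the Gaussian density divided by the density.\<close>

lemma cutoff_tendsto: "(\<lambda>n. cutoff (real n) r) \<longlonglongrightarrow> 1"
  and cutoff_op_tendsto: "(\<lambda>n. cutoff_op v (real n) r) \<longlonglongrightarrow> r\<^sup>2 / v\<^sup>2 - 1 / v"
proof -
  have i: "filterlim (\<lambda>n. real n) at_top sequentially" by (rule filterlim_real_sequentially)
  have d: "(\<lambda>n. c / real n ^ k) \<longlonglongrightarrow> 0" if "0 < k" for c :: real and k
    by (rule tendsto_divide_0[OF tendsto_const], rule filterlim_at_top_imp_at_infinity)
      (rule filterlim_pow_at_top[OF that i])
  have q: "(\<lambda>n. (1 - r\<^sup>2 / (real n)\<^sup>2)\<^sup>2) \<longlonglongrightarrow> (1 - 0)\<^sup>2"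
    by (intro tendsto_intros d) simp
  have ev: "\<forall>\<^sub>F n in sequentially. indicator {- real n..real n} r = (1 :: real)"
  proof -
    obtain N :: nat where "\<bar>r\<bar> \<le> real N" using real_arch_simple by blast
    then show ?thesis by (intro eventually_sequentiallyI[of N]) (auto simp: indicator_def)
  qed
  show "(\<lambda>n. cutoff (real n) r) \<longlonglongrightarrow> 1"
    by (rule Lim_transform_eventually[OF q[simplified]]) (use ev in \<open>eventually_elim, simp add: cutoff_def\<close>)
  have "(\<lambda>n. (r\<^sup>2 / v\<^sup>2 - 1 / v) * (1 - r\<^sup>2 / (real n)\<^sup>2)\<^sup>2 + (8 * r\<^sup>2 / v) / (real n)\<^sup>2 * (1 - r\<^sup>2 / (real n)\<^sup>2)
     + (12 * r\<^sup>2 / real n ^ 4 - 4 / (real n)\<^sup>2)) \<longlonglongrightarrow> (r\<^sup>2 / v\<^sup>2 - 1 / v) * (1 - 0)\<^sup>2 + 0 * (1 - 0) + (0 - 0)"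
    by (intro tendsto_intros d q) simp_all
  then have *: "(\<lambda>n. (r\<^sup>2 / v\<^sup>2 - 1 / v) * (1 - r\<^sup>2 / (real n)\<^sup>2)\<^sup>2 + (8 * r\<^sup>2 / v) / (real n)\<^sup>2 * (1 - r\<^sup>2 / (real n)\<^sup>2)
     + (12 * r\<^sup>2 / real n ^ 4 - 4 / (real n)\<^sup>2)) \<longlonglongrightarrow> r\<^sup>2 / v\<^sup>2 - 1 / v" by simp
  show "(\<lambda>n. cutoff_op v (real n) r) \<longlonglongrightarrow> r\<^sup>2 / v\<^sup>2 - 1 / v"
    by (rule Lim_transform_eventually[OF *])
      (use ev in \<open>eventually_elim, simp add: cutoff_op_def mult_ac\<close>)
qed

lemma normal_density_has_derivative:
  assumes "0 < \<sigma>"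
  shows "(normal_density m \<sigma> has_real_derivative - ((s - m) / \<sigma>\<^sup>2) * normal_density m \<sigma> s) (at s)"
proof -
  have "((\<lambda>s. 1 / sqrt (2 * pi * \<sigma>\<^sup>2) * exp (- (s - m)\<^sup>2 / (2 * \<sigma>\<^sup>2))) has_real_derivative
      1 / sqrt (2 * pi * \<sigma>\<^sup>2) * (exp (- (s - m)\<^sup>2 / (2 * \<sigma>\<^sup>2)) * (- ((s - m) / \<sigma>\<^sup>2)))) (at s)"
  proof (rule DERIV_cmult)
    have "((\<lambda>s. - (s - m)\<^sup>2 / (2 * \<sigma>\<^sup>2)) has_real_derivative - ((s - m) / \<sigma>\<^sup>2)) (at s)"
      using assms by (auto intro!: derivative_eq_intros simp: field_simps)
    then show "((\<lambda>s. exp (- (s - m)\<^sup>2 / (2 * \<sigma>\<^sup>2))) has_real_derivative exp (- (s - m)\<^sup>2 / (2 * \<sigma>\<^sup>2)) * (- ((s - m) / \<sigma>\<^sup>2))) (at s)"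
      by (rule DERIV_fun_exp)
  qed
  then show ?thesis unfolding normal_density_def[abs_def] by (simp add: mult_ac)
qed

text \<open>Green's identity on \<open>{m - R..m + R}\<close> for \<open>V\<close> and the truncated
  Gaussian. The truncated Gaussian and its derivative vanish at both ends, so no information about
  the size of \<open>V1\<close> enters.\<close>

lemma integral_cutoff_by_parts:
  fixes V V1 V2 :: "real \<Rightarrow> real"
  assumes V: "\<And>s. (V has_real_derivative V1 s) (at s)" and V1: "\<And>s. (V1 has_real_derivative V2 s) (at s)"
    and V2: "\<And>s. isCont V2 s" and \<sigma>: "0 < \<sigma>" and R: "0 < R"
  shows "(\<integral>s. normal_density m \<sigma> s * (V2 s * cutoff R (s - m) - V s * cutoff_op (\<sigma>\<^sup>2) R (s - m)) \<partial>lborel) = 0"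
proof -
  define v where "v = \<sigma>\<^sup>2"
  have v: "0 < v" using \<sigma> by (simp add: v_def)
  define n where "n = normal_density m \<sigma>"
  define A where "A s = (1 - (s - m)\<^sup>2 / R\<^sup>2)\<^sup>2" for s
  define A1 where "A1 s = - 4 * (s - m) * (1 - (s - m)\<^sup>2 / R\<^sup>2) / R\<^sup>2" for s
  define A2 where "A2 s = 12 * (s - m)\<^sup>2 / R ^ 4 - 4 / R\<^sup>2" for s
  define C where "C s = (((s - m)\<^sup>2 / v\<^sup>2 - 1 / v) * A s + 8 * (s - m)\<^sup>2 * (1 - (s - m)\<^sup>2 / R\<^sup>2) / (v * R\<^sup>2) + A2 s)" for s
  have n: "(n has_real_derivative - ((s - m) / v) * n s) (at s)" for s
    unfolding n_def v_def by (rule normal_density_has_derivative[OF \<sigma>])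
  have A: "(A has_real_derivative A1 s) (at s)" for s
    unfolding A_def[abs_def] A1_def using R
    by (auto intro!: derivative_eq_intros simp: field_simps power2_eq_square)
  have A1: "(A1 has_real_derivative A2 s) (at s)" for s
    unfolding A1_def[abs_def] A2_def using R
    by (auto intro!: derivative_eq_intros simp: field_simps power2_eq_square power4_eq_xxxx)
  define \<phi>1 where "\<phi>1 s = n s * (A1 s - (s - m) / v * A s)" for s
  have \<phi>: "((\<lambda>s. n s * A s) has_real_derivative \<phi>1 s) (at s)" for s
    by (rule DERIV_cong[OF DERIV_mult[OF n A]]) (simp add: \<phi>1_def algebra_simps)
  have \<phi>1: "(\<phi>1 has_real_derivative n s * C s) (at s)" for s
  proof -
    have l: "((\<lambda>s. (s - m) / v) has_real_derivative 1 / v) (at s)"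
      using v by (auto intro!: derivative_eq_intros)
    have "((\<lambda>s. n s * (A1 s - (s - m) / v * A s)) has_real_derivative
        (- ((s - m) / v) * n s) * (A1 s - (s - m) / v * A s) + (A2 s - (1 / v * A s + A1 s * ((s - m) / v))) * n s) (at s)"
      by (rule DERIV_mult[OF n DERIV_diff[OF A1 DERIV_mult[OF l A]]])
    moreover have "(- ((s - m) / v) * n s) * (A1 s - (s - m) / v * A s) + (A2 s - (1 / v * A s + A1 s * ((s - m) / v))) * n s
        = n s * C s"
    proof -
      have "- (2 * (s - m) / v) * A1 s = 8 * (s - m)\<^sup>2 * (1 - (s - m)\<^sup>2 / R\<^sup>2) / (v * R\<^sup>2)"
      proof -
        have "- (2 * w / v) * (- 4 * w * e / R\<^sup>2) = 8 * w\<^sup>2 * e / (v * R\<^sup>2)" for w e :: real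
          by (simp add: power2_eq_square mult_ac)
        from this[of "s - m" "1 - (s - m)\<^sup>2 / R\<^sup>2"] show ?thesis unfolding A1_def .
      qed
      then have C: "C s = (((s - m) / v)\<^sup>2 - 1 / v) * A s - 2 * ((s - m) / v) * A1 s + A2 s"
        by (simp add: C_def power_divide)
      have "(- w * N) * (a1 - w * a) + (a2 - (1 / v * a + a1 * w)) * N = N * ((w\<^sup>2 - 1 / v) * a - 2 * w * a1 + a2)"
        for w N a a1 a2 :: real
        by (simp add: algebra_simps power2_eq_square)
      then show ?thesis unfolding C .
    qed
    ultimately show ?thesis unfolding \<phi>1_def[abs_def] by simp
  qed
  \<comment> \<open>With \<open>\<phi> = n * A\<close> for the truncated Gaussian,
    \<open>V1 * \<phi> - V * \<phi>1\<close> is an antiderivative of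
    \<open>V2 * \<phi> - V * (n * C)\<close>, because the mixed products cancel.\<close>
  define G where "G s = V1 s * (n s * A s) - V s * \<phi>1 s" for s
  have G: "(G has_real_derivative n s * (V2 s * A s - V s * C s)) (at s)" for s
  proof -
    have "((\<lambda>s. V1 s * (n s * A s) - V s * \<phi>1 s) has_real_derivative
       (V2 s * (n s * A s) + \<phi>1 s * V1 s) - (V1 s * \<phi>1 s + (n s * C s) * V s)) (at s)"
      by (rule DERIV_diff[OF DERIV_mult[OF V1 \<phi>] DERIV_mult[OF V \<phi>1]])
    then show ?thesis unfolding G_def[abs_def] by (rule DERIV_cong) (simp add: algebra_simps)
  qed
  have cont: "isCont (\<lambda>s. n s * (V2 s * A s - V s * C s)) s" for s
  proof -
    have "isCont A2 s" using R unfolding A2_def[abs_def] by (intro continuous_intros) auto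
    then have "isCont C s"
      unfolding C_def[abs_def] using v R DERIV_isCont[OF A] by (intro continuous_intros) auto
    then show ?thesis
      using DERIV_isCont[OF n] DERIV_isCont[OF A] DERIV_isCont[OF V] V2 by (intro continuous_intros) auto
  qed
  have "(\<integral>s. n s * (V2 s * A s - V s * C s) * indicator {m - R..m + R} s \<partial>lborel) = G (m + R) - G (m - R)"
    using R by (intro integral_FTC_Icc_real G cont) auto
  also have "\<dots> = 0" using R by (simp add: G_def \<phi>1_def A_def A1_def)
  also have "(\<lambda>s. n s * (V2 s * A s - V s * C s) * indicator {m - R..m + R} s)
      = (\<lambda>s. normal_density m \<sigma> s * (V2 s * cutoff R (s - m) - V s * cutoff_op (\<sigma>\<^sup>2) R (s - m)))"
  proof
    fix s
    have "indicator {m - R..m + R} s = (indicator {-R..R} (s - m) :: real)" by (auto simp: indicator_def)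
    then show "n s * (V2 s * A s - V s * C s) * indicator {m - R..m + R} s
      = normal_density m \<sigma> s * (V2 s * cutoff R (s - m) - V s * cutoff_op (\<sigma>\<^sup>2) R (s - m))"
      unfolding n_def A_def C_def A2_def v_def cutoff_def cutoff_op_def by (simp add: algebra_simps)
  qed
  finally show ?thesis .
qed

text \<open>Tychonoff's theorem in the full function space, where every coordinate outside
  \<open>{1..d}\<close> ranges over the singleton of \<open>undefined\<close>.\<close>

lemma compact_box: "compact (Pi\<^sub>E {1..d::nat} (\<lambda>j. {a j..b j :: real}))"
proof -
  have "Pi\<^sub>E {1..d} (\<lambda>j. {a j..b j}) = Pi\<^sub>E UNIV (\<lambda>j. if j \<in> {1..d} then {a j..b j} else {undefined})"
    by (auto simp: PiE_def Pi_def extensional_def split: if_splits)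
  moreover have "compactin (product_topology (\<lambda>_::nat. euclidean) UNIV)
      (Pi\<^sub>E UNIV (\<lambda>j. if j \<in> {1..d} then {a j..b j} else {undefined}))"
    unfolding compactin_PiE by (auto simp: compactin_euclidean_iff)
  ultimately show ?thesis
    by (simp add: euclidean_product_topology compactin_euclidean_iff del: One_nat_def)
qed

lemma Rd_upd: "y \<in> Rd d \<Longrightarrow> i \<in> {1..d} \<Longrightarrow> y(i := s) \<in> Rd d"
  by (auto simp: Rd_def PiE_def extensional_def)

lemma continuous_on_Rd_upd:
  assumes g: "continuous_on (Rd d) g" and y: "y \<in> Rd d" and i: "i \<in> {1..d}"
  shows "continuous_on UNIV (\<lambda>s. g (y(i := s)))"
proof (rule continuous_on_compose2[OF g])
  show "continuous_on UNIV (\<lambda>s. y(i := s))"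
  proof (rule continuous_on_coordinatewise_then_product)
    fix j show "continuous_on UNIV (\<lambda>s. (y(i := s)) j)"
      by (cases "j = i") (auto intro: continuous_intros)
  qed
  show "range (\<lambda>s. y(i := s)) \<subseteq> Rd d" using Rd_upd[OF y i] by auto
qed

text \<open>\<open>C_diff\<close> speaks of the derivative at the current coordinate only. Applied
  to the point \<open>y(i := s)\<close> it yields the derivative along the whole coordinate line
  through \<open>y\<close>.\<close>

lemma C_diff_2D:
  assumes "C_diff d 2 u" and i: "i \<in> {1..d}"
  shows "continuous_on (Rd d) u" "continuous_on (Rd d) (partial_deriv i (partial_deriv i u))"
    and "y \<in> Rd d \<Longrightarrow> ((\<lambda>s. u (y(i := s))) has_real_derivative partial_deriv i u (y(i := s))) (at s)"
    and "y \<in> Rd d \<Longrightarrow> ((\<lambda>s. partial_deriv i u (y(i := s))) has_real_derivative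
      partial_deriv i (partial_deriv i u) (y(i := s))) (at s)"
proof -
  have C: "C_diff d (Suc (Suc 0)) u" using assms(1) by (simp add: numeral_2_eq_2)
  then show "continuous_on (Rd d) u" by simp
  have C1: "C_diff d (Suc 0) (partial_deriv i u)" using C i by simp
  then show "continuous_on (Rd d) (partial_deriv i (partial_deriv i u))" using i by simp
  have D: "((\<lambda>s. g (y(i := s))) has_real_derivative partial_deriv i g (y(i := s))) (at s)"
    if g: "C_diff d (Suc k) g" and y: "y \<in> Rd d" for g y s k
  proof -
    have "\<forall>x\<in>Rd d. (\<lambda>t. g (x(i := t))) differentiable at (x i)" using g i by simp
    from bspec[OF this Rd_upd[OF y i, of s]]
    have "(\<lambda>t. g (y(i := t))) differentiable at s" by simp
    then have "((\<lambda>t. g (y(i := t))) has_real_derivative deriv (\<lambda>t. g (y(i := t))) s) (at s)"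
      using DERIV_deriv_iff_real_differentiable by blast
    then show ?thesis by (simp add: partial_deriv_def)
  qed
  show "y \<in> Rd d \<Longrightarrow> ((\<lambda>s. u (y(i := s))) has_real_derivative partial_deriv i u (y(i := s))) (at s)"
    by (rule D[OF C])
  show "y \<in> Rd d \<Longrightarrow> ((\<lambda>s. partial_deriv i u (y(i := s))) has_real_derivative
      partial_deriv i (partial_deriv i u) (y(i := s))) (at s)"
    by (rule D[OF C1])
qed

lemma bounded_on_box:
  fixes g :: "(nat \<Rightarrow> real) \<Rightarrow> real"
  assumes "continuous_on (Rd d) g"
  shows "\<exists>K. \<forall>y\<in>Pi\<^sub>E {1..d} (\<lambda>j. {a j..b j}). \<bar>g y\<bar> \<le> K"
proof -
  have sub: "Pi\<^sub>E {1..d} (\<lambda>j. {a j..b j}) \<subseteq> Rd d" by (auto simp: Rd_def PiE_def)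
  have "compact (g ` Pi\<^sub>E {1..d} (\<lambda>j. {a j..b j}))"
    by (rule compact_continuous_image[OF continuous_on_subset[OF assms sub] compact_box])
  from compact_imp_bounded[OF this] show ?thesis unfolding bounded_iff by auto
qed

text \<open>All coordinates are cut off, not just the \<open>i\<close>-th, so that the integrand
  vanishes outside a compact box and is bounded there by continuity. Integrating over coordinate
  \<open>i\<close> first, the other factors are constants and the one-dimensional identity gives
  0.\<close>

lemma heat_integral_cutoff_component:
  fixes x :: "nat \<Rightarrow> real"
  assumes u: "C_diff d 2 u" and i: "i \<in> {1..d}" and t: "0 < t" and R: "1 \<le> R"
  defines "g \<equiv> \<lambda>y. (partial_deriv i (partial_deriv i u) y * cutoff R (y i - x i) - u y * cutoff_op (2 * t) R (y i - x i))
      * (\<Prod>j\<in>{1..d} - {i}. cutoff R (y j - x j))"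
  shows "integrable (heat_measure d t x) g" "(\<integral>y. g y \<partial>heat_measure d t x) = 0"
proof -
  let ?D = "partial_deriv i (partial_deriv i u)"
  let ?s = "sqrt (2 * t)"
  have s: "0 < ?s" "?s\<^sup>2 = 2 * t" using t by auto
  let ?I = "{1..d} - {i}"
  have II: "insert i ?I = {1..d}" using i by auto
  interpret H: prob_space "heat_measure d t x" by (rule prob_space_heat_measure[OF t])
  have comp: "(\<lambda>y. y j) \<in> borel_measurable (borel_Rd d)" if "j \<in> {1..d}" for j
    by (rule measurable_component_singleton[OF that])
  note um = continuous_on_Rd_measurable[OF C_diff_2D(1)[OF u i]]
    and Dm = continuous_on_Rd_measurable[OF C_diff_2D(2)[OF u i]]
  have cm: "(\<lambda>y. cutoff R (y j - x j)) \<in> borel_measurable (borel_Rd d)"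
      "(\<lambda>y. cutoff_op (2 * t) R (y j - x j)) \<in> borel_measurable (borel_Rd d)" if "j \<in> {1..d}" for j
    using comp[OF that] by measurable
  have gm: "g \<in> borel_measurable (borel_Rd d)"
    unfolding g_def using i
    by (intro borel_measurable_times borel_measurable_diff borel_measurable_prod um Dm cm) auto
  obtain K1 where K1: "\<bar>u y\<bar> \<le> K1" if "y \<in> Pi\<^sub>E {1..d} (\<lambda>j. {x j - R..x j + R})" for y
    using bounded_on_box[OF C_diff_2D(1)[OF u i], where a="\<lambda>j. x j - R" and b="\<lambda>j. x j + R"] by blast
  obtain K2 where K2: "\<bar>?D y\<bar> \<le> K2" if "y \<in> Pi\<^sub>E {1..d} (\<lambda>j. {x j - R..x j + R})" for y
    using bounded_on_box[OF C_diff_2D(2)[OF u i], where a="\<lambda>j. x j - R" and b="\<lambda>j. x j + R"] by blast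
  define K3 where "K3 = R\<^sup>2 / (2 * t)\<^sup>2 + 9 / (2 * t) * (1 + R\<^sup>2) + 16"
  have K3: "\<bar>cutoff_op (2 * t) R r\<bar> \<le> K3" if "\<bar>r\<bar> \<le> R" for r
  proof -
    have "r\<^sup>2 \<le> R\<^sup>2" using that R by (metis abs_le_square_iff abs_of_nonneg order_trans zero_le_one)
    then have "r\<^sup>2 / (2 * t)\<^sup>2 + 9 / (2 * t) * (1 + r\<^sup>2) + 16 \<le> K3"
      unfolding K3_def using t by (intro add_mono divide_right_mono mult_left_mono) auto
    then show ?thesis using cutoff_op_bound[of "2 * t" R r] t R by linarith
  qed
  \<comment> \<open>Inside the box continuity bounds \<open>u\<close> and its second derivative;
    outside it some cutoff factor is 0.\<close>
  have bound: "\<bar>g y\<bar> \<le> \<bar>K2\<bar> + \<bar>K1\<bar> * K3" if y: "y \<in> Rd d" for y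
  proof (cases "\<forall>j\<in>{1..d}. \<bar>y j - x j\<bar> \<le> R")
    case True
    have box: "y \<in> Pi\<^sub>E {1..d} (\<lambda>j. {x j - R..x j + R})"
    proof (rule PiE_I)
      fix j assume "j \<in> {1..d}"
      with True have "\<bar>y j - x j\<bar> \<le> R" by blast
      then show "y j \<in> {x j - R..x j + R}" by (simp add: abs_le_iff)
    next
      fix j assume "j \<notin> {1..d}"
      then show "y j = undefined" using y unfolding Rd_def by (rule PiE_arb[rotated])
    qed
    have p: "\<bar>\<Prod>j\<in>?I. cutoff R (y j - x j)\<bar> \<le> 1"
      unfolding abs_prod using cutoff_range by (intro prod_le_1) auto
    have "\<bar>?D y * cutoff R (y i - x i) - u y * cutoff_op (2 * t) R (y i - x i)\<bar>
        \<le> \<bar>?D y * cutoff R (y i - x i)\<bar> + \<bar>u y * cutoff_op (2 * t) R (y i - x i)\<bar>" by linarith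
    also have "\<dots> \<le> \<bar>K2\<bar> * 1 + \<bar>K1\<bar> * K3"
      unfolding abs_mult using K1[OF box] K2[OF box] K3 True i cutoff_range[of R "y i - x i"]
      by (intro add_mono mult_mono) auto
    finally have "\<bar>g y\<bar> \<le> (\<bar>K2\<bar> * 1 + \<bar>K1\<bar> * K3) * 1"
      unfolding g_def abs_mult using p by (intro mult_mono) auto
    then show ?thesis by simp
  next
    case False
    then obtain j where j: "j \<in> {1..d}" "\<not> \<bar>y j - x j\<bar> \<le> R" by blast
    then have c: "cutoff R (y j - x j) = 0" "cutoff_op (2 * t) R (y j - x j) = 0"
      by (auto simp: cutoff_def cutoff_op_def indicator_def)
    have "g y = 0"
    proof (cases "j = i")
      case True then show ?thesis using c by (simp add: g_def)
    next
      case False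
      then have "(\<Prod>j\<in>?I. cutoff R (y j - x j)) = 0" using c j by (intro prod_zero) auto
      then show ?thesis by (simp add: g_def)
    qed
    moreover have "0 \<le> K3" using K3[of 0] R by simp
    ultimately show ?thesis by simp
  qed
  have gmH: "g \<in> borel_measurable (heat_measure d t x)"
    using gm unfolding measurable_cong_sets[OF sets_heat_measure refl] .
  show ig: "integrable (heat_measure d t x) g"
    by (rule H.integrable_const_bound[OF _ gmH, of "\<bar>K2\<bar> + \<bar>K1\<bar> * K3"])
      (use bound in \<open>auto simp: space_heat_measure\<close>)
  interpret L: product_sigma_finite "\<lambda>j::nat. lborel :: real measure" ..
  let ?p = "heat_density d t x"
  have gL: "g \<in> borel_measurable (lebesgue_Rd d)" "?p \<in> borel_measurable (lebesgue_Rd d)"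
    using gm measurable_heat_density unfolding measurable_cong_sets[OF sets_lebesgue_Rd refl] by auto
  have ip: "integrable (Pi\<^sub>M (insert i ?I) (\<lambda>_. lborel)) (\<lambda>y. ?p y * g y)"
    unfolding II using ig unfolding heat_measure_eq_density[OF t]
    by (subst (asm) integrable_density) (use gL heat_density_nonneg in auto)
  have "(\<integral>y. g y \<partial>heat_measure d t x) = (\<integral>y. ?p y * g y \<partial>Pi\<^sub>M (insert i ?I) (\<lambda>_. lborel))"
    unfolding II unfolding heat_measure_eq_density[OF t]
    by (subst integral_density) (use gL heat_density_nonneg in auto)
  also have "\<dots> = (\<integral>y. \<integral>s. ?p (y(i := s)) * g (y(i := s)) \<partial>lborel \<partial>Pi\<^sub>M ?I (\<lambda>_. lborel))"
    by (rule L.product_integral_insert[OF _ _ ip]) auto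
  also have "\<dots> = (\<integral>y. 0 \<partial>Pi\<^sub>M ?I (\<lambda>_. lborel :: real measure))"
  proof (rule Bochner_Integration.integral_cong[OF refl])
    fix y assume "y \<in> space (Pi\<^sub>M ?I (\<lambda>_. lborel :: real measure))"
    then have y: "y(i := 0) \<in> Rd d" using i by (auto simp: space_PiM Rd_def PiE_def extensional_def)
    define V where "V s = u (y(i := s))" for s
    define V2 where "V2 s = ?D (y(i := s))" for s
    define c where "c = (\<Prod>j\<in>?I. normal_density (x j) ?s (y j)) * (\<Prod>j\<in>?I. cutoff R (y j - x j))"
    have "?p (y(i := s)) * g (y(i := s))
       = c * (normal_density (x i) ?s s * (V2 s * cutoff R (s - x i) - V s * cutoff_op (?s\<^sup>2) R (s - x i)))" for s
    proof -
      have "?p (y(i := s)) = normal_density (x i) ?s s * (\<Prod>j\<in>?I. normal_density (x j) ?s (y j))"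
        unfolding heat_density_def by (subst II[symmetric], subst prod.insert) (auto intro!: prod.cong)
      moreover have "(\<Prod>j\<in>?I. cutoff R ((y(i := s)) j - x j)) = (\<Prod>j\<in>?I. cutoff R (y j - x j))"
        by (rule prod.cong) auto
      ultimately show ?thesis unfolding g_def c_def V_def V2_def s(2) by (simp add: mult_ac)
    qed
    moreover have "(\<integral>s. normal_density (x i) ?s s * (V2 s * cutoff R (s - x i) - V s * cutoff_op (?s\<^sup>2) R (s - x i)) \<partial>lborel) = 0"
    proof (rule integral_cutoff_by_parts)
      show "(V has_real_derivative partial_deriv i u (y(i := s))) (at s)" for s
        using C_diff_2D(3)[OF u i y, of s] by (simp add: V_def[abs_def])
      show "((\<lambda>s. partial_deriv i u (y(i := s))) has_real_derivative V2 s) (at s)" for s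
        using C_diff_2D(4)[OF u i y, of s] by (simp add: V2_def)
      show "isCont V2 s" for s
        using continuous_on_Rd_upd[OF C_diff_2D(2)[OF u i] y i]
        by (simp add: V2_def[abs_def] continuous_on_eq_continuous_at)
    qed (use s R in auto)
    ultimately show "(\<integral>s. ?p (y(i := s)) * g (y(i := s)) \<partial>lborel) = 0" by simp
  qed
  finally show "(\<integral>y. g y \<partial>heat_measure d t x) = 0" by simp
qed

text \<open>The Laplacian of the heat density in \<open>y\<close>, divided by the density; by the
  heat equation it is also the logarithmic derivative of the density in time.\<close>

definition heat_op :: "nat \<Rightarrow> real \<Rightarrow> (nat \<Rightarrow> real) \<Rightarrow> (nat \<Rightarrow> real) \<Rightarrow> real" where
  "heat_op d t x y = (\<Sum>i\<in>{1..d}. (y i - x i)\<^sup>2 / (2 * t)\<^sup>2 - 1 / (2 * t))"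

lemma square_le_exp: "r\<^sup>2 \<le> 2 * exp \<bar>r :: real\<bar>"
proof -
  have "1 + \<bar>r\<bar> + \<bar>r\<bar>\<^sup>2 / 2 \<le> exp \<bar>r\<bar>" by (rule exp_lower_Taylor_quadratic) simp
  then show ?thesis by simp
qed

lemma exp_component_le:
  assumes "i \<in> {1..d}" shows "exp \<bar>y i - x i\<bar> \<le> exp (l1norm d x) * exp (l1norm d y)"
proof -
  have "\<bar>y i - x i\<bar> \<le> l1norm d x + l1norm d y"
    using l1norm_component[OF assms, of x] l1norm_component[OF assms, of y] by linarith
  then show ?thesis by (simp add: exp_add[symmetric])
qed

lemma continuous_on_Laplacian: "C_diff d 2 u \<Longrightarrow> continuous_on (Rd d) (Laplacian d u)"
  unfolding Laplacian_def[abs_def] by (intro continuous_on_sum C_diff_2D(2))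

lemma continuous_on_C_diff: "C_diff d k u \<Longrightarrow> continuous_on (Rd d) u"
  by (cases k) auto

lemma measurable_heat_op: "heat_op d t x \<in> borel_measurable (borel_Rd d)"
proof -
  have "(\<lambda>y. (y i - x i)\<^sup>2 / (2 * t)\<^sup>2 - 1 / (2 * t)) \<in> borel_measurable (borel_Rd d)" if "i \<in> {1..d}" for i
    using measurable_coord[OF that] by measurable
  then show ?thesis unfolding heat_op_def[abs_def] by (intro borel_measurable_sum)
qed

text \<open>The estimate is uniform for times from \<open>a\<close> on, as Fubini's theorem on a
  time interval requires. The quadratic term is traded for an exponential to match the form of
  \<open>integrable_heat_measure_bound\<close>.\<close>

lemma heat_op_bound:
  assumes a: "0 < a" "a \<le> t"
  shows "\<bar>heat_op d t x y\<bar> \<le> real d * (2 / (2 * a)\<^sup>2 + 1 / (2 * a)) * exp (l1norm d x) * exp (l1norm d y)"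
proof -
  have "\<bar>heat_op d t x y\<bar> \<le> (\<Sum>i\<in>{1..d}. \<bar>(y i - x i)\<^sup>2 / (2 * t)\<^sup>2 - 1 / (2 * t)\<bar>)"
    unfolding heat_op_def by (rule sum_abs)
  also have "\<dots> \<le> (\<Sum>i\<in>{1..d}. (2 / (2 * a)\<^sup>2 + 1 / (2 * a)) * (exp (l1norm d x) * exp (l1norm d y)))"
  proof (rule sum_mono)
    fix i assume i: "i \<in> {1..d}"
    let ?e = "exp (l1norm d x) * exp (l1norm d y)"
    have e1: "1 \<le> ?e" by (simp add: exp_add[symmetric])
    have sq: "(y i - x i)\<^sup>2 \<le> 2 * ?e" using square_le_exp[of "y i - x i"] exp_component_le[OF i, of y x] by linarith
    have "(y i - x i)\<^sup>2 / (2 * t)\<^sup>2 \<le> (2 * ?e) / (2 * a)\<^sup>2"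
      using sq a by (intro frac_le power_mono) auto
    moreover have "1 / (2 * t) \<le> ?e / (2 * a)" using e1 a by (intro frac_le) auto
    moreover have "0 \<le> (y i - x i)\<^sup>2 / (2 * t)\<^sup>2" "0 \<le> 1 / (2 * t)" using a by auto
    ultimately have "\<bar>(y i - x i)\<^sup>2 / (2 * t)\<^sup>2 - 1 / (2 * t)\<bar> \<le> (2 * ?e) / (2 * a)\<^sup>2 + ?e / (2 * a)" by linarith
    also have "\<dots> = (2 / (2 * a)\<^sup>2 + 1 / (2 * a)) * ?e" by (simp add: distrib_right)
    finally show "\<bar>(y i - x i)\<^sup>2 / (2 * t)\<^sup>2 - 1 / (2 * t)\<bar> \<le> (2 / (2 * a)\<^sup>2 + 1 / (2 * a)) * ?e" .
  qed
  also have "\<dots> = real d * (2 / (2 * a)\<^sup>2 + 1 / (2 * a)) * exp (l1norm d x) * exp (l1norm d y)" by simp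
  finally show ?thesis .
qed

text \<open>The cut-off identities of all coordinates are added and the cutoff radius tends to
  infinity by dominated convergence.\<close>

lemma heat_integral_Laplacian:
  fixes x :: "nat \<Rightarrow> real"
  assumes u: "C_diff d 2 u" and t: "0 < t" and b: "0 \<le> b"
    and ub: "\<And>y. y \<in> Rd d \<Longrightarrow> \<bar>u y\<bar> \<le> C * exp (b * l1norm d y)"
    and Lb: "\<And>y. y \<in> Rd d \<Longrightarrow> \<bar>Laplacian d u y\<bar> \<le> C' * exp (b * l1norm d y)"
  shows "(\<integral>y. Laplacian d u y \<partial>heat_measure d t x) = (\<integral>y. u y * heat_op d t x y \<partial>heat_measure d t x)"
proof -
  let ?H = "heat_measure d t x" and ?v = "2 * t"
  let ?D = "\<lambda>i. partial_deriv i (partial_deriv i u)"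
  interpret H: prob_space ?H by (rule prob_space_heat_measure[OF t])
  have um: "u \<in> borel_measurable (borel_Rd d)"
    by (rule continuous_on_Rd_measurable[OF continuous_on_C_diff[OF u]])
  have Lm: "Laplacian d u \<in> borel_measurable (borel_Rd d)"
    by (rule continuous_on_Rd_measurable[OF continuous_on_Laplacian[OF u]])
  have C: "0 \<le> C" by (rule exp_bound_nonneg[OF ub[OF zero_in_Rd]])
  define g where "g R i y = (?D i y * cutoff R (y i - x i) - u y * cutoff_op ?v R (y i - x i))
      * (\<Prod>j\<in>{1..d} - {i}. cutoff R (y j - x j))" for R i y
  define h where "h n y = (\<Sum>i\<in>{1..d}. g (real (Suc n)) i y)" for n y
  have gi: "integrable ?H (g (real (Suc n)) i)" "(\<integral>y. g (real (Suc n)) i y \<partial>?H) = 0" if "i \<in> {1..d}" for i n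
    using heat_integral_cutoff_component[OF u that t, of "real (Suc n)" x] unfolding g_def[abs_def] by auto
  have h0: "(\<integral>y. h n y \<partial>?H) = 0" for n
    unfolding h_def using gi by (simp add: Bochner_Integration.integral_sum del: One_nat_def)
  \<comment> \<open>In the sum every second derivative carries the same product of all cutoffs, so
    they combine to the Laplacian. Only this sum has a growth bound; the single second derivatives
    have none.\<close>
  have h_eq: "h n y = Laplacian d u y * (\<Prod>j\<in>{1..d}. cutoff (real (Suc n)) (y j - x j))
      - u y * (\<Sum>i\<in>{1..d}. cutoff_op ?v (real (Suc n)) (y i - x i) * (\<Prod>j\<in>{1..d} - {i}. cutoff (real (Suc n)) (y j - x j)))" for n y
  proof -
    let ?c = "\<lambda>j. cutoff (real (Suc n)) (y j - x j)"
    let ?p = "\<lambda>i. \<Prod>j\<in>{1..d} - {i}. ?c j"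
    have p: "(\<Prod>j\<in>{1..d}. ?c j) = ?c i * ?p i" if "i \<in> {1..d}" for i
      using prod.remove[of "{1..d}" i ?c] that by simp
    have "h n y = (\<Sum>i\<in>{1..d}. ?D i y * (?c i * ?p i)) - (\<Sum>i\<in>{1..d}. u y * (cutoff_op ?v (real (Suc n)) (y i - x i) * ?p i))"
      unfolding h_def g_def sum_subtractf[symmetric] by (intro sum.cong refl) (simp add: algebra_simps)
    also have "(\<Sum>i\<in>{1..d}. ?D i y * (?c i * ?p i)) = (\<Sum>i\<in>{1..d}. ?D i y * (\<Prod>j\<in>{1..d}. ?c j))"
      by (intro sum.cong refl) (simp only: p)
    also have "\<dots> = Laplacian d u y * (\<Prod>j\<in>{1..d}. ?c j)"
      by (simp add: Laplacian_def sum_distrib_right)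
    finally show ?thesis by (simp add: sum_distrib_left)
  qed
  have lim: "(\<lambda>n. h n y) \<longlonglongrightarrow> Laplacian d u y - u y * heat_op d t x y" for y
  proof -
    have c: "(\<lambda>n. cutoff (real (Suc n)) r) \<longlonglongrightarrow> 1" "(\<lambda>n. cutoff_op ?v (real (Suc n)) r) \<longlonglongrightarrow> r\<^sup>2 / ?v\<^sup>2 - 1 / ?v" for r
      by (rule LIMSEQ_Suc[OF cutoff_tendsto], rule LIMSEQ_Suc[OF cutoff_op_tendsto])
    have p: "(\<lambda>n. \<Prod>j\<in>J. cutoff (real (Suc n)) (y j - x j)) \<longlonglongrightarrow> 1" for J
      using tendsto_prod[of J "\<lambda>j n. cutoff (real (Suc n)) (y j - x j)" "\<lambda>_. 1"] c(1) by simp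
    have "(\<lambda>n. h n y) \<longlonglongrightarrow> Laplacian d u y * 1 - u y * (\<Sum>i\<in>{1..d}. ((y i - x i)\<^sup>2 / ?v\<^sup>2 - 1 / ?v) * 1)"
      unfolding h_eq by (intro tendsto_intros p c)
    then show ?thesis by (simp add: heat_op_def)
  qed
  define K where "K = 2 / ?v\<^sup>2 + 9 / ?v * 3 + 16"
  have K0: "0 \<le> K" using t by (simp add: K_def)
  have cb: "\<bar>cutoff_op ?v (real (Suc n)) (y i - x i)\<bar> \<le> K * (exp (l1norm d x) * exp (l1norm d y))" if i: "i \<in> {1..d}" for n y i
  proof -
    let ?e = "exp (l1norm d x) * exp (l1norm d y)" and ?r = "y i - x i"
    have e1: "1 \<le> ?e" by (simp add: exp_add[symmetric])
    have sq: "?r\<^sup>2 \<le> 2 * ?e" using square_le_exp[of ?r] exp_component_le[OF i, of y x] by linarith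
    have "\<bar>cutoff_op ?v (real (Suc n)) ?r\<bar> \<le> ?r\<^sup>2 / ?v\<^sup>2 + 9 / ?v * (1 + ?r\<^sup>2) + 16"
      by (rule cutoff_op_bound) (use t in auto)
    also have "\<dots> \<le> (2 * ?e) / ?v\<^sup>2 + 9 / ?v * (3 * ?e) + 16 * ?e"
      using sq e1 t by (intro add_mono divide_right_mono mult_left_mono) auto
    also have "\<dots> = K * ?e" by (simp add: K_def algebra_simps)
    finally show ?thesis .
  qed
  \<comment> \<open>The dominating function. The exponent rises from \<open>b\<close> to
    \<open>b + 1\<close> to absorb the quadratic growth of \<open>cutoff_op\<close>.\<close>
  define w where "w y = C' * exp (b * l1norm d y) + C * (real d * K * exp (l1norm d x)) * exp ((b + 1) * l1norm d y)" for y
  have wi: "integrable ?H w"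
    unfolding w_def[abs_def] using b
    by (intro Bochner_Integration.integrable_add integrable_mult_right heat_measure_exp_l1norm(1)[OF t]) auto
  have hw: "\<bar>h n y\<bar> \<le> w y" if y: "y \<in> Rd d" for n y
  proof -
    let ?e = "exp (l1norm d x) * exp (l1norm d y)"
    have p: "\<bar>\<Prod>j\<in>J. cutoff (real (Suc n)) (y j - x j)\<bar> \<le> 1" for J
      unfolding abs_prod using cutoff_range by (intro prod_le_1) auto
    have "\<bar>Laplacian d u y * (\<Prod>j\<in>{1..d}. cutoff (real (Suc n)) (y j - x j))\<bar> \<le> (C' * exp (b * l1norm d y)) * 1"
      unfolding abs_mult using Lb[OF y] p by (intro mult_mono) auto
    moreover have "\<bar>\<Sum>i\<in>{1..d}. cutoff_op ?v (real (Suc n)) (y i - x i) * (\<Prod>j\<in>{1..d} - {i}. cutoff (real (Suc n)) (y j - x j))\<bar>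
       \<le> (\<Sum>i\<in>{1..d}. (K * ?e) * 1)"
      by (rule order_trans[OF sum_abs], rule sum_mono, unfold abs_mult, rule mult_mono) (use cb p K0 in auto)
    then have "\<bar>u y * (\<Sum>i\<in>{1..d}. cutoff_op ?v (real (Suc n)) (y i - x i) * (\<Prod>j\<in>{1..d} - {i}. cutoff (real (Suc n)) (y j - x j)))\<bar>
      \<le> (C * exp (b * l1norm d y)) * (real d * (K * ?e))"
      unfolding abs_mult using ub[OF y] C by (intro mult_mono) auto
    moreover have "(C * exp (b * l1norm d y)) * (real d * (K * ?e)) = C * (real d * K * exp (l1norm d x)) * exp ((b + 1) * l1norm d y)"
      by (simp add: distrib_right exp_add)
    ultimately show ?thesis unfolding h_eq w_def by linarith
  qed
  have limm: "(\<lambda>y. Laplacian d u y - u y * heat_op d t x y) \<in> borel_measurable ?H"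
    unfolding measurable_cong_sets[OF sets_heat_measure refl]
    by (intro borel_measurable_diff borel_measurable_times Lm um measurable_heat_op)
  have "(\<lambda>n. \<integral>y. h n y \<partial>?H) \<longlonglongrightarrow> (\<integral>y. Laplacian d u y - u y * heat_op d t x y \<partial>?H)"
  proof (rule integral_dominated_convergence[OF limm _ wi])
    show "h n \<in> borel_measurable ?H" for n
      unfolding h_def[abs_def] using borel_measurable_integrable[OF gi(1)] by (intro borel_measurable_sum)
    show "AE y in ?H. (\<lambda>n. h n y) \<longlonglongrightarrow> Laplacian d u y - u y * heat_op d t x y" using lim by simp
    show "AE y in ?H. norm (h n y) \<le> w y" for n
      using hw by (intro AE_I2) (simp add: space_heat_measure)
  qed
  then have 0: "(\<integral>y. Laplacian d u y - u y * heat_op d t x y \<partial>?H) = 0"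
    unfolding h0 by (simp add: LIMSEQ_const_iff)
  have iL: "integrable ?H (Laplacian d u)"
    by (rule integrable_heat_measure_bound(1)[OF t Lm Lb b])
  have iu: "integrable ?H (\<lambda>y. u y * heat_op d t x y)"
  proof (rule integrable_heat_measure_bound(1)[OF t, where b="b + 1"])
    show "(\<lambda>y. u y * heat_op d t x y) \<in> borel_measurable (borel_Rd d)"
      by (intro borel_measurable_times um measurable_heat_op)
    fix y assume y: "y \<in> Rd d"
    have "\<bar>u y * heat_op d t x y\<bar> \<le> (C * exp (b * l1norm d y)) * (real d * (2 / (2 * t)\<^sup>2 + 1 / (2 * t)) * exp (l1norm d x) * exp (l1norm d y))"
      unfolding abs_mult using ub[OF y] heat_op_bound[OF t order_refl] C by (intro mult_mono) auto
    also have "\<dots> = C * (real d * (2 / (2 * t)\<^sup>2 + 1 / (2 * t)) * exp (l1norm d x)) * exp ((b + 1) * l1norm d y)"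
    proof -
      have "(C * exp (b * l1norm d y)) * (real d * k * exp (l1norm d x) * exp (l1norm d y))
        = C * (real d * k * exp (l1norm d x)) * exp ((b + 1) * l1norm d y)" for k
      proof -
        have e: "exp ((b + 1) * l1norm d y) = exp (b * l1norm d y) * exp (l1norm d y)"
          by (simp add: distrib_right exp_add)
        show ?thesis unfolding e by (simp add: mult_ac)
      qed
      then show ?thesis .
    qed
    finally show "\<bar>u y * heat_op d t x y\<bar> \<le> \<dots>" .
  qed (use b in simp)
  show ?thesis using 0 iL iu by simp
qed

section \<open>The heat equation and its integration in time\<close>

lemma heat_density_exp:
  assumes t: "0 < t"
  shows "heat_density d t x y = exp (- (real d / 2) * ln (4 * pi * t) - (\<Sum>j\<in>{1..d}. (y j - x j)\<^sup>2) / (4 * t))"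
proof -
  have "normal_density m (sqrt (2 * t)) s = exp (- ln (4 * pi * t) / 2 - (s - m)\<^sup>2 / (4 * t))" for m s
  proof -
    have "1 / sqrt (4 * pi * t) = exp (- ln (4 * pi * t) / 2)"
      using t by (simp add: ln_sqrt[symmetric] exp_minus inverse_eq_divide)
    moreover have "normal_density m (sqrt (2 * t)) s = 1 / sqrt (4 * pi * t) * exp (- (s - m)\<^sup>2 / (4 * t))"
      using t by (simp add: normal_density_def)
    ultimately have "normal_density m (sqrt (2 * t)) s = exp (- ln (4 * pi * t) / 2 + - (s - m)\<^sup>2 / (4 * t))"
      unfolding exp_add by simp
    then show ?thesis by simp
  qed
  then show ?thesis
    unfolding heat_density_def
    by (simp add: exp_sum[symmetric] sum_subtractf sum_divide_distrib[symmetric] algebra_simps)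
qed

lemma heat_op_eq: "heat_op d t x y = (\<Sum>j\<in>{1..d}. (y j - x j)\<^sup>2) / (4 * t\<^sup>2) - real d / (2 * t)"
  unfolding heat_op_def by (simp add: sum_subtractf sum_divide_distrib power_mult_distrib)

text \<open>The heat equation for the Gaussian density with discount factor, read off from its
  representation as a single exponential.\<close>

lemma heat_density_has_derivative:
  assumes t: "0 < t"
  shows "((\<lambda>t. exp (- lam * t) * heat_density d t x y) has_real_derivative
      exp (- lam * t) * heat_density d t x y * (heat_op d t x y - lam)) (at t)"
proof -
  define \<rho> where "\<rho> = (\<Sum>j\<in>{1..d}. (y j - x j)\<^sup>2)"
  define E where "E t = - lam * t + (- (real d / 2) * ln (4 * pi * t) - \<rho> / (4 * t))" for t
  have "(E has_real_derivative - lam + (- (real d / 2) * (1 / t) + \<rho> / (4 * t\<^sup>2))) (at t)"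
    unfolding E_def[abs_def] using t
    by (auto intro!: derivative_eq_intros simp: field_simps power2_eq_square)
  then have "((\<lambda>t. exp (E t)) has_real_derivative exp (E t) * (- lam + (- (real d / 2) * (1 / t) + \<rho> / (4 * t\<^sup>2)))) (at t)"
    by (rule DERIV_fun_exp)
  moreover have eq: "exp (E s) = exp (- lam * s) * heat_density d s x y" if "0 < s" for s
    unfolding E_def heat_density_exp[OF that] \<rho>_def exp_add ..
  moreover have "- lam + (- (real d / 2) * (1 / t) + \<rho> / (4 * t\<^sup>2)) = heat_op d t x y - lam"
    by (simp add: heat_op_eq \<rho>_def)
  ultimately have "((\<lambda>t. exp (E t)) has_real_derivative exp (- lam * t) * heat_density d t x y * (heat_op d t x y - lam)) (at t)"
    using t by simp
  then show ?thesis
    by (rule has_field_derivative_transform_within_open[of _ _ _ "{0<..}"]) (use t eq in auto)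
qed

lemma measurable_heat_density_joint:
  "(\<lambda>p. heat_density d (fst p) x (snd p)) \<in> borel_measurable (borel \<Otimes>\<^sub>M borel_Rd d)"
  unfolding heat_density_def
proof (rule borel_measurable_prod)
  fix j assume "j \<in> {1..d}"
  from measurable_compose[OF measurable_snd measurable_coord[OF this]]
  have [measurable]: "(\<lambda>p. snd p j) \<in> borel_measurable (borel \<Otimes>\<^sub>M borel_Rd d)" .
  show "(\<lambda>p. normal_density (x j) (sqrt (2 * fst p)) (snd p j)) \<in> borel_measurable (borel \<Otimes>\<^sub>M borel_Rd d)"
    unfolding normal_density_def by measurable
qed

lemma measurable_heat_op_joint:
  "(\<lambda>p. heat_op d (fst p) x (snd p)) \<in> borel_measurable (borel \<Otimes>\<^sub>M borel_Rd d)"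
  unfolding heat_op_def
proof (rule borel_measurable_sum)
  fix j assume "j \<in> {1..d}"
  from measurable_compose[OF measurable_snd measurable_coord[OF this]]
  have [measurable]: "(\<lambda>p. snd p j) \<in> borel_measurable (borel \<Otimes>\<^sub>M borel_Rd d)" .
  show "(\<lambda>p. (snd p j - x j)\<^sup>2 / (2 * fst p)\<^sup>2 - 1 / (2 * fst p)) \<in> borel_measurable (borel \<Otimes>\<^sub>M borel_Rd d)"
    by measurable
qed

text \<open>\<open>G\<close> is minus the time derivative of the discounted mean of
  \<open>u\<close>. The statement is the integrated form, which Fubini's theorem gives without
  differentiating under the integral. The positive lower end \<open>a\<close> avoids the singularity
  of \<open>heat_op\<close> at time 0.\<close>

lemma heat_time_integral:
  fixes x :: "nat \<Rightarrow> real"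
  assumes u: "C_diff d 2 u" and b: "0 \<le> b" and lam: "0 < lam"
    and ub: "\<And>y. y \<in> Rd d \<Longrightarrow> \<bar>u y\<bar> \<le> C * exp (b * l1norm d y)"
    and Lb: "\<And>y. y \<in> Rd d \<Longrightarrow> \<bar>Laplacian d u y\<bar> \<le> C' * exp (b * l1norm d y)"
    and a: "0 < a" "a \<le> T"
  defines "G \<equiv> \<lambda>t. exp (- lam * t) * (lam * (\<integral>y. u y \<partial>heat_measure d t x) - (\<integral>y. Laplacian d u y \<partial>heat_measure d t x))"
  shows "(\<lambda>t. indicator {a..T} t * G t) \<in> borel_measurable lborel"
    and "(\<integral>t. indicator {a..T} t * G t \<partial>lborel) = exp (- lam * a) * (\<integral>y. u y \<partial>heat_measure d a x) - exp (- lam * T) * (\<integral>y. u y \<partial>heat_measure d T x)"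
proof -
  let ?L = "lebesgue_Rd d"
  let ?H = "\<lambda>t. heat_measure d t x"
  let ?p = "\<lambda>t y. heat_density d t x y"
  have um: "u \<in> borel_measurable (borel_Rd d)"
    by (rule continuous_on_Rd_measurable[OF continuous_on_C_diff[OF u]])
  have Lm: "Laplacian d u \<in> borel_measurable (borel_Rd d)"
    by (rule continuous_on_Rd_measurable[OF continuous_on_Laplacian[OF u]])
  have C: "0 \<le> C" by (rule exp_bound_nonneg[OF ub[OF zero_in_Rd]])
  have sL: "sets ?L = sets (borel_Rd d)" by (rule sets_lebesgue_Rd)
  interpret L: product_sigma_finite "\<lambda>j::nat. lborel :: real measure" ..
  interpret Lf: finite_product_sigma_finite "\<lambda>j::nat. lborel :: real measure" "{1..d}" by standard simp
  interpret P: pair_sigma_finite "lborel :: real measure" ?L ..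
  \<comment> \<open>\<open>u\<close> times the time derivative of the discounted density.
    Integrating over space first leads to \<open>- G\<close>, integrating over time first to the
    difference of the boundary values.\<close>
  define F where "F p = indicator {a..T} (fst p) * (u (snd p) * (exp (- lam * fst p) * ?p (fst p) (snd p) * (heat_op d (fst p) x (snd p) - lam)))"
    for p :: "real \<times> (nat \<Rightarrow> real)"
  have Fm: "F \<in> borel_measurable (lborel \<Otimes>\<^sub>M ?L)"
  proof -
    have "F \<in> borel_measurable (borel \<Otimes>\<^sub>M borel_Rd d)"
      unfolding F_def[abs_def]
      by (intro borel_measurable_times borel_measurable_diff measurable_heat_density_joint measurable_heat_op_joint
          measurable_compose[OF measurable_snd um] borel_measurable_const) measurable
    moreover have "sets (lborel \<Otimes>\<^sub>M ?L) = sets (borel \<Otimes>\<^sub>M borel_Rd d)"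
      by (rule sets_pair_measure_cong) (simp_all add: sL del: One_nat_def)
    ultimately show ?thesis using measurable_cong_sets[OF _ refl] by blast
  qed
  define D where "D = real d * (2 / (2 * a)\<^sup>2 + 1 / (2 * a)) * exp (l1norm d x) + lam"
  have uo: "\<bar>u y * (heat_op d t x y - lam)\<bar> \<le> C * D * exp ((b + 1) * l1norm d y)" if y: "y \<in> Rd d" and t: "a \<le> t" for y t
  proof -
    have e1: "1 \<le> exp (l1norm d y)" by simp
    have "\<bar>heat_op d t x y - lam\<bar> \<le> \<bar>heat_op d t x y\<bar> + lam * 1" using lam by simp
    also have "\<dots> \<le> real d * (2 / (2 * a)\<^sup>2 + 1 / (2 * a)) * exp (l1norm d x) * exp (l1norm d y) + lam * exp (l1norm d y)"
      using heat_op_bound[OF a(1) t] e1 lam by (intro add_mono mult_left_mono) auto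
    also have "\<dots> = D * exp (l1norm d y)" by (simp add: D_def distrib_right)
    finally have "\<bar>u y * (heat_op d t x y - lam)\<bar> \<le> (C * exp (b * l1norm d y)) * (D * exp (l1norm d y))"
      unfolding abs_mult using ub[OF y] C by (intro mult_mono) auto
    also have "\<dots> = C * D * exp ((b + 1) * l1norm d y)" by (simp add: distrib_right exp_add)
    finally show ?thesis .
  qed
  have uom: "(\<lambda>y. u y * (heat_op d t x y - lam)) \<in> borel_measurable (borel_Rd d)" for t
    by (intro borel_measurable_times borel_measurable_diff um measurable_heat_op borel_measurable_const)
  have pL: "?p t \<in> borel_measurable ?L" "(\<lambda>y. u y * (heat_op d t x y - lam)) \<in> borel_measurable ?L" for t
    using measurable_heat_density uom unfolding measurable_cong_sets[OF sL refl] by auto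
  have Ft: "integrable ?L (\<lambda>y. F (t, y))"
    and FtI: "(\<integral>y. F (t, y) \<partial>?L) = indicator {a..T} t * (exp (- lam * t) * (\<integral>y. u y * (heat_op d t x y - lam) \<partial>?H t))"
    and FtN: "(\<integral>y. \<bar>F (t, y)\<bar> \<partial>?L) = indicator {a..T} t * (exp (- lam * t) * (\<integral>y. \<bar>u y * (heat_op d t x y - lam)\<bar> \<partial>?H t))" for t
  proof -
    have e: "F (t, y) = indicator {a..T} t * (exp (- lam * t) * (?p t y * (u y * (heat_op d t x y - lam))))" for y
      by (simp add: F_def)
    have e': "\<bar>F (t, y)\<bar> = indicator {a..T} t * (exp (- lam * t) * (?p t y * \<bar>u y * (heat_op d t x y - lam)\<bar>))" for y
      unfolding e using heat_density_nonneg[of d t x y] by (simp add: abs_mult)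
    have "integrable ?L (\<lambda>y. F (t, y)) \<and> (\<integral>y. F (t, y) \<partial>?L) = indicator {a..T} t * (exp (- lam * t) * (\<integral>y. u y * (heat_op d t x y - lam) \<partial>?H t))
       \<and> (\<integral>y. \<bar>F (t, y)\<bar> \<partial>?L) = indicator {a..T} t * (exp (- lam * t) * (\<integral>y. \<bar>u y * (heat_op d t x y - lam)\<bar> \<partial>?H t))"
    proof (cases "t \<in> {a..T}")
      case False then show ?thesis by (simp add: F_def)
    next
      case True
      then have t: "0 < t" using a by simp
      have "integrable (?H t) (\<lambda>y. u y * (heat_op d t x y - lam))"
        by (rule integrable_heat_measure_bound(1)[OF t uom uo]) (use True b in auto)
      then have i: "integrable ?L (\<lambda>y. ?p t y * (u y * (heat_op d t x y - lam)))"
        unfolding heat_measure_eq_density[OF t] by (subst (asm) integrable_density) (use pL heat_density_nonneg in auto)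
      have "(\<integral>y. u y * (heat_op d t x y - lam) \<partial>?H t) = (\<integral>y. ?p t y * (u y * (heat_op d t x y - lam)) \<partial>?L)"
        unfolding heat_measure_eq_density[OF t] by (subst integral_density) (use pL heat_density_nonneg in auto)
      moreover have "(\<integral>y. \<bar>u y * (heat_op d t x y - lam)\<bar> \<partial>?H t) = (\<integral>y. ?p t y * \<bar>u y * (heat_op d t x y - lam)\<bar> \<partial>?L)"
        unfolding heat_measure_eq_density[OF t]
        by (subst integral_density) (use pL borel_measurable_abs[OF pL(2)] heat_density_nonneg in auto)
      ultimately show ?thesis unfolding e' unfolding e using i
        by simp
    qed
    then show "integrable ?L (\<lambda>y. F (t, y))"
      "(\<integral>y. F (t, y) \<partial>?L) = indicator {a..T} t * (exp (- lam * t) * (\<integral>y. u y * (heat_op d t x y - lam) \<partial>?H t))"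
      "(\<integral>y. \<bar>F (t, y)\<bar> \<partial>?L) = indicator {a..T} t * (exp (- lam * t) * (\<integral>y. \<bar>u y * (heat_op d t x y - lam)\<bar> \<partial>?H t))" by auto
  qed
  have iF: "integrable (lborel \<Otimes>\<^sub>M ?L) F"
  proof (rule P.Fubini_integrable[OF Fm])
    define K where "K = C * D * 2 ^ d * exp ((b + 1) * l1norm d x + real d * (b + 1)\<^sup>2 * T)"
    show "integrable lborel (\<lambda>t. \<integral>y. norm (F (t, y)) \<partial>?L)"
    proof (rule Bochner_Integration.integrable_bound)
      show "integrable lborel (\<lambda>t. indicator {a..T} t *\<^sub>R \<bar>K\<bar>)"
        by (intro integrable_scaleR_left integrable_real_indicator) (use a in \<open>auto simp: emeasure_lborel_Icc\<close>)
      have "(\<lambda>p. norm (F p)) \<in> borel_measurable (lborel \<Otimes>\<^sub>M ?L)" using Fm by simp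
      then show "(\<lambda>t. \<integral>y. norm (F (t, y)) \<partial>?L) \<in> borel_measurable lborel"
        using Lf.borel_measurable_lebesgue_integral[of "\<lambda>t y. norm (F (t, y))" lborel] by simp
      show "AE t in lborel. norm (\<integral>y. norm (F (t, y)) \<partial>?L) \<le> norm (indicator {a..T} t *\<^sub>R \<bar>K\<bar>)"
      proof (rule AE_I2)
        fix t :: real
        show "norm (\<integral>y. norm (F (t, y)) \<partial>?L) \<le> norm (indicator {a..T} t *\<^sub>R \<bar>K\<bar>)"
        proof (cases "t \<in> {a..T}")
          case True
          then have t: "0 < t" "a \<le> t" "t \<le> T" using a by auto
          have "0 \<le> C * D" using C lam a by (simp add: D_def)
          have "\<bar>\<integral>y. \<bar>u y * (heat_op d t x y - lam)\<bar> \<partial>?H t\<bar> \<le> C * D * 2 ^ d * exp ((b + 1) * l1norm d x + real d * (b + 1)\<^sup>2 * t)"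
            by (rule integrable_heat_measure_bound(2)[OF t(1) borel_measurable_abs[OF uom]]) (use uo t b in auto)
          also have "\<dots> \<le> K" unfolding K_def using \<open>0 \<le> C * D\<close> t b by (intro mult_left_mono) (auto intro: mult_left_mono)
          finally have *: "\<bar>\<integral>y. \<bar>u y * (heat_op d t x y - lam)\<bar> \<partial>?H t\<bar> \<le> K" .
          have n: "(\<integral>y. norm (F (t, y)) \<partial>?L) = exp (- lam * t) * (\<integral>y. \<bar>u y * (heat_op d t x y - lam)\<bar> \<partial>?H t)"
            using True FtN[of t] by (simp add: abs_mult)
          have "norm (\<integral>y. norm (F (t, y)) \<partial>?L) = exp (- lam * t) * \<bar>\<integral>y. \<bar>u y * (heat_op d t x y - lam)\<bar> \<partial>?H t\<bar>"
            unfolding n unfolding real_norm_def by (subst abs_mult) simp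
          also have "\<dots> \<le> 1 * K" using * t lam by (intro mult_mono) auto
          finally show ?thesis using True by simp
        next
          case False
          then have "F (t, y) = 0" for y by (simp add: F_def)
          then show ?thesis by simp
        qed
      qed
    qed
    show "AE t in lborel. integrable ?L (\<lambda>y. F (t, y))" using Ft by simp
  qed
  \<comment> \<open>This is where the weight \<open>heat_op\<close> is exchanged for the Laplacian
    of \<open>u\<close>.\<close>
  have Gt: "(\<integral>y. F (t, y) \<partial>?L) = - (indicator {a..T} t * G t)" for t
  proof (cases "t \<in> {a..T}")
    case True
    then have t: "0 < t" "a \<le> t" using a by auto
    have iu: "integrable (?H t) u" by (rule integrable_heat_measure_bound(1)[OF t(1) um ub b])
    have iuo: "integrable (?H t) (\<lambda>y. u y * (heat_op d t x y - lam))"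
      by (rule integrable_heat_measure_bound(1)[OF t(1) uom uo]) (use t b in auto)
    have "(\<integral>y. u y * heat_op d t x y \<partial>?H t) = (\<integral>y. u y * (heat_op d t x y - lam) + lam * u y \<partial>?H t)"
      by (rule Bochner_Integration.integral_cong) (auto simp: algebra_simps)
    also have "\<dots> = (\<integral>y. u y * (heat_op d t x y - lam) \<partial>?H t) + lam * (\<integral>y. u y \<partial>?H t)"
      using iu iuo by simp
    finally have e: "(\<integral>y. u y * (heat_op d t x y - lam) \<partial>?H t) = (\<integral>y. Laplacian d u y \<partial>?H t) - lam * (\<integral>y. u y \<partial>?H t)"
      using heat_integral_Laplacian[OF u t(1) b ub Lb, of x] by simp
    show ?thesis unfolding FtI G_def e by (simp add: algebra_simps)
  next
    case False
    then have "F (t, y) = 0" for y by (simp add: F_def)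
    then show ?thesis using False by simp
  qed
  have "(\<lambda>t. \<integral>y. F (t, y) \<partial>?L) \<in> borel_measurable lborel"
    using Lf.borel_measurable_lebesgue_integral[of "\<lambda>t y. F (t, y)" lborel] Fm by simp
  then have "(\<lambda>t. - (\<integral>y. F (t, y) \<partial>?L)) \<in> borel_measurable lborel" by simp
  then show "(\<lambda>t. indicator {a..T} t * G t) \<in> borel_measurable lborel" unfolding Gt by simp
  have Fy: "(\<integral>t. F (t, y) \<partial>lborel) = u y * (exp (- lam * T) * ?p T y - exp (- lam * a) * ?p a y)" for y
  proof -
    let ?q' = "\<lambda>t. exp (- lam * t) * ?p t y * (heat_op d t x y - lam)"
    have "(\<integral>t. ?q' t * indicator {a..T} t \<partial>lborel) = exp (- lam * T) * ?p T y - exp (- lam * a) * ?p a y"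
    proof (rule integral_FTC_Icc_real[OF a(2)])
      fix t assume t: "a \<le> t" "t \<le> T"
      then have t0: "0 < t" using a by simp
      show "((\<lambda>t. exp (- lam * t) * ?p t y) has_real_derivative ?q' t) (at t)"
        by (rule heat_density_has_derivative[OF t0])
      have "isCont (\<lambda>t. exp (- lam * t) * ?p t y) t"
        by (rule DERIV_isCont[OF heat_density_has_derivative[OF t0]])
      moreover have "isCont (\<lambda>t. heat_op d t x y - lam) t"
        unfolding heat_op_def using t0 by (intro continuous_intros) auto
      ultimately show "isCont ?q' t" by (rule isCont_mult)
    qed
    moreover have "(\<lambda>t. F (t, y)) = (\<lambda>t. u y * (?q' t * indicator {a..T} t))" by (auto simp: F_def mult_ac)
    ultimately show ?thesis by simp
  qed
  have mH: "(\<integral>y. u y * ?p t y \<partial>?L) = (\<integral>y. u y \<partial>?H t)" "integrable ?L (\<lambda>y. u y * ?p t y)" if t: "0 < t" for t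
  proof -
    have uL: "u \<in> borel_measurable ?L" using um unfolding measurable_cong_sets[OF sL refl] .
    have "integrable (?H t) u" by (rule integrable_heat_measure_bound(1)[OF t um ub b])
    then show "integrable ?L (\<lambda>y. u y * ?p t y)"
      unfolding heat_measure_eq_density[OF t]
      by (subst (asm) integrable_density) (use pL uL heat_density_nonneg in \<open>auto simp: mult.commute\<close>)
    show "(\<integral>y. u y * ?p t y \<partial>?L) = (\<integral>y. u y \<partial>?H t)"
      unfolding heat_measure_eq_density[OF t]
      by (subst integral_density) (use pL uL heat_density_nonneg in \<open>auto simp: mult.commute\<close>)
  qed
  have "(\<integral>t. indicator {a..T} t * G t \<partial>lborel) = - (\<integral>t. \<integral>y. F (t, y) \<partial>?L \<partial>lborel)"
    unfolding Gt by simp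
  also have "(\<integral>t. \<integral>y. F (t, y) \<partial>?L \<partial>lborel) = (\<integral>y. \<integral>t. F (t, y) \<partial>lborel \<partial>?L)"
    using P.Fubini_integral[of "\<lambda>t y. F (t, y)"] iF by simp
  also have "\<dots> = (\<integral>y. exp (- lam * T) * (u y * ?p T y) - exp (- lam * a) * (u y * ?p a y) \<partial>?L)"
    unfolding Fy by (simp add: algebra_simps)
  also have "\<dots> = exp (- lam * T) * (\<integral>y. u y \<partial>?H T) - exp (- lam * a) * (\<integral>y. u y \<partial>?H a)"
    using mH[of T] mH[of a] a by simp
  finally show "(\<integral>t. indicator {a..T} t * G t \<partial>lborel) = exp (- lam * a) * (\<integral>y. u y \<partial>?H a) - exp (- lam * T) * (\<integral>y. u y \<partial>?H T)"
    by simp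
qed

text \<open>All the measures are images of one standard Gaussian under
  \<open>w \<mapsto> x + s n * w\<close>, so continuity of \<open>u\<close> gives pointwise
  convergence. The scales are at most 2, whence a common dominating exponential.\<close>

lemma heat_measure_tendsto:
  fixes x :: "nat \<Rightarrow> real"
  assumes u: "continuous_on (Rd d) u" and b: "0 \<le> b" and x: "x \<in> Rd d"
    and ub: "\<And>y. y \<in> Rd d \<Longrightarrow> \<bar>u y\<bar> \<le> C * exp (b * l1norm d y)"
  shows "(\<lambda>n. \<integral>y. u y \<partial>heat_measure d (1 / real (Suc n)) x) \<longlonglongrightarrow> u x"
proof -
  let ?N = "Pi\<^sub>M {1..d} (\<lambda>_. gauss 0 1)"
  define f where "f c w = translate d x (\<lambda>j\<in>{1..d}. c * w j)" for c w
  define s where "s n = sqrt (2 * (1 / real (Suc n)))" for n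
  have s: "0 < s n" "s n \<le> 2" for n
  proof -
    have "2 * (1 / real (Suc n)) \<le> 2\<^sup>2" by (simp add: field_simps)
    then have "sqrt (2 * (1 / real (Suc n))) \<le> sqrt (2\<^sup>2)" by (rule real_sqrt_le_mono)
    then show "s n \<le> 2" unfolding s_def real_sqrt_abs by simp
  qed (simp add: s_def)
  have um: "u \<in> borel_measurable (borel_Rd d)" by (rule continuous_on_Rd_measurable[OF u])
  have C: "0 \<le> C" by (rule exp_bound_nonneg[OF ub[OF x]])
  have N: "prob_space ?N" by (intro prob_space_PiM prob_space_normal_density) simp
  have sN: "sets ?N = sets (borel_Rd d)" by (rule sets_PiM_gauss)
  have fm: "f c \<in> measurable ?N (borel_Rd d)" for c
    unfolding f_def[abs_def] translate_def by (rule measurable_restrict) simp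
  have eq: "(\<integral>y. u y \<partial>heat_measure d (1 / real (Suc n)) x) = (\<integral>w. u (f (s n) w) \<partial>?N)" for n
  proof -
    have "heat_measure d (1 / real (Suc n)) x = distr ?N (borel_Rd d) (f (s n))"
      using distr_product_gauss_affine[of 1 "s n" d x] s[of n] unfolding heat_measure_def f_def[abs_def] s_def by simp
    then show ?thesis by (simp only: integral_distr[OF fm um])
  qed
  have fc: "continuous_on UNIV (\<lambda>c. u (f c w))" for w
  proof (rule continuous_on_compose2[OF u])
    show "continuous_on UNIV (\<lambda>c. f c w)"
    proof (rule continuous_on_coordinatewise_then_product)
      fix j show "continuous_on UNIV (\<lambda>c. f c w j)"
        by (cases "j \<in> {1..d}") (auto simp: f_def translate_def intro!: continuous_intros)
    qed
    show "range (\<lambda>c. f c w) \<subseteq> Rd d" by (auto simp: f_def)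
  qed
  have f0: "f 0 w = x" for w
    using x by (auto simp: f_def translate_def Rd_def PiE_def extensional_def)
  have s0: "s \<longlonglongrightarrow> 0"
  proof -
    have "(\<lambda>n. sqrt (2 * (1 / real (Suc n)))) \<longlonglongrightarrow> sqrt (2 * 0)"
      by (intro tendsto_intros LIMSEQ_Suc[OF lim_1_over_n])
    then show ?thesis unfolding s_def[abs_def] by simp
  qed
  have lim: "(\<lambda>n. u (f (s n) w)) \<longlonglongrightarrow> u x" for w
  proof -
    have "isCont (\<lambda>c. u (f c w)) 0" using fc[of w] by (simp add: continuous_on_eq_continuous_at)
    from isCont_tendsto_compose[OF this s0] show ?thesis by (simp add: f0)
  qed
  have "(\<lambda>n. \<integral>w. u (f (s n) w) \<partial>?N) \<longlonglongrightarrow> (\<integral>w. u x \<partial>?N)"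
  proof (rule integral_dominated_convergence)
    show "integrable ?N (\<lambda>w. (C * exp (b * l1norm d x)) * exp ((b * 2) * l1norm d w))"
      by (intro integrable_mult_right product_gauss_exp_l1norm(1)) simp
    show "(\<lambda>w. u (f (s n) w)) \<in> borel_measurable ?N" for n by (rule measurable_compose[OF fm um])
    show "AE w in ?N. (\<lambda>n. u (f (s n) w)) \<longlonglongrightarrow> u x" using lim by simp
    show "AE w in ?N. norm (u (f (s n) w)) \<le> (C * exp (b * l1norm d x)) * exp ((b * 2) * l1norm d w)" for n
    proof (rule AE_I2)
      fix w
      have l: "l1norm d (\<lambda>j\<in>{1..d}. s n * w j) = s n * l1norm d w"
        using s(1)[of n] by (simp add: l1norm_def abs_mult sum_distrib_left)
      have "l1norm d (f (s n) w) \<le> l1norm d x + s n * l1norm d w"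
        using l1norm_translate[of d x "\<lambda>j\<in>{1..d}. s n * w j"] unfolding l f_def .
      also have "\<dots> \<le> l1norm d x + 2 * l1norm d w" using s(2)[of n] by (simp add: mult_right_mono)
      finally have "b * l1norm d (f (s n) w) \<le> b * (l1norm d x + 2 * l1norm d w)" using b by (rule mult_left_mono)
      then have "C * exp (b * l1norm d (f (s n) w)) \<le> C * (exp (b * l1norm d x) * exp ((b * 2) * l1norm d w))"
        using C by (intro mult_left_mono) (auto simp: exp_add[symmetric] algebra_simps)
      moreover have "\<bar>u (f (s n) w)\<bar> \<le> C * exp (b * l1norm d (f (s n) w))" by (rule ub) (simp add: f_def)
      ultimately show "norm (u (f (s n) w)) \<le> (C * exp (b * l1norm d x)) * exp ((b * 2) * l1norm d w)" by simp
    qed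
  qed simp
  then show ?thesis unfolding eq using prob_space.prob_space[OF N] by simp
qed

section \<open>Passage to the full time axis\<close>

lemma integrable_exponential:
  assumes "0 < c" shows "integrable lborel (\<lambda>t. indicator {0..} t * exp (- c * t :: real))"
proof -
  interpret prob_space "density lborel (\<lambda>x. ennreal (exponential_density c x))"
    by (rule prob_space_exponential_density[OF assms])
  have "integrable (density lborel (\<lambda>x. ennreal (exponential_density c x))) (\<lambda>_. 1 / c :: real)" by simp
  then have "integrable lborel (\<lambda>t. exponential_density c t * (1 / c))"
    by (subst (asm) integrable_density) (use assms exponential_density_nonneg in auto)
  moreover have "(\<lambda>t. exponential_density c t * (1 / c)) = (\<lambda>t. indicator {0..} t * exp (- c * t))"
    using assms by (auto simp: erlang_density_def indicator_def mult.commute)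
  ultimately show ?thesis by simp
qed

text \<open>The discounted mean of \<open>u\<close> runs from \<open>u x\<close> at time 0 to 0 at
  infinity, and minus its derivative is \<open>exp (- lam * t)\<close> times the mean of
  \<open>lam * u - Laplacian d u\<close>. Read with the exponential density this is the
  claim.\<close>

theorem feynman_kac:
  fixes x :: "nat \<Rightarrow> real"
  assumes u: "C_diff d 2 u" and lam: "0 < lam" and x: "x \<in> Rd d"
    and ub: "\<And>b. 0 < b \<Longrightarrow> \<exists>C. \<forall>y\<in>Rd d. \<bar>u y\<bar> \<le> C * exp (b * l1norm d y)"
    and Lb: "\<And>b. 0 < b \<Longrightarrow> \<exists>C. \<forall>y\<in>Rd d. \<bar>Laplacian d u y\<bar> \<le> C * exp (b * l1norm d y)"
  shows "(\<integral>t. (if 0 < t then \<integral>y. u y - Laplacian d u y / lam \<partial>heat_measure d t x else 0)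
      \<partial>density lborel (exponential_density lam)) = u x"
proof -
  \<comment> \<open>Chosen so that \<open>real d * b\<^sup>2 \<le> lam / 2\<close>: the means then
    grow at most like \<open>exp (lam / 2 * t)\<close>, and half of the discount is left for
    integrability.\<close>
  define b where "b = sqrt (lam / (2 * (real d + 1)))"
  have b: "0 < b" using lam by (simp add: b_def)
  have db: "real d * b\<^sup>2 \<le> lam / 2"
  proof -
    have "real d * b\<^sup>2 = lam / 2 * (real d / (real d + 1))" using lam by (simp add: b_def)
    also have "\<dots> \<le> lam / 2 * 1" using lam by (intro mult_left_mono) auto
    finally show ?thesis by simp
  qed
  obtain C where C: "\<bar>u y\<bar> \<le> C * exp (b * l1norm d y)" if "y \<in> Rd d" for y using ub[OF b] by blast
  obtain C' where C': "\<bar>Laplacian d u y\<bar> \<le> C' * exp (b * l1norm d y)" if "y \<in> Rd d" for y using Lb[OF b] by blast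
  have b0: "0 \<le> b" using b by simp
  let ?H = "\<lambda>t. heat_measure d t x"
  have um: "u \<in> borel_measurable (borel_Rd d)"
    by (rule continuous_on_Rd_measurable[OF continuous_on_C_diff[OF u]])
  have Lm: "Laplacian d u \<in> borel_measurable (borel_Rd d)"
    by (rule continuous_on_Rd_measurable[OF continuous_on_Laplacian[OF u]])
  define m where "m t = (\<integral>y. u y \<partial>?H t)" for t
  define k where "k t = (\<integral>y. Laplacian d u y \<partial>?H t)" for t
  define G where "G t = exp (- lam * t) * (lam * m t - k t)" for t
  define a where "a n = 1 / real (Suc n)" for n
  define T where "T n = real (Suc n)" for n
  have aT: "0 < a n" "a n \<le> T n" for n
  proof -
    have "1 / real (Suc n) \<le> 1" by simp
    moreover have "1 \<le> real (Suc n)" by simp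
    ultimately show "a n \<le> T n" unfolding a_def T_def by (rule order_trans)
  qed (simp add: a_def)
  have step: "(\<lambda>t. indicator {a n..T n} t * G t) \<in> borel_measurable lborel"
    "(\<integral>t. indicator {a n..T n} t * G t \<partial>lborel) = exp (- lam * a n) * m (a n) - exp (- lam * T n) * m (T n)" for n
    using heat_time_integral[OF u b0 lam C C' aT, of n x] unfolding G_def m_def k_def by auto
  define B where "B = C * 2 ^ d * exp (b * l1norm d x)"
  define B' where "B' = C' * 2 ^ d * exp (b * l1norm d x)"
  have e2: "exp (b * l1norm d x + real d * b\<^sup>2 * t) \<le> exp (b * l1norm d x) * exp (lam / 2 * t)" if "0 < t" for t
    using db that by (simp add: exp_add mult_right_mono)
  have CC: "0 \<le> C" "0 \<le> C'" by (rule exp_bound_nonneg[OF C[OF x]], rule exp_bound_nonneg[OF C'[OF x]])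
  have mb: "\<bar>m t\<bar> \<le> B * exp (lam / 2 * t)" if t: "0 < t" for t
  proof -
    have "\<bar>m t\<bar> \<le> C * 2 ^ d * exp (b * l1norm d x + real d * b\<^sup>2 * t)"
      unfolding m_def by (rule integrable_heat_measure_bound(2)[OF t um C b0])
    also have "\<dots> \<le> C * 2 ^ d * (exp (b * l1norm d x) * exp (lam / 2 * t))"
      using e2[OF t] CC by (intro mult_left_mono) auto
    finally show ?thesis by (simp add: B_def mult_ac)
  qed
  have kb: "\<bar>k t\<bar> \<le> B' * exp (lam / 2 * t)" if t: "0 < t" for t
  proof -
    have "\<bar>k t\<bar> \<le> C' * 2 ^ d * exp (b * l1norm d x + real d * b\<^sup>2 * t)"
      unfolding k_def by (rule integrable_heat_measure_bound(2)[OF t Lm C' b0])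
    also have "\<dots> \<le> C' * 2 ^ d * (exp (b * l1norm d x) * exp (lam / 2 * t))"
      using e2[OF t] CC by (intro mult_left_mono) auto
    finally show ?thesis by (simp add: B'_def mult_ac)
  qed
  have half: "exp (- lam * t) * exp (lam / 2 * t) = exp (- (lam / 2) * t)" for t
    by (simp add: exp_add[symmetric])
  have Gb: "\<bar>G t\<bar> \<le> (lam * B + B') * exp (- (lam / 2) * t)" if t: "0 < t" for t
  proof -
    have "\<bar>G t\<bar> = exp (- lam * t) * \<bar>lam * m t - k t\<bar>" by (simp add: G_def abs_mult)
    also have "\<dots> \<le> exp (- lam * t) * (lam * (B * exp (lam / 2 * t)) + B' * exp (lam / 2 * t))"
    proof (rule mult_left_mono)
      have "\<bar>lam * m t - k t\<bar> \<le> lam * \<bar>m t\<bar> + \<bar>k t\<bar>" using lam abs_triangle_ineq4[of "lam * m t" "k t"] by (simp add: abs_mult)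
      then show "\<bar>lam * m t - k t\<bar> \<le> lam * (B * exp (lam / 2 * t)) + B' * exp (lam / 2 * t)"
        using mult_left_mono[OF mb[OF t], of lam] kb[OF t] lam by linarith
    qed simp
    also have "\<dots> = (lam * B + B') * (exp (- lam * t) * exp (lam / 2 * t))" by (simp add: algebra_simps)
    finally show ?thesis unfolding half .
  qed
  \<comment> \<open>Measurability of \<open>G\<close> on the positive half line comes from the
    truncations supplied by \<open>heat_time_integral\<close>, whose pointwise limit is
    \<open>G0\<close>.\<close>
  define G0 where "G0 t = indicator {0<..} t * G t" for t
  have lim: "(\<lambda>n. indicator {a n..T n} t * G t) \<longlonglongrightarrow> G0 t" for t
  proof (cases "0 < t")
    case True
    obtain N1 where N1: "1 / t \<le> real N1" using real_arch_simple by blast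
    obtain N2 where N2: "t \<le> real N2" using real_arch_simple by blast
    have "indicator {a n..T n} t * G t = G0 t" if n: "N1 + N2 \<le> n" for n
    proof -
      have "1 / t \<le> real (Suc n)" "t \<le> real (Suc n)" using N1 N2 n by linarith+
      then have "a n \<le> t" "t \<le> T n" using True by (auto simp: a_def T_def field_simps)
      then show ?thesis using True by (simp add: G0_def)
    qed
    then show ?thesis by (intro tendsto_eventually eventually_sequentiallyI[of "N1 + N2"])
  next
    case False
    have "(\<lambda>n. indicator {a n..T n} t * G t) = (\<lambda>_. G0 t)"
    proof
      fix n show "indicator {a n..T n} t * G t = G0 t"
        using False aT(1)[of n] by (simp add: indicator_def G0_def)
    qed
    then show ?thesis by simp
  qed
  have G0m: "G0 \<in> borel_measurable lborel"
    using step(1) lim by (rule borel_measurable_LIMSEQ_real[rotated])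
  have "(\<lambda>n. \<integral>t. indicator {a n..T n} t * G t \<partial>lborel) \<longlonglongrightarrow> (\<integral>t. G0 t \<partial>lborel)"
  proof (rule integral_dominated_convergence[OF G0m step(1)])
    show "integrable lborel (\<lambda>t. (lam * B + B') * (indicator {0..} t * exp (- (lam / 2) * t)))"
      by (intro integrable_mult_right integrable_exponential) (use lam in simp)
    show "AE t in lborel. (\<lambda>n. indicator {a n..T n} t * G t) \<longlonglongrightarrow> G0 t" using lim by simp
    show "AE t in lborel. norm (indicator {a n..T n} t * G t) \<le> (lam * B + B') * (indicator {0..} t * exp (- (lam / 2) * t))" for n
    proof (rule AE_I2)
      fix t :: real
      show "norm (indicator {a n..T n} t * G t) \<le> (lam * B + B') * (indicator {0..} t * exp (- (lam / 2) * t))"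
      proof (cases "t \<in> {a n..T n}")
        case True
        then have "0 < t" using aT(1)[of n] by simp
        then show ?thesis using Gb[of t] True by simp
      next
        case False
        have "0 \<le> lam * B + B'" using CC lam by (simp add: B_def B'_def)
        moreover have "indicator {a n..T n} t = (0 :: real)" using False by (rule indicator_simps(2))
        ultimately show ?thesis by simp
      qed
    qed
  qed
  moreover have "(\<lambda>n. exp (- lam * a n) * m (a n) - exp (- lam * T n) * m (T n)) \<longlonglongrightarrow> exp (- lam * 0) * u x - 0"
  proof (intro tendsto_diff tendsto_mult tendsto_exp tendsto_const)
    show "a \<longlonglongrightarrow> 0" unfolding a_def[abs_def] by (rule LIMSEQ_Suc[OF lim_1_over_n])
    show "(\<lambda>n. m (a n)) \<longlonglongrightarrow> u x"
      unfolding m_def a_def by (rule heat_measure_tendsto[OF continuous_on_C_diff[OF u] b0 x C])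
    show "(\<lambda>n. exp (- lam * T n) * m (T n)) \<longlonglongrightarrow> 0"
    proof (rule Lim_null_comparison)
      show "\<forall>\<^sub>F n in sequentially. norm (exp (- lam * T n) * m (T n)) \<le> B * exp (- (lam / 2) * T n)"
      proof (rule always_eventually, rule allI)
        fix n
        have "0 < T n" by (simp add: T_def)
        have "norm (exp (- lam * T n) * m (T n)) \<le> exp (- lam * T n) * (B * exp (lam / 2 * T n))"
          using mb[OF \<open>0 < T n\<close>] by (simp add: abs_mult)
        also have "\<dots> = B * exp (- (lam / 2) * T n)" using half[of "T n"] by (simp add: mult_ac)
        finally show "norm (exp (- lam * T n) * m (T n)) \<le> B * exp (- (lam / 2) * T n)" .
      qed
      have "filterlim T at_top sequentially"
        unfolding T_def[abs_def] by (rule filterlim_compose[OF filterlim_real_sequentially filterlim_Suc])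
      then have "filterlim (\<lambda>n. lam / 2 * T n) at_top sequentially"
        using lam by (intro filterlim_tendsto_pos_mult_at_top[OF tendsto_const]) auto
      then have "filterlim (\<lambda>n. - (lam / 2 * T n)) at_bot sequentially"
        by (simp add: filterlim_uminus_at_top)
      then have "(\<lambda>n. exp (- (lam / 2) * T n)) \<longlonglongrightarrow> 0"
        using filterlim_compose[OF exp_at_bot] by simp
      then show "(\<lambda>n. B * exp (- (lam / 2) * T n)) \<longlonglongrightarrow> 0" by (rule tendsto_mult_right_zero)
    qed
  qed
  ultimately have GI: "(\<integral>t. G0 t \<partial>lborel) = u x"
    unfolding step(2) using LIMSEQ_unique by force
  have "(\<integral>t. (if 0 < t then \<integral>y. u y - Laplacian d u y / lam \<partial>?H t else 0) \<partial>density lborel (exponential_density lam))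
      = (\<integral>t. (if 0 < t then m t - k t / lam else 0) \<partial>density lborel (exponential_density lam))"
  proof (rule Bochner_Integration.integral_cong[OF refl])
    fix t :: real
    show "(if 0 < t then \<integral>y. u y - Laplacian d u y / lam \<partial>?H t else 0) = (if 0 < t then m t - k t / lam else 0)"
      using integrable_heat_measure_bound(1)[OF _ um C b0] integrable_heat_measure_bound(1)[OF _ Lm C' b0]
      by (simp add: m_def k_def)
  qed
  also have "\<dots> = (\<integral>t. exponential_density lam t * (if 0 < t then m t - k t / lam else 0) \<partial>lborel)"
  proof (subst integral_density)
    \<comment> \<open>Undoing the discount recovers the integrand from \<open>G0\<close>, whose
      measurability is known.\<close>
    have "(\<lambda>t. exp (lam * t) / lam * G0 t) \<in> borel_measurable lborel" using G0m by simp
    moreover have "(\<lambda>t. exp (lam * t) / lam * G0 t) = (\<lambda>t. if 0 < t then m t - k t / lam else 0)"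
    proof
      fix t
      have "exp (lam * t) / lam * (exp (- lam * t) * (lam * m t - k t)) = m t - k t / lam"
        using lam by (simp add: exp_minus field_simps)
      then show "exp (lam * t) / lam * G0 t = (if 0 < t then m t - k t / lam else 0)"
        by (simp add: G0_def G_def)
    qed
    ultimately show "(\<lambda>t. if 0 < t then m t - k t / lam else 0) \<in> borel_measurable lborel" by simp
  qed (use lam exponential_density_nonneg in auto)
  also have "(\<lambda>t. exponential_density lam t * (if 0 < t then m t - k t / lam else 0)) = G0"
    using lam by (auto simp: G0_def G_def erlang_density_def algebra_simps)
  finally show ?thesis using GI by simp
qed

section \<open>Weights and a priori bounds\<close>

text \<open>The inequality \<open>t \<le> exp t\<close> at \<open>t = b * s / real p\<close>, raised
  to the power \<open>p\<close>.\<close>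

lemma power_le_exp:
  assumes "0 < b" "0 < p" "0 \<le> s"
  shows "(s :: real) ^ p \<le> (real p / b) ^ p * exp (b * s)"
proof -
  have "b * s / real p \<le> exp (b * s / real p)" using exp_ge_add_one_self[of "b * s / real p"] by linarith
  then have "s \<le> (real p / b) * exp (b * s / real p)" using assms by (simp add: field_simps)
  then have "s ^ p \<le> ((real p / b) * exp (b * s / real p)) ^ p" using assms by (intro power_mono)
  also have "\<dots> = (real p / b) ^ p * exp (b * s)"
    unfolding power_mult_distrib using assms by (simp add: exp_of_nat_mult[symmetric])
  finally show ?thesis .
qed

text \<open>\<open>\<mu>\<close> is the law of \<open>sqrt 2 * W_R\<close> with \<open>R\<close> exponential: its density is the kernel of
  \<open>lam * (lam - Laplacian)^{-1}\<close>.\<close>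

locale resolvent =
  fixes d :: nat and lam :: real and \<mu> :: "(nat \<Rightarrow> real) measure"
  assumes lam: "0 < lam" and prob_mu: "prob_space \<mu>" and sets_mu: "sets \<mu> = sets (borel_Rd d)"
    and nn_integral_mu: "\<And>(h :: (nat \<Rightarrow> real) \<Rightarrow> real) x. h \<in> borel_measurable (borel_Rd d) \<Longrightarrow>
      (\<integral>\<^sup>+z. ennreal (h (translate d x z)) \<partial>\<mu>)
      = (\<integral>\<^sup>+t. (if 0 < t then \<integral>\<^sup>+y. ennreal (h y) \<partial>heat_measure d t x else 0) \<partial>density lborel (exponential_density lam))"
    and integral_mu: "\<And>(h :: (nat \<Rightarrow> real) \<Rightarrow> real) x. h \<in> borel_measurable (borel_Rd d) \<Longrightarrow> integrable \<mu> (\<lambda>z. h (translate d x z)) \<Longrightarrow>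
      (\<integral>z. h (translate d x z) \<partial>\<mu>)
      = (\<integral>t. (if 0 < t then \<integral>y. h y \<partial>heat_measure d t x else 0) \<partial>density lborel (exponential_density lam))"

text \<open>Multiplication by \<open>exp (\<beta> * t)\<close> turns the exponential density of rate
  \<open>lam\<close> into \<open>lam / (lam - \<beta>)\<close> times the one of rate
  \<open>lam - \<beta>\<close>.\<close>

lemma nn_integral_exponential_exp:
  assumes "0 \<le> \<beta>" "\<beta> < lam"
  shows "(\<integral>\<^sup>+t. (if 0 < t then ennreal (c * exp (\<beta> * t)) else 0) \<partial>density lborel (exponential_density lam))
    \<le> ennreal c * ennreal (lam / (lam - \<beta>))"
proof -
  have "(\<integral>\<^sup>+t. (if 0 < t then ennreal (c * exp (\<beta> * t)) else 0) \<partial>density lborel (exponential_density lam))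
      = (\<integral>\<^sup>+t. ennreal (exponential_density lam t) * (if 0 < t then ennreal (c * exp (\<beta> * t)) else 0) \<partial>lborel)"
    by (subst nn_integral_density) auto
  also have "\<dots> \<le> (\<integral>\<^sup>+t. (ennreal c * ennreal (lam / (lam - \<beta>))) * ennreal (exponential_density (lam - \<beta>) t) \<partial>lborel)"
  proof (rule nn_integral_mono)
    fix t :: real
    show "ennreal (exponential_density lam t) * (if 0 < t then ennreal (c * exp (\<beta> * t)) else 0)
      \<le> (ennreal c * ennreal (lam / (lam - \<beta>))) * ennreal (exponential_density (lam - \<beta>) t)"
    proof (cases "0 < t")
      case True
      have "exponential_density lam t * exp (\<beta> * t) = lam / (lam - \<beta>) * exponential_density (lam - \<beta>) t"
      proof -
        have "exponential_density lam t * exp (\<beta> * t) = lam * exp (\<beta> * t - lam * t)"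
          using True by (simp add: erlang_density_def exp_diff exp_minus field_simps)
        moreover have "exponential_density (lam - \<beta>) t = (lam - \<beta>) * exp (\<beta> * t - lam * t)"
          using True by (simp add: erlang_density_def algebra_simps)
        ultimately show ?thesis using assms by simp
      qed
      then have e: "ennreal (exponential_density lam t) * ennreal (exp (\<beta> * t))
          = ennreal (lam / (lam - \<beta>)) * ennreal (exponential_density (lam - \<beta>) t)"
        using assms exponential_density_nonneg[of lam t] exponential_density_nonneg[of "lam - \<beta>" t]
        by (simp add: ennreal_mult[symmetric])
      have "ennreal (exponential_density lam t) * (ennreal c * ennreal (exp (\<beta> * t)))
         = ennreal c * (ennreal (exponential_density lam t) * ennreal (exp (\<beta> * t)))" by (simp add: mult_ac)
      also have "\<dots> = (ennreal c * ennreal (lam / (lam - \<beta>))) * ennreal (exponential_density (lam - \<beta>) t)"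
        unfolding e by (simp add: mult_ac)
      finally show ?thesis using True by (simp add: ennreal_mult'')
    qed simp
  qed
  also have "\<dots> = ennreal c * ennreal (lam / (lam - \<beta>)) * (\<integral>\<^sup>+t. ennreal (exponential_density (lam - \<beta>) t) \<partial>lborel)"
    by (subst nn_integral_cmult) auto
  also have "(\<integral>\<^sup>+t. ennreal (exponential_density (lam - \<beta>) t) \<partial>lborel) = 1"
  proof -
    interpret prob_space "density lborel (\<lambda>x. ennreal (exponential_density (lam - \<beta>) x))"
      by (rule prob_space_exponential_density) (use assms in simp)
    show ?thesis using emeasure_space_1 by (simp add: emeasure_density)
  qed
  finally show ?thesis by simp
qed

text \<open>An eigenfunction of the Laplacian with eigenvalue
  \<open>real d * \<epsilon>\<^sup>2\<close>, comparable to
  \<open>exp (\<epsilon> * l1norm d y)\<close>. Averaging multiplies it by a factor close to 1 for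
  small \<open>\<epsilon>\<close>; the available estimate for the exponential itself loses
  \<open>2 ^ d\<close> each time, which an iteration could not afford.\<close>

definition cosh_weight :: "nat \<Rightarrow> real \<Rightarrow> (nat \<Rightarrow> real) \<Rightarrow> real" where
  "cosh_weight d \<epsilon> y = (\<Prod>j\<in>{1..d}. cosh (\<epsilon> * y j))"

lemma measurable_cosh_weight: "cosh_weight d \<epsilon> \<in> borel_measurable (borel_Rd d)"
  unfolding cosh_weight_def[abs_def]
proof (rule borel_measurable_prod)
  fix j assume "j \<in> {1..d}"
  from measurable_coord[OF this]
  have [measurable]: "(\<lambda>y. y j) \<in> borel_measurable (borel_Rd d)" .
  show "(\<lambda>y. cosh (\<epsilon> * y j)) \<in> borel_measurable (borel_Rd d)" unfolding cosh_def by measurable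
qed

lemma cosh_weight_pos: "0 < cosh_weight d \<epsilon> y"
  unfolding cosh_weight_def by (intro prod_pos) (simp add: cosh_real_pos)

lemma exp_l1norm_le_cosh_weight: "0 \<le> b \<Longrightarrow> exp (b * l1norm d y) \<le> 2 ^ d * cosh_weight d b y"
proof -
  assume b: "0 \<le> b"
  have "exp (b * l1norm d y) = (\<Prod>j\<in>{1..d}. exp (b * \<bar>y j\<bar>))"
    by (simp add: l1norm_def sum_distrib_left exp_sum)
  also have "\<dots> \<le> (\<Prod>j\<in>{1..d}. 2 * cosh (b * y j))"
  proof (rule prod_mono, rule conjI)
    fix j assume "j \<in> {1..d}"
    show "exp (b * \<bar>y j\<bar>) \<le> 2 * cosh (b * y j)"
      by (cases "0 \<le> y j") (auto simp: cosh_def)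
  qed simp
  also have "\<dots> = 2 ^ d * cosh_weight d b y" by (simp add: cosh_weight_def prod.distrib)
  finally show ?thesis .
qed

lemma has_bochner_integral_gauss_cosh:
  assumes "0 < \<sigma>"
  shows "has_bochner_integral (gauss m \<sigma>) (\<lambda>y. cosh (b * y)) (cosh (b * m) * exp (b\<^sup>2 * \<sigma>\<^sup>2 / 2))"
proof -
  have "has_bochner_integral (gauss m \<sigma>) (\<lambda>y. (exp (b * y) + exp (- b * y)) * (1 / 2))
     ((exp (b * m + b\<^sup>2 * \<sigma>\<^sup>2 / 2) + exp (- b * m + (- b)\<^sup>2 * \<sigma>\<^sup>2 / 2)) * (1 / 2))"
    by (intro has_bochner_integral_mult_left has_bochner_integral_add has_bochner_integral_gauss_exp assms)
  moreover have "(exp (b * m + b\<^sup>2 * \<sigma>\<^sup>2 / 2) + exp (- b * m + (- b)\<^sup>2 * \<sigma>\<^sup>2 / 2)) * (1 / 2) = cosh (b * m) * exp (b\<^sup>2 * \<sigma>\<^sup>2 / 2)"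
    by (simp add: cosh_def exp_add[symmetric] distrib_right)
  moreover have "(\<lambda>y. (exp (b * y) + exp (- b * y)) * (1 / 2)) = (\<lambda>y. cosh (b * y))" by (auto simp: cosh_def)
  ultimately show ?thesis by simp
qed

lemma heat_measure_cosh_weight:
  assumes t: "0 < t"
  shows "(\<integral>\<^sup>+y. ennreal (cosh_weight d b y) \<partial>heat_measure d t x) = ennreal (cosh_weight d b x * exp (real d * b\<^sup>2 * t))"
proof -
  have s: "0 < sqrt (2 * t)" using t by simp
  interpret product_sigma_finite "\<lambda>j. gauss (x j) (sqrt (2 * t))" by (rule product_sigma_finite_gauss[OF s])
  note hb = has_bochner_integral_gauss_cosh[OF s]
  have i: "integrable (heat_measure d t x) (cosh_weight d b)"
    unfolding heat_measure_def cosh_weight_def[abs_def]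
    using hb by (intro product_integrable_prod) (auto simp: has_bochner_integral_iff)
  have "(\<integral>y. cosh_weight d b y \<partial>heat_measure d t x) = (\<Prod>j\<in>{1..d}. cosh (b * x j) * exp (b\<^sup>2 * (sqrt (2 * t))\<^sup>2 / 2))"
    unfolding heat_measure_def cosh_weight_def using hb
    by (subst product_integral_prod) (auto simp: has_bochner_integral_iff intro!: prod.cong)
  also have "\<dots> = cosh_weight d b x * exp (real d * b\<^sup>2 * t)"
    using t by (simp add: prod.distrib cosh_weight_def exp_of_nat_mult[symmetric] mult.assoc)
  finally show ?thesis
    using nn_integral_eq_integral[OF i] cosh_weight_pos[THEN less_imp_le] by simp
qed

text \<open>Only a one-dimensional marginal is involved, so the constant is free of
  \<open>d\<close>. The polynomial dependence of the weights on the dimension rests on this.\<close>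

lemma heat_measure_exp_component:
  assumes t: "0 < t" and j: "j \<in> {1..d}"
  shows "(\<integral>\<^sup>+y. ennreal (exp (b * \<bar>y j\<bar>)) \<partial>heat_measure d t x) \<le> ennreal (2 * exp (\<bar>b\<bar> * \<bar>x j\<bar> + b\<^sup>2 * t))"
proof -
  have s: "0 < sqrt (2 * t)" using t by simp
  let ?M = "\<lambda>j. gauss (x j) (sqrt (2 * t))"
  have c: "distr (heat_measure d t x) (?M j) (\<lambda>y. y j) = ?M j"
    unfolding heat_measure_def by (rule distr_PiM_component[OF prob_space_normal_density[OF s] j])
  have m: "(\<lambda>y. y j) \<in> measurable (heat_measure d t x) (?M j)"
    unfolding heat_measure_def by (rule measurable_component_singleton[OF j])
  have "(\<integral>\<^sup>+y. ennreal (exp (b * \<bar>y j\<bar>)) \<partial>heat_measure d t x) = (\<integral>\<^sup>+s. ennreal (exp (b * \<bar>s\<bar>)) \<partial>distr (heat_measure d t x) (?M j) (\<lambda>y. y j))"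
    by (subst nn_integral_distr[OF m]) auto
  also have "\<dots> = (\<integral>\<^sup>+s. ennreal (exp (b * \<bar>s\<bar>)) \<partial>?M j)" unfolding c ..
  also have "\<dots> = ennreal (\<integral>s. exp (b * \<bar>s\<bar>) \<partial>?M j)"
    by (rule nn_integral_eq_integral[OF gauss_exp_abs(1)[OF s]]) simp
  also have "\<dots> \<le> ennreal (2 * exp (\<bar>b\<bar> * \<bar>x j\<bar> + b\<^sup>2 * t))"
    using gauss_exp_abs(2)[OF s, of "x j" b] t by (intro ennreal_leI) simp
  finally show ?thesis .
qed

context resolvent
begin

sublocale mu: prob_space \<mu> by (rule prob_mu)

lemma space_mu: "space \<mu> = Rd d"
  using sets_eq_imp_space_eq[OF sets_mu] space_borel_Rd by metis

lemma measurable_translate_mu: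
  assumes "h \<in> borel_measurable (borel_Rd d)" "x \<in> Rd d"
  shows "(\<lambda>z. h (translate d x z)) \<in> borel_measurable \<mu>"
  by (rule measurable_compose[OF measurable_translate[OF measurable_const_Rd[OF assms(2)] measurable_ident_sets[OF sets_mu]] assms(1)])

lemma mu_cosh_weight:
  assumes x: "x \<in> Rd d" and b: "real d * b\<^sup>2 < lam"
  shows "integrable \<mu> (\<lambda>z. cosh_weight d b (translate d x z))"
    and "(\<integral>z. cosh_weight d b (translate d x z) \<partial>\<mu>) \<le> lam / (lam - real d * b\<^sup>2) * cosh_weight d b x"
proof -
  have m: "(\<lambda>z. cosh_weight d b (translate d x z)) \<in> borel_measurable \<mu>"
    by (rule measurable_translate_mu[OF measurable_cosh_weight x])
  have "(\<integral>\<^sup>+z. ennreal (cosh_weight d b (translate d x z)) \<partial>\<mu>)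
    = (\<integral>\<^sup>+t. (if 0 < t then ennreal (cosh_weight d b x * exp (real d * b\<^sup>2 * t)) else 0) \<partial>density lborel (exponential_density lam))"
    unfolding nn_integral_mu[OF measurable_cosh_weight]
    by (rule nn_integral_cong) (simp add: heat_measure_cosh_weight)
  also have "\<dots> \<le> ennreal (cosh_weight d b x) * ennreal (lam / (lam - real d * b\<^sup>2))"
    by (rule nn_integral_exponential_exp) (use b in auto)
  also have "\<dots> = ennreal (lam / (lam - real d * b\<^sup>2) * cosh_weight d b x)"
    using lam b cosh_weight_pos[of d b x] by (simp add: ennreal_mult[symmetric] mult.commute)
  finally have le: "(\<integral>\<^sup>+z. ennreal (cosh_weight d b (translate d x z)) \<partial>\<mu>) \<le> ennreal (lam / (lam - real d * b\<^sup>2) * cosh_weight d b x)" .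
  note p = cosh_weight_pos[THEN less_imp_le]
  show i: "integrable \<mu> (\<lambda>z. cosh_weight d b (translate d x z))"
    by (rule integrableI_bounded[OF m]) (use le p in \<open>auto simp: le_less_trans\<close>)
  have "0 \<le> lam / (lam - real d * b\<^sup>2) * cosh_weight d b x" using lam b p by simp
  then show "(\<integral>z. cosh_weight d b (translate d x z) \<partial>\<mu>) \<le> lam / (lam - real d * b\<^sup>2) * cosh_weight d b x"
    using le nn_integral_eq_integral[OF i] p by simp
qed

lemma mu_power_component:
  assumes j: "j \<in> {1..d}" and k: "0 < k"
  shows "(\<integral>\<^sup>+z. ennreal (\<bar>z j\<bar> ^ k) \<partial>\<mu>) \<le> ennreal (4 * (real k / sqrt (lam / 2)) ^ k)"
proof -
  \<comment> \<open>This makes the factor from the exponential time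
    \<open>lam / (lam - lam / 2) = 2\<close>. The constant 4 is this factor times the 2 of
    \<open>heat_measure_exp_component\<close>.\<close>
  define b where "b = sqrt (lam / 2)"
  have b: "0 < b" "b\<^sup>2 = lam / 2" using lam by (auto simp: b_def)
  let ?z = "\<lambda>j\<in>{1..d}. 0 :: real"
  have zR: "?z \<in> Rd d" by (auto simp: Rd_def)
  define h where "h y = (real k / b) ^ k * exp (b * \<bar>y j\<bar>)" for y :: "nat \<Rightarrow> real"
  have hm: "h \<in> borel_measurable (borel_Rd d)"
    using measurable_coord[OF j] unfolding h_def[abs_def] by measurable
  have pw: "\<bar>z j\<bar> ^ k \<le> h (translate d ?z z)" for z :: "nat \<Rightarrow> real"
  proof -
    have "\<bar>z j\<bar> ^ k \<le> (real k / b) ^ k * exp (b * \<bar>z j\<bar>)" by (rule power_le_exp[OF b(1) k]) simp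
    then show ?thesis using j by (simp add: h_def translate_def)
  qed
  have "(\<integral>\<^sup>+z. ennreal (\<bar>z j\<bar> ^ k) \<partial>\<mu>) \<le> (\<integral>\<^sup>+z. ennreal (h (translate d ?z z)) \<partial>\<mu>)"
    by (intro nn_integral_mono ennreal_leI pw)
  also have "\<dots> = (\<integral>\<^sup>+t. (if 0 < t then \<integral>\<^sup>+y. ennreal (h y) \<partial>heat_measure d t ?z else 0) \<partial>density lborel (exponential_density lam))"
    by (rule nn_integral_mu[OF hm])
  also have "\<dots> \<le> (\<integral>\<^sup>+t. (if 0 < t then ennreal (((real k / b) ^ k * 2) * exp (lam / 2 * t)) else 0) \<partial>density lborel (exponential_density lam))"
  proof (rule nn_integral_mono)
    fix t :: real
    show "(if 0 < t then \<integral>\<^sup>+y. ennreal (h y) \<partial>heat_measure d t ?z else 0)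
      \<le> (if 0 < t then ennreal (((real k / b) ^ k * 2) * exp (lam / 2 * t)) else 0)"
    proof (cases "0 < t")
      case True
      have m: "(\<lambda>y. ennreal (exp (b * \<bar>y j\<bar>))) \<in> borel_measurable (heat_measure d t ?z)"
        unfolding measurable_cong_sets[OF sets_heat_measure refl]
        using measurable_coord[OF j] by measurable
      have "(\<integral>\<^sup>+y. ennreal (h y) \<partial>heat_measure d t ?z) = ennreal ((real k / b) ^ k) * (\<integral>\<^sup>+y. ennreal (exp (b * \<bar>y j\<bar>)) \<partial>heat_measure d t ?z)"
        unfolding h_def using b by (subst nn_integral_cmult[OF m, symmetric]) (simp add: ennreal_mult)
      also have "\<dots> \<le> ennreal ((real k / b) ^ k) * ennreal (2 * exp (\<bar>b\<bar> * \<bar>?z j\<bar> + b\<^sup>2 * t))"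
        by (intro mult_left_mono heat_measure_exp_component[OF True j]) simp
      also have "\<dots> = ennreal (((real k / b) ^ k * 2) * exp (lam / 2 * t))"
        using b j by (simp add: ennreal_mult[symmetric] mult_ac)
      finally show ?thesis using True by simp
    qed simp
  qed
  also have "\<dots> \<le> ennreal ((real k / b) ^ k * 2) * ennreal (lam / (lam - lam / 2))"
    by (rule nn_integral_exponential_exp) (use lam in auto)
  also have "\<dots> = ennreal (4 * (real k / b) ^ k)"
  proof -
    have "lam / (lam - lam / 2) = 2" using lam by simp
    then show ?thesis using b by (subst ennreal_mult[symmetric]) auto
  qed
  finally show ?thesis by (simp add: b_def)
qed

end

text \<open>The weight grows with order \<open>p\<close>, while its square is a polynomial without
  mixed terms, so that its mean reduces to moments of single coordinates.\<close>

definition poly_weight :: "nat \<Rightarrow> nat \<Rightarrow> real \<Rightarrow> (nat \<Rightarrow> real) \<Rightarrow> real" where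
  "poly_weight d p A y = sqrt (A + (\<Sum>j\<in>{1..d}. y j ^ (2 * p)))"

lemma measurable_poly_weight: "poly_weight d p A \<in> borel_measurable (borel_Rd d)"
proof -
  have "(\<lambda>y. y j ^ (2 * p)) \<in> borel_measurable (borel_Rd d)" if "j \<in> {1..d}" for j
    using measurable_coord[OF that] by measurable
  then have "(\<lambda>y. A + (\<Sum>j\<in>{1..d}. y j ^ (2 * p))) \<in> borel_measurable (borel_Rd d)"
    by (intro borel_measurable_add borel_measurable_sum) auto
  then show ?thesis unfolding poly_weight_def[abs_def] by simp
qed

lemma poly_weight_nonneg: "0 \<le> A \<Longrightarrow> 0 \<le> poly_weight d p A y"
  unfolding poly_weight_def by (simp add: sum_nonneg)

lemma poly_weight_square: "0 \<le> A \<Longrightarrow> (poly_weight d p A y)\<^sup>2 = A + (\<Sum>j\<in>{1..d}. y j ^ (2 * p))"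
  unfolding poly_weight_def by (simp add: sum_nonneg)

text \<open>The factor of \<open>\<bar>x\<bar> ^ k\<close> may be arbitrarily close to 1, at the
  expense of \<open>C\<close>. With \<open>(1 + \<tau>) ^ k = B\<close>, the first term suffices if
  \<open>\<bar>y\<bar> \<le> \<tau> * \<bar>x\<bar>\<close>, and otherwise \<open>y\<close>
  dominates.\<close>

lemma power_add_le:
  assumes B: "1 < B" and k: "0 < k"
  shows "\<exists>C\<ge>0. \<forall>x y :: real. \<bar>x + y\<bar> ^ k \<le> B * \<bar>x\<bar> ^ k + C * \<bar>y\<bar> ^ k"
proof -
  define \<tau> where "\<tau> = root k B - 1"
  have \<tau>: "0 < \<tau>" using B k by (simp add: \<tau>_def)
  have B': "(1 + \<tau>) ^ k = B" using B k by (simp add: \<tau>_def real_root_pow_pos2)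
  define C where "C = (1 + 1 / \<tau>) ^ k"
  have C0: "0 \<le> C" using \<tau> by (simp add: C_def)
  have "\<bar>x + y\<bar> ^ k \<le> B * \<bar>x\<bar> ^ k + C * \<bar>y\<bar> ^ k" for x y :: real
  proof (cases "\<bar>y\<bar> \<le> \<tau> * \<bar>x\<bar>")
    case True
    then have "\<bar>x + y\<bar> \<le> (1 + \<tau>) * \<bar>x\<bar>" using abs_triangle_ineq[of x y] by (simp add: distrib_right)
    then have "\<bar>x + y\<bar> ^ k \<le> ((1 + \<tau>) * \<bar>x\<bar>) ^ k" by (rule power_mono) simp
    also have "\<dots> = B * \<bar>x\<bar> ^ k" by (simp add: power_mult_distrib B')
    finally show ?thesis using C0 by (simp add: add_increasing2)
  next
    case False
    then have "\<bar>x\<bar> \<le> (1 / \<tau>) * \<bar>y\<bar>" using \<tau> by (simp add: field_simps)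
    then have "\<bar>x + y\<bar> \<le> (1 + 1 / \<tau>) * \<bar>y\<bar>" using abs_triangle_ineq[of x y] by (simp add: distrib_right)
    then have "\<bar>x + y\<bar> ^ k \<le> ((1 + 1 / \<tau>) * \<bar>y\<bar>) ^ k" by (rule power_mono) simp
    also have "\<dots> = C * \<bar>y\<bar> ^ k" by (simp add: power_mult_distrib C_def)
    finally show ?thesis using B by (simp add: add_increasing)
  qed
  then show ?thesis using C0 by blast
qed

context resolvent
begin

text \<open>The moments of the noise contribute \<open>real d * (C * D)\<close>, which the gain
  \<open>(B - 1) * A\<close> in the constant part of the weight absorbs. This is the reason for the
  lower bound on \<open>A\<close>.\<close>

lemma mu_poly_weight:
  assumes p: "0 < p" and B: "1 < B" and C: "0 \<le> C"
    and CB: "\<And>x y :: real. \<bar>x + y\<bar> ^ (2 * p) \<le> B * \<bar>x\<bar> ^ (2 * p) + C * \<bar>y\<bar> ^ (2 * p)"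
    and D: "D = 4 * (real (2 * p) / sqrt (lam / 2)) ^ (2 * p)"
    and A: "real d * (C * D / (B - 1)) \<le> A" and x: "x \<in> Rd d"
  shows "L2_le \<mu> (\<lambda>z. poly_weight d p A (translate d x z)) (sqrt B * poly_weight d p A x)"
proof (rule L2_leI)
  have D0: "0 \<le> D" using lam by (simp add: D)
  have A0: "0 \<le> A"
  proof -
    have "0 \<le> real d * (C * D / (B - 1))" using C D0 B by simp
    then show ?thesis using A by linarith
  qed
  have dCD: "real d * (C * D) \<le> (B - 1) * A"
  proof -
    have "(B - 1) * (real d * (C * D / (B - 1))) \<le> (B - 1) * A" using A B by (intro mult_left_mono) auto
    then show ?thesis using B by simp
  qed
  show "(\<lambda>z. poly_weight d p A (translate d x z)) \<in> borel_measurable \<mu>"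
    by (rule measurable_translate_mu[OF measurable_poly_weight x])
  show "0 \<le> sqrt B * poly_weight d p A x" using B poly_weight_nonneg[OF A0] by simp
  have zm: "(\<lambda>z. ennreal (\<bar>z j\<bar> ^ (2 * p))) \<in> borel_measurable \<mu>" if "j \<in> {1..d}" for j
    unfolding measurable_cong_sets[OF sets_mu refl]
    using measurable_coord[OF that] by measurable
  define S where "S = (\<Sum>j\<in>{1..d}. x j ^ (2 * p))"
  have S0: "0 \<le> S" by (simp add: S_def sum_nonneg)
  have ab: "\<bar>s\<bar> ^ (2 * p) = s ^ (2 * p)" for s :: real by (simp add: power_mult)
  have pw: "ennreal ((poly_weight d p A (translate d x z))\<^sup>2) \<le> ennreal (A + B * S) + (\<Sum>j\<in>{1..d}. ennreal C * ennreal (\<bar>z j\<bar> ^ (2 * p)))" for z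
  proof -
    have "(poly_weight d p A (translate d x z))\<^sup>2 = A + (\<Sum>j\<in>{1..d}. \<bar>x j + z j\<bar> ^ (2 * p))"
      unfolding poly_weight_square[OF A0] ab by (auto simp: translate_def intro!: sum.cong)
    also have "\<dots> \<le> A + (\<Sum>j\<in>{1..d}. B * \<bar>x j\<bar> ^ (2 * p) + C * \<bar>z j\<bar> ^ (2 * p))"
      by (intro add_left_mono sum_mono CB)
    also have "\<dots> = (A + B * S) + (\<Sum>j\<in>{1..d}. C * \<bar>z j\<bar> ^ (2 * p))"
      unfolding ab by (simp add: S_def sum.distrib sum_distrib_left)
    finally have "ennreal ((poly_weight d p A (translate d x z))\<^sup>2) \<le> ennreal ((A + B * S) + (\<Sum>j\<in>{1..d}. C * \<bar>z j\<bar> ^ (2 * p)))"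
      by (rule ennreal_leI)
    also have "\<dots> = ennreal (A + B * S) + ennreal (\<Sum>j\<in>{1..d}. C * \<bar>z j\<bar> ^ (2 * p))"
      using A0 B S0 C by (intro ennreal_plus) (auto intro!: sum_nonneg)
    also have "ennreal (\<Sum>j\<in>{1..d}. C * \<bar>z j\<bar> ^ (2 * p)) = (\<Sum>j\<in>{1..d}. ennreal C * ennreal (\<bar>z j\<bar> ^ (2 * p)))"
      using C by (subst sum_ennreal[symmetric]) (auto simp: ennreal_mult)
    finally show ?thesis .
  qed
  have "(\<integral>\<^sup>+z. ennreal ((poly_weight d p A (translate d x z))\<^sup>2) \<partial>\<mu>)
     \<le> (\<integral>\<^sup>+z. ennreal (A + B * S) + (\<Sum>j\<in>{1..d}. ennreal C * ennreal (\<bar>z j\<bar> ^ (2 * p))) \<partial>\<mu>)"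
    by (rule nn_integral_mono) (rule pw)
  also have "\<dots> = ennreal (A + B * S) + (\<Sum>j\<in>{1..d}. ennreal C * (\<integral>\<^sup>+z. ennreal (\<bar>z j\<bar> ^ (2 * p)) \<partial>\<mu>))"
  proof -
    have sm: "(\<lambda>z. \<Sum>j\<in>{1..d}. ennreal C * ennreal (\<bar>z j\<bar> ^ (2 * p))) \<in> borel_measurable \<mu>"
      using zm by (intro borel_measurable_sum borel_measurable_times_ennreal borel_measurable_const)
    have "(\<integral>\<^sup>+z. (\<Sum>j\<in>{1..d}. ennreal C * ennreal (\<bar>z j\<bar> ^ (2 * p))) \<partial>\<mu>)
        = (\<Sum>j\<in>{1..d}. \<integral>\<^sup>+z. ennreal C * ennreal (\<bar>z j\<bar> ^ (2 * p)) \<partial>\<mu>)"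
      using zm by (intro nn_integral_sum borel_measurable_times_ennreal borel_measurable_const)
    also have "\<dots> = (\<Sum>j\<in>{1..d}. ennreal C * (\<integral>\<^sup>+z. ennreal (\<bar>z j\<bar> ^ (2 * p)) \<partial>\<mu>))"
      by (rule sum.cong[OF refl nn_integral_cmult[OF zm]])
    finally show ?thesis
      by (subst nn_integral_add[OF borel_measurable_const sm]) (simp add: mu.emeasure_space_1)
  qed
  also have "\<dots> \<le> ennreal (A + B * S) + (\<Sum>j\<in>{1..d}. ennreal C * ennreal D)"
    using p unfolding D by (intro add_left_mono sum_mono mult_left_mono mu_power_component) auto
  also have "\<dots> = ennreal (A + B * S + real d * (C * D))"
    using A0 B S0 C D0 by (simp add: ennreal_mult[symmetric] ennreal_of_nat_eq_real_of_nat)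
  also have "\<dots> \<le> ennreal ((sqrt B * poly_weight d p A x)\<^sup>2)"
  proof (rule ennreal_leI)
    have "(sqrt B * poly_weight d p A x)\<^sup>2 = B * (A + S)"
      using B by (simp add: power_mult_distrib poly_weight_square[OF A0] S_def)
    then show "A + B * S + real d * (C * D) \<le> (sqrt B * poly_weight d p A x)\<^sup>2"
      using dCD by (simp add: algebra_simps)
  qed
  finally show "(\<integral>\<^sup>+z. ennreal ((poly_weight d p A (translate d x z))\<^sup>2) \<partial>\<mu>) \<le> ennreal ((sqrt B * poly_weight d p A x)\<^sup>2)" .
qed

lemma exp_bound_imp_integrable:
  assumes h: "h \<in> borel_measurable (borel_Rd d)" and x: "x \<in> Rd d"
    and b: "0 \<le> b" "real d * b\<^sup>2 < lam" and C: "\<And>y. y \<in> Rd d \<Longrightarrow> \<bar>h y\<bar> \<le> C * exp (b * l1norm d y)"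
  shows "integrable \<mu> (\<lambda>z. h (translate d x z))"
proof (rule Bochner_Integration.integrable_bound)
  show "integrable \<mu> (\<lambda>z. (\<bar>C\<bar> * 2 ^ d) * cosh_weight d b (translate d x z))"
    using mu_cosh_weight(1)[OF x b(2)] by simp
  show "(\<lambda>z. h (translate d x z)) \<in> borel_measurable \<mu>" by (rule measurable_translate_mu[OF h x])
  show "AE z in \<mu>. norm (h (translate d x z)) \<le> norm ((\<bar>C\<bar> * 2 ^ d) * cosh_weight d b (translate d x z))"
  proof (rule AE_I2)
    fix z
    let ?y = "translate d x z"
    have "\<bar>h ?y\<bar> \<le> C * exp (b * l1norm d ?y)" by (rule C) simp
    also have "\<dots> \<le> \<bar>C\<bar> * (2 ^ d * cosh_weight d b ?y)"
      using exp_l1norm_le_cosh_weight[OF b(1)] by (intro mult_mono) auto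
    finally show "norm (h ?y) \<le> norm ((\<bar>C\<bar> * 2 ^ d) * cosh_weight d b ?y)"
      using cosh_weight_pos[of d b ?y] by (simp add: mult.assoc)
  qed
qed

lemma small_exponent: "\<exists>b>0. real d * b\<^sup>2 \<le> e" if "0 < e"
proof -
  have "real d * (sqrt (e / (real d + 1)))\<^sup>2 = e * (real d / (real d + 1))" using that by simp
  also have "\<dots> \<le> e * 1" using that by (intro mult_left_mono) auto
  finally show ?thesis using that by (intro exI[of _ "sqrt (e / (real d + 1))"]) auto
qed

lemma fixed_point:
  assumes u: "C_diff d 2 u" and x: "x \<in> Rd d"
    and ub: "\<And>b. 0 < b \<Longrightarrow> \<exists>C. \<forall>y\<in>Rd d. \<bar>u y\<bar> \<le> C * exp (b * l1norm d y)"
    and Lb: "\<And>b. 0 < b \<Longrightarrow> \<exists>C. \<forall>y\<in>Rd d. \<bar>Laplacian d u y\<bar> \<le> C * exp (b * l1norm d y)"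
  shows "(\<integral>z. u (translate d x z) - Laplacian d u (translate d x z) / lam \<partial>\<mu>) = u x"
proof -
  obtain b where b: "0 < b" "real d * b\<^sup>2 \<le> lam / 2" using small_exponent[of "lam / 2"] lam by auto
  obtain C where C: "\<And>y. y \<in> Rd d \<Longrightarrow> \<bar>u y\<bar> \<le> C * exp (b * l1norm d y)" using ub[OF b(1)] by blast
  obtain C' where C': "\<And>y. y \<in> Rd d \<Longrightarrow> \<bar>Laplacian d u y\<bar> \<le> C' * exp (b * l1norm d y)" using Lb[OF b(1)] by blast
  define h where "h y = u y - Laplacian d u y / lam" for y
  have hm: "h \<in> borel_measurable (borel_Rd d)"
    unfolding h_def[abs_def] using continuous_on_Rd_measurable[OF continuous_on_C_diff[OF u]]
      continuous_on_Rd_measurable[OF continuous_on_Laplacian[OF u]] by (intro borel_measurable_diff borel_measurable_divide) auto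
  have i: "integrable \<mu> (\<lambda>z. h (translate d x z))"
  proof (rule exp_bound_imp_integrable[OF hm x])
    fix y assume y: "y \<in> Rd d"
    have "\<bar>h y\<bar> \<le> \<bar>u y\<bar> + \<bar>Laplacian d u y / lam\<bar>" unfolding h_def by (rule abs_triangle_ineq4)
    also have "\<bar>Laplacian d u y / lam\<bar> = \<bar>Laplacian d u y\<bar> / lam" using lam by (simp add: abs_divide)
    also have "\<bar>u y\<bar> + \<bar>Laplacian d u y\<bar> / lam \<le> C * exp (b * l1norm d y) + (C' * exp (b * l1norm d y)) / lam"
      using C[OF y] C'[OF y] lam by (intro add_mono divide_right_mono) auto
    also have "\<dots> = (C + C' / lam) * exp (b * l1norm d y)" by (simp add: distrib_right)
    finally show "\<bar>h y\<bar> \<le> (C + C' / lam) * exp (b * l1norm d y)" .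
  qed (use b lam in auto)
  show ?thesis using integral_mu[OF hm i] feynman_kac[OF u lam x ub Lb] unfolding h_def by simp
qed

text \<open>Iterating the fixed point equation \<open>n\<close> times turns the subexponential growth bound into a term
  \<open>q' ^ n * cosh_weight\<close> with \<open>q' < 1\<close>, which vanishes in the limit.\<close>

lemma solution_bound:
  assumes um: "u \<in> borel_measurable (borel_Rd d)" and L: "0 \<le> L" "L < lam"
    and K: "0 \<le> K" and s: "0 \<le> s" and Q: "L / lam * s < 1"
    and \<psi>0: "\<And>x. 0 \<le> \<psi> x"
    and \<psi>L2: "\<And>x. x \<in> Rd d \<Longrightarrow> L2_le \<mu> (\<lambda>z. \<psi> (translate d x z)) (s * \<psi> x)"
    and ub: "\<And>b. 0 < b \<Longrightarrow> \<exists>C. \<forall>y\<in>Rd d. \<bar>u y\<bar> \<le> C * exp (b * l1norm d y)"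
    and fp: "\<And>x. x \<in> Rd d \<Longrightarrow> \<bar>u x\<bar> \<le> (\<integral>z. K * \<psi> (translate d x z) + L / lam * \<bar>u (translate d x z)\<bar> \<partial>\<mu>)"
    and x: "x \<in> Rd d"
  shows "\<bar>u x\<bar> \<le> K * s / (1 - L / lam * s) * \<psi> x"
proof -
  \<comment> \<open>Half of the gap \<open>lam - L\<close> is spent on the exponential weight, so
    the contraction factor \<open>q' = L / (lam - real d * b\<^sup>2)\<close> stays below 1.\<close>
  obtain b where b: "0 < b" "real d * b\<^sup>2 \<le> (lam - L) / 2" using small_exponent[of "(lam - L) / 2"] L by auto
  have "(lam - L) / 2 < lam" using lam L by simp
  then have bl: "real d * b\<^sup>2 < lam" by (rule le_less_trans[OF b(2)])
  obtain C where C: "\<And>y. y \<in> Rd d \<Longrightarrow> \<bar>u y\<bar> \<le> C * exp (b * l1norm d y)" using ub[OF b(1)] by blast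
  define C2 where "C2 = \<bar>C\<bar> * 2 ^ d"
  define q where "q = L / lam"
  define q' where "q' = q * (lam / (lam - real d * b\<^sup>2))"
  have q0: "0 \<le> q" using L by (simp add: q_def)
  have q': "0 \<le> q'" "q' < 1"
  proof -
    have e: "q' = L / (lam - real d * b\<^sup>2)" using lam by (simp add: q'_def q_def)
    have "x < lam - y" if "y \<le> (lam - x) / 2" "x < lam" for x y :: real
      using that by (simp add: field_simps)
    then have "0 < lam - real d * b\<^sup>2" "L < lam - real d * b\<^sup>2" using b(2) L bl by simp_all
    then show "0 \<le> q'" "q' < 1" unfolding e using L by (auto simp: divide_less_eq)
  qed
  \<comment> \<open>The fixed point of \<open>a \<mapsto> K * s + q * a * s\<close>, so that one
    more application of the fixed point inequality reproduces the coefficient of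
    \<open>\<psi> x\<close>.\<close>
  define a0 where "a0 = K * s / (1 - q * s)"
  have Q': "q * s < 1" using Q by (simp add: q_def)
  have a0: "0 \<le> a0" "K * s + q * a0 * s = a0"
    using K s Q' by (auto simp: a0_def field_simps)
  have iter: "\<bar>u x\<bar> \<le> a0 * \<psi> x + C2 * q' ^ n * cosh_weight d b x" if "x \<in> Rd d" for n x
    using that
  proof (induction n arbitrary: x)
    case (0 x)
    have "\<bar>u x\<bar> \<le> C * exp (b * l1norm d x)" by (rule C[OF 0])
    also have "\<dots> \<le> \<bar>C\<bar> * (2 ^ d * cosh_weight d b x)"
      using exp_l1norm_le_cosh_weight[of b d x] b by (intro mult_mono) auto
    finally show ?case using a0(1) \<psi>0[of x] by (simp add: C2_def mult.assoc add_increasing)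
  next
    case (Suc n)
    note i\<psi> = mu.L2_le_mean(1,2)[OF \<psi>L2[OF Suc.prems]]
    note i\<rho> = mu_cosh_weight[OF Suc.prems bl]
    have iu: "integrable \<mu> (\<lambda>z. u (translate d x z))"
      by (rule exp_bound_imp_integrable[OF um Suc.prems _ bl C]) (use b in auto)
    have "\<bar>u x\<bar> \<le> (\<integral>z. K * \<psi> (translate d x z) + q * \<bar>u (translate d x z)\<bar> \<partial>\<mu>)"
      using fp[OF Suc.prems] by (simp add: q_def)
    also have "\<dots> \<le> (\<integral>z. (K + q * a0) * \<psi> (translate d x z) + (q * (C2 * q' ^ n)) * cosh_weight d b (translate d x z) \<partial>\<mu>)"
    proof (rule integral_mono)
      fix z
      let ?y = "translate d x z"
      have "q * \<bar>u ?y\<bar> \<le> q * (a0 * \<psi> ?y + C2 * q' ^ n * cosh_weight d b ?y)"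
        by (intro mult_left_mono Suc.IH q0) simp
      then show "K * \<psi> ?y + q * \<bar>u ?y\<bar> \<le> (K + q * a0) * \<psi> ?y + (q * (C2 * q' ^ n)) * cosh_weight d b ?y"
        by (simp add: algebra_simps)
    qed (use iu i\<psi> i\<rho> in auto)
    also have "\<dots> = (K + q * a0) * (\<integral>z. \<psi> (translate d x z) \<partial>\<mu>) + (q * (C2 * q' ^ n)) * (\<integral>z. cosh_weight d b (translate d x z) \<partial>\<mu>)"
      using i\<psi> i\<rho> by simp
    also have "\<dots> \<le> (K + q * a0) * (s * \<psi> x) + (q * (C2 * q' ^ n)) * (lam / (lam - real d * b\<^sup>2) * cosh_weight d b x)"
      using i\<psi>(2) i\<rho>(2) K q0 a0 q' by (intro add_mono mult_left_mono) (auto simp: C2_def)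
    also have "\<dots> = (K * s + q * a0 * s) * \<psi> x + C2 * q' ^ Suc n * cosh_weight d b x"
    proof -
      have "(q * (C2 * q' ^ n)) * (lam / (lam - real d * b\<^sup>2) * cosh_weight d b x) = C2 * (q * (lam / (lam - real d * b\<^sup>2))) * q' ^ n * cosh_weight d b x"
        by (simp only: mult_ac)
      then show ?thesis unfolding q'_def[symmetric] by (simp add: algebra_simps)
    qed
    finally show ?case unfolding a0(2) .
  qed
  have "(\<lambda>n. a0 * \<psi> x + C2 * q' ^ n * cosh_weight d b x) \<longlonglongrightarrow> a0 * \<psi> x + C2 * 0 * cosh_weight d b x"
    using q' by (intro tendsto_intros LIMSEQ_power_zero) auto
  then have "\<bar>u x\<bar> \<le> a0 * \<psi> x + C2 * 0 * cosh_weight d b x"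
    by (rule LIMSEQ_le_const) (use iter[OF x] in auto)
  then show ?thesis by (simp add: a0_def q_def)
qed

end

section \<open>Rates and costs\<close>

text \<open>At \<open>r = 1\<close> the expression equals \<open>Q * (1 + m) / (1 - m)\<close>,
  which is below 1 by hypothesis. By continuity some \<open>r < 1\<close> still works, with room
  \<open>\<eta>\<close>.\<close>

lemma rate_exists:
  fixes Q m :: real
  assumes Q: "0 \<le> Q" and m: "0 < m" "m < 1" and less: "Q * (1 + m) < 1 - m"
  shows "\<exists>r \<eta>. m < r \<and> r < 1 \<and> 0 < \<eta> \<and> Q / r + Q * (1 + 1 / r) * (m / (r - m)) \<le> 1 - \<eta>"
proof -
  define g where "g r = Q / r + Q * (1 + 1 / r) * (m / (r - m))" for r
  have g1: "g 1 < 1"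
  proof -
    have "g 1 = Q * (1 + m) / (1 - m)" using m by (simp add: g_def field_simps)
    also have "\<dots> < 1" using less m by (simp add: divide_less_eq)
    finally show ?thesis .
  qed
  define \<eta> where "\<eta> = (1 - g 1) / 2"
  have \<eta>: "0 < \<eta>" "g 1 < 1 - \<eta>" using g1 by (auto simp: \<eta>_def field_simps)
  have "isCont g 1" unfolding g_def[abs_def] using m by (intro continuous_intros) auto
  then have "(g \<longlongrightarrow> g 1) (at_left 1)"
    by (simp add: isCont_def filterlim_at_split)
  then have "\<forall>\<^sub>F r in at_left 1. g r < 1 - \<eta>" using \<eta>(2) by (rule order_tendstoD)
  moreover have "\<forall>\<^sub>F r in at_left 1. r \<in> {m<..<1}" by (rule eventually_at_leftI[OF _ m(2)])
  ultimately have "\<forall>\<^sub>F r in at_left 1. g r < 1 - \<eta> \<and> r \<in> {m<..<1}" by (rule eventually_conj)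
  then obtain r where "g r < 1 - \<eta>" "r \<in> {m<..<1}"
    using eventually_happens' trivial_limit_at_left_real by blast
  then show ?thesis using \<eta>(1) unfolding g_def by (intro exI[of _ r] exI[of _ \<eta>]) auto
qed

lemma geometric_bound:
  fixes \<rho> :: real
  assumes "0 \<le> \<rho>" "\<rho> < 1"
  shows "(\<Sum>k\<in>{1..<n}. \<rho> ^ (n - k)) \<le> \<rho> / (1 - \<rho>)"
proof (induction n)
  case 0 then show ?case using assms by simp
next
  case (Suc n)
  show ?case
  proof (cases "n = 0")
    case True then show ?thesis using assms by simp
  next
    case False
    have "(\<Sum>k\<in>{1..<Suc n}. \<rho> ^ (Suc n - k)) = (\<Sum>k\<in>{1..<n}. \<rho> ^ (Suc n - k)) + \<rho>"
      using False by (subst sum.atLeastLessThan_Suc) auto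
    also have "(\<Sum>k\<in>{1..<n}. \<rho> ^ (Suc n - k)) = \<rho> * (\<Sum>k\<in>{1..<n}. \<rho> ^ (n - k))"
      unfolding sum_distrib_left by (rule sum.cong) (auto simp: Suc_diff_le)
    also have "\<dots> + \<rho> \<le> \<rho> * (\<rho> / (1 - \<rho>)) + \<rho>"
      using Suc assms by (intro add_right_mono mult_left_mono) auto
    also have "\<dots> = \<rho> / (1 - \<rho>)" using assms by (simp add: field_simps)
    finally show ?thesis .
  qed
qed

text \<open>The geometric ansatz \<open>a * r ^ n\<close> reproduces itself. The statistical errors
  form a geometric series with ratio \<open>m / r < 1\<close>, where \<open>m\<close> is
  \<open>1 / sqrt M\<close>, and the choice \<open>a = b / \<eta>\<close> lets the spare
  \<open>\<eta>\<close> pay for level 0.\<close>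

lemma recursion_bound:
  fixes Q a b r \<eta> :: real and M :: nat
  assumes M: "1 < M" and Q: "0 \<le> Q" and b: "0 \<le> b" and r: "1 / sqrt (real M) < r" "r < 1" and \<eta>: "0 < \<eta>"
    and rate: "Q / r + Q * (1 + 1 / r) * ((1 / sqrt (real M)) / (r - 1 / sqrt (real M))) \<le> 1 - \<eta>"
    and a: "a = b / \<eta>" and n: "1 \<le> n"
  shows "(\<Sum>k\<in>{0..<n}. (if k = 0 then b else Q * a * (r ^ k + r ^ (k - 1))) / sqrt (real (M ^ (n - k))))
        + Q * a * r ^ (n - 1) \<le> a * r ^ n"
proof -
  define m where "m = 1 / sqrt (real M)"
  have m: "0 < m" "m < r" using M r by (auto simp: m_def)
  have r0: "0 < r" using m by simp
  have a0: "0 \<le> a" using b \<eta> a by simp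
  define \<rho> where "\<rho> = m / r"
  have \<rho>: "0 \<le> \<rho>" "\<rho> < 1" using m by (auto simp: \<rho>_def)
  have sq: "x / sqrt (real (M ^ j)) = x * m ^ j" for x j
    by (simp add: m_def real_sqrt_power power_one_over)
  have mn: "b * m ^ n \<le> \<eta> * a * r ^ n"
  proof -
    have "m ^ n \<le> r ^ n" using m by (intro power_mono) auto
    then have "b * m ^ n \<le> b * r ^ n" using b by (rule mult_left_mono)
    then show ?thesis using a \<eta> by simp
  qed
  have summand: "Q * a * (r ^ k + r ^ (k - 1)) * m ^ (n - k) = Q * a * (1 + 1 / r) * r ^ n * \<rho> ^ (n - k)" if k: "k \<in> {1..<n}" for k
  proof -
    have "r ^ (k - 1) = r ^ k * (1 / r)" using k r0 by (cases k) auto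
    moreover have "r ^ n = r ^ k * r ^ (n - k)" using k by (simp add: power_add[symmetric])
    moreover have "m ^ (n - k) = r ^ (n - k) * \<rho> ^ (n - k)"
      using r0 by (simp add: \<rho>_def power_mult_distrib[symmetric])
    ultimately show ?thesis by (simp add: algebra_simps)
  qed
  have "(\<Sum>k\<in>{0..<n}. (if k = 0 then b else Q * a * (r ^ k + r ^ (k - 1))) / sqrt (real (M ^ (n - k))))
     = b * m ^ n + (\<Sum>k\<in>{1..<n}. Q * a * (r ^ k + r ^ (k - 1)) * m ^ (n - k))"
    unfolding sq using n by (subst sum.atLeast_Suc_lessThan) auto
  also have "(\<Sum>k\<in>{1..<n}. Q * a * (r ^ k + r ^ (k - 1)) * m ^ (n - k))
      = Q * a * (1 + 1 / r) * r ^ n * (\<Sum>k\<in>{1..<n}. \<rho> ^ (n - k))"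
    unfolding sum_distrib_left by (rule sum.cong[OF refl summand])
  also have "\<dots> \<le> Q * a * (1 + 1 / r) * r ^ n * (\<rho> / (1 - \<rho>))"
    using Q a0 r0 by (intro mult_left_mono geometric_bound \<rho>) auto
  also have "\<rho> / (1 - \<rho>) = m / (r - m)" using r0 m by (simp add: \<rho>_def field_simps)
  finally have "(\<Sum>k\<in>{0..<n}. (if k = 0 then b else Q * a * (r ^ k + r ^ (k - 1))) / sqrt (real (M ^ (n - k))))
     + Q * a * r ^ (n - 1) \<le> \<eta> * a * r ^ n + Q * a * (1 + 1 / r) * r ^ n * (m / (r - m)) + Q * a * r ^ (n - 1)"
    using mn by simp
  also have rn: "r ^ (n - 1) = r ^ n / r" using n r0 by (cases n) auto
  also have "\<eta> * a * r ^ n + Q * a * (1 + 1 / r) * r ^ n * (m / (r - m)) + Q * a * (r ^ n / r)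
     = (a * r ^ n) * (\<eta> + (Q / r + Q * (1 + 1 / r) * (m / (r - m))))"
  proof -
    have "\<eta> * a * p + Q * a * y * p * X + Q * a * (p / r) = (a * p) * (\<eta> + (Q / r + Q * y * X))" for p y X
      by (simp add: algebra_simps)
    then show ?thesis .
  qed
  also have "\<dots> \<le> (a * r ^ n) * 1"
    using rate a0 r0 unfolding m_def[symmetric] by (intro mult_left_mono) auto
  finally show ?thesis unfolding rn by simp
qed

text \<open>By induction each level costs at most three copies of \<open>e * (5 * M) ^ k\<close>.
  After the common factor \<open>M ^ n\<close> is taken out,
  \<open>1 + 3 * (\<Sum>k\<in>{1..<n}. 5 ^ k) \<le> 5 ^ n\<close> closes the induction.\<close>

lemma cost_bound:
  fixes cost :: "nat \<Rightarrow> real" and e :: real and M :: nat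
  assumes M: "1 \<le> M" and e: "1 \<le> e"
    and rec: "\<And>n. cost n \<le> e * real M ^ n + (\<Sum>k\<in>{1..<n}. real M ^ (n - k) * (e + cost k + cost (k - 1)))"
  shows "cost n \<le> e * (5 * real M) ^ n"
proof (induction n rule: less_induct)
  case (less n)
  let ?M = "real M"
  have M1: "1 \<le> ?M" using M by simp
  have five: "(\<Sum>k\<in>{1..<n}. (5::real) ^ k) \<le> 5 ^ n / 4 - 1 / 4" for n
  proof (induction n)
    case (Suc n)
    then show ?case by (cases "n = 0") auto
  qed simp
  have "cost n \<le> e * ?M ^ n + (\<Sum>k\<in>{1..<n}. ?M ^ (n - k) * (e + cost k + cost (k - 1)))" by (rule rec)
  also have "\<dots> \<le> e * ?M ^ n + (\<Sum>k\<in>{1..<n}. e * ?M ^ n * (3 * 5 ^ k))"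
  proof (intro add_left_mono sum_mono)
    fix k assume k: "k \<in> {1..<n}"
    have p1: "1 \<le> (5 * ?M) ^ k" using M1 by (intro one_le_power) auto
    have p2: "(5 * ?M) ^ (k - 1) \<le> (5 * ?M) ^ k" using M1 by (intro power_increasing) auto
    have "e \<le> e * (5 * ?M) ^ k" using p1 e by simp
    moreover have "cost k \<le> e * (5 * ?M) ^ k" by (rule less.IH) (use k in auto)
    moreover have "cost (k - 1) \<le> e * (5 * ?M) ^ k"
      using order_trans[OF less.IH mult_left_mono[OF p2]] k e by auto
    ultimately have "e + cost k + cost (k - 1) \<le> 3 * (e * (5 * ?M) ^ k)" by linarith
    then have "?M ^ (n - k) * (e + cost k + cost (k - 1)) \<le> ?M ^ (n - k) * (3 * (e * (5 * ?M) ^ k))"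
      by (intro mult_left_mono) auto
    also have "\<dots> = e * (?M ^ (n - k) * ?M ^ k) * (3 * 5 ^ k)" by (simp add: power_mult_distrib)
    also have "?M ^ (n - k) * ?M ^ k = ?M ^ n" using k by (simp add: power_add[symmetric])
    finally show "?M ^ (n - k) * (e + cost k + cost (k - 1)) \<le> e * ?M ^ n * (3 * 5 ^ k)" .
  qed
  also have "\<dots> = e * ?M ^ n * (1 + 3 * (\<Sum>k\<in>{1..<n}. 5 ^ k))"
    by (simp add: distrib_left sum_distrib_left[symmetric])
  also have "\<dots> \<le> e * ?M ^ n * 5 ^ n"
  proof (rule mult_left_mono)
    have "(1::real) \<le> 5 ^ n" by (rule one_le_power) simp
    then show "1 + 3 * (\<Sum>k\<in>{1..<n}. (5::real) ^ k) \<le> 5 ^ n" using five[of n] by linarith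
  qed (use e in auto)
  also have "\<dots> = e * (5 * ?M) ^ n" by (simp add: power_mult_distrib)
  finally show ?case .
qed

text \<open>\<open>n\<close> exceeds \<open>ln x / ln (1 / r)\<close>, which gives the first bound,
  but by at most 1. A quantity that is exponential in \<open>n\<close> is therefore a power of
  \<open>x\<close>, up to the factor \<open>\<beta>\<close> for the rounding.\<close>

lemma number_of_levels:
  fixes r \<beta> x :: real
  assumes r: "0 < r" "r < 1" and \<beta>: "1 \<le> \<beta>" and x: "1 \<le> x"
  defines "n \<equiv> Suc (nat \<lfloor>ln x / ln (1 / r)\<rfloor>)"
  shows "r ^ n * x \<le> 1" "\<beta> ^ n \<le> \<beta> * x powr (ln \<beta> / ln (1 / r))"
proof -
  define l where "l = ln (1 / r)"
  have l: "0 < l" using r by (simp add: l_def)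
  have lr: "ln r = - l" using r by (simp add: l_def ln_div)
  define s where "s = ln x / l"
  have s: "0 \<le> s" using x l by (simp add: s_def)
  have n: "real n - 1 \<le> s" "s < real n" using s unfolding n_def l_def[symmetric] s_def[symmetric] by linarith+
  have "r ^ n = exp (real n * ln r)" using r by (simp add: exp_of_nat_mult)
  also have "\<dots> * x = exp (ln x - real n * l)" using x by (simp add: lr exp_diff exp_minus field_simps)
  also have "\<dots> \<le> 1" using n(2) l by (simp add: s_def field_simps)
  finally show "r ^ n * x \<le> 1" .
  have "\<beta> ^ n = \<beta> powr real n" using \<beta> by (simp add: powr_realpow)
  also have "\<dots> \<le> \<beta> powr (s + 1)" using n \<beta> by (intro powr_mono) auto
  also have "\<dots> = \<beta> * \<beta> powr s" using \<beta> by (simp add: powr_add)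
  also have "\<beta> powr s = x powr (ln \<beta> / l)" using \<beta> x by (simp add: powr_def s_def)
  finally show "\<beta> ^ n \<le> \<beta> * x powr (ln \<beta> / ln (1 / r))" unfolding l_def .
qed

section \<open>The error estimate\<close>

context resolvent
begin

lemma mlp_scheme_resolvent:
  assumes fc: "continuous_on (Rd d \<times> UNIV) (\<lambda>(x, v). f x v)" and M: "1 \<le> M"
  shows "mlp_scheme d \<mu> (\<lambda>y v. v - f y v / lam) M"
proof (rule mlp_scheme.intro)
  have "(\<lambda>q. snd q - (\<lambda>(x, v). f x v) q / lam) \<in> borel_measurable (borel_Rd d \<Otimes>\<^sub>M borel)"
    by (intro borel_measurable_diff borel_measurable_divide measurable_snd
        continuous_on_Rd_prod_measurable[OF fc] borel_measurable_const)
  then show "(\<lambda>(y, v). v - f y v / lam) \<in> borel_measurable (borel_Rd d \<Otimes>\<^sub>M borel)" by (simp add: split_beta)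
qed (use M prob_mu sets_mu in auto)

text \<open>The constant \<open>a\<close> has two roles: it bounds \<open>u\<close> relative to the
  weight, which is the error of the zeroth iterate, and through \<open>\<eta>\<close> it absorbs the
  statistical error of level 0 in the recursion.\<close>

theorem mlp_error:
  fixes u :: "(nat \<Rightarrow> real) \<Rightarrow> real" and f :: "(nat \<Rightarrow> real) \<Rightarrow> real \<Rightarrow> real" and K :: real
  assumes u: "C_diff d 2 u" and fc: "continuous_on (Rd d \<times> UNIV) (\<lambda>(x, v). f x v)"
    and pde: "\<And>x. x \<in> Rd d \<Longrightarrow> Laplacian d u x = f x (u x)"
    and L: "0 \<le> L" "L < lam"
    and lip: "\<And>x v w. x \<in> Rd d \<Longrightarrow> \<bar>f x v - f x w - lam * (v - w)\<bar> \<le> L * \<bar>v - w\<bar>"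
    and ub: "\<And>b. 0 < b \<Longrightarrow> \<exists>C. \<forall>y\<in>Rd d. \<bar>u y\<bar> \<le> C * exp (b * l1norm d y)"
    and fb: "\<And>b. 0 < b \<Longrightarrow> \<exists>C. \<forall>y\<in>Rd d. \<bar>f y 0\<bar> \<le> C * exp (b * l1norm d y)"
    and p: "0 < p" and B: "1 < B" and C: "0 \<le> C"
    and CB: "\<And>x y :: real. \<bar>x + y\<bar> ^ (2 * p) \<le> B * \<bar>x\<bar> ^ (2 * p) + C * \<bar>y\<bar> ^ (2 * p)"
    and D: "D = 4 * (real (2 * p) / sqrt (lam / 2)) ^ (2 * p)"
    and A: "real d * (C * D / (B - 1)) \<le> A"
    and K: "0 \<le> K" and f0: "\<And>y. y \<in> Rd d \<Longrightarrow> \<bar>f y 0\<bar> \<le> lam * K * poly_weight d p A y"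
    and M: "1 < M" and Q: "Q = L / lam * sqrt B" and r: "1 / sqrt (real M) < r" "r < 1" and \<eta>: "0 < \<eta>"
    and rate: "Q / r + Q * (1 + 1 / r) * ((1 / sqrt (real M)) / (r - 1 / sqrt (real M))) \<le> 1 - \<eta>"
    and a: "a = sqrt B * K / \<eta>" and x: "x \<in> Rd d"
  shows "L2_le (Pi\<^sub>M Theta (\<lambda>_. \<mu>)) (\<lambda>z. mlp_scheme.Phi d (\<lambda>y v. v - f y v / lam) M n x z - u x)
    (a * r ^ n * poly_weight d p A x)"
proof -
  let ?F = "\<lambda>y v. v - f y v / lam"
  let ?\<psi> = "poly_weight d p A"
  have um: "u \<in> borel_measurable (borel_Rd d)"
    by (rule continuous_on_Rd_measurable[OF continuous_on_C_diff[OF u]])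
  interpret S: mlp_scheme d \<mu> ?F M
    by (rule mlp_scheme_resolvent[OF fc]) (use M in simp)
  have D0: "0 \<le> D" using lam by (simp add: D)
  have A0: "0 \<le> A"
  proof -
    have "0 \<le> real d * (C * D / (B - 1))" using C D0 B by simp
    then show ?thesis using A by linarith
  qed
  have q0: "0 \<le> L / lam" using L lam by simp
  have Q0: "0 \<le> Q" unfolding Q using q0 B by (intro mult_nonneg_nonneg) auto
  have m0: "0 < 1 / sqrt (real M)" using M by simp
  have r0: "0 < r" using m0 r by linarith
  have \<psi>0: "0 \<le> ?\<psi> y" for y by (rule poly_weight_nonneg[OF A0])
  have \<psi>L2: "L2_le \<mu> (\<lambda>z. ?\<psi> (translate d y z)) (sqrt B * ?\<psi> y)" if "y \<in> Rd d" for y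
    by (rule mu_poly_weight[OF p B C CB D A that])
  have Flip: "\<bar>?F y v - ?F y w\<bar> \<le> L / lam * \<bar>v - w\<bar>" if "y \<in> Rd d" for y v w
  proof -
    have "?F y v - ?F y w = - (f y v - f y w - lam * (v - w)) / lam" using lam by (simp add: field_simps)
    then have "\<bar>?F y v - ?F y w\<bar> = \<bar>f y v - f y w - lam * (v - w)\<bar> / lam" using lam by (simp only: abs_divide abs_minus_cancel abs_of_pos)
    also have "\<dots> \<le> (L * \<bar>v - w\<bar>) / lam" using lip[OF that] lam by (intro divide_right_mono) auto
    finally show ?thesis by simp
  qed
  have F0: "\<bar>?F y 0\<bar> \<le> K * ?\<psi> y" if "y \<in> Rd d" for y
    using f0[OF that] lam by (simp add: abs_divide divide_le_eq mult_ac)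
  \<comment> \<open>The equation turns the growth of the Laplacian into that of
    \<open>f y (u y)\<close>, which the Lipschitz bound reduces to \<open>u\<close> and
    \<open>f y 0\<close>.\<close>
  have Lb: "\<exists>C. \<forall>y\<in>Rd d. \<bar>Laplacian d u y\<bar> \<le> C * exp (b * l1norm d y)" if b: "0 < b" for b
  proof -
    obtain C1 where C1: "\<And>y. y \<in> Rd d \<Longrightarrow> \<bar>u y\<bar> \<le> C1 * exp (b * l1norm d y)" using ub[OF b] by blast
    obtain C2 where C2: "\<And>y. y \<in> Rd d \<Longrightarrow> \<bar>f y 0\<bar> \<le> C2 * exp (b * l1norm d y)" using fb[OF b] by blast
    have "\<bar>Laplacian d u y\<bar> \<le> (C2 + (lam + L) * C1) * exp (b * l1norm d y)" if y: "y \<in> Rd d" for y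
    proof -
      have "\<bar>f y (u y)\<bar> \<le> \<bar>f y 0\<bar> + (lam + L) * \<bar>u y\<bar>"
      proof -
        have "\<bar>lam * u y\<bar> = lam * \<bar>u y\<bar>" using lam by (simp add: abs_mult)
        moreover have "\<bar>f y (u y) - f y 0 - lam * u y\<bar> \<le> L * \<bar>u y\<bar>" using lip[OF y, of "u y" 0] by simp
        ultimately have "\<bar>f y (u y)\<bar> \<le> \<bar>f y 0\<bar> + lam * \<bar>u y\<bar> + L * \<bar>u y\<bar>" by linarith
        then show ?thesis by (simp add: distrib_right)
      qed
      also have "\<dots> \<le> C2 * exp (b * l1norm d y) + (lam + L) * (C1 * exp (b * l1norm d y))"
        using C1[OF y] C2[OF y] lam L by (intro add_mono mult_left_mono) auto
      finally show ?thesis unfolding pde[OF y] by (simp add: algebra_simps)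
    qed
    then show ?thesis by blast
  qed
  have ufix: "u y = (\<integral>z. ?F (translate d y z) (u (translate d y z)) \<partial>\<mu>)" if y: "y \<in> Rd d" for y
    using fixed_point[OF u y ub Lb] pde by simp
  have fp: "\<bar>u y\<bar> \<le> (\<integral>z. K * ?\<psi> (translate d y z) + L / lam * \<bar>u (translate d y z)\<bar> \<partial>\<mu>)" if y: "y \<in> Rd d" for y
  proof -
    obtain b where b: "0 < b" "real d * b\<^sup>2 \<le> lam / 2" using small_exponent[of "lam / 2"] lam by auto
    obtain C1 where C1: "\<And>y. y \<in> Rd d \<Longrightarrow> \<bar>u y\<bar> \<le> C1 * exp (b * l1norm d y)" using ub[OF b(1)] by blast
    have iu: "integrable \<mu> (\<lambda>z. u (translate d y z))"
      by (rule exp_bound_imp_integrable[OF um y _ _ C1]) (use b lam in auto)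
    have i: "integrable \<mu> (\<lambda>z. K * ?\<psi> (translate d y z) + L / lam * \<bar>u (translate d y z)\<bar>)"
      using iu mu.L2_le_mean(1)[OF \<psi>L2[OF y]] by simp
    have le: "\<bar>?F Y (u Y)\<bar> \<le> K * ?\<psi> Y + L / lam * \<bar>u Y\<bar>" if "Y \<in> Rd d" for Y
    proof -
      have "L / lam * \<bar>u Y - 0\<bar> = L / lam * \<bar>u Y\<bar>" by simp
      then show ?thesis using F0[OF that] Flip[OF that, of "u Y" 0] by linarith
    qed
    have m: "(\<lambda>Y. ?F Y (u Y)) \<in> borel_measurable (borel_Rd d)"
      by (rule S.measurable_F[OF measurable_ident_sets[OF refl] um])
    have iF: "integrable \<mu> (\<lambda>z. ?F (translate d y z) (u (translate d y z)))"
    proof (rule Bochner_Integration.integrable_bound[OF i measurable_translate_mu[OF m y]], rule AE_I2)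
      fix z
      have "\<bar>?F (translate d y z) (u (translate d y z))\<bar> \<le> K * ?\<psi> (translate d y z) + L / lam * \<bar>u (translate d y z)\<bar>"
        by (rule le) simp
      also have "\<dots> \<le> \<bar>K * ?\<psi> (translate d y z) + L / lam * \<bar>u (translate d y z)\<bar>\<bar>" by (rule abs_ge_self)
      finally show "norm (?F (translate d y z) (u (translate d y z))) \<le> norm (K * ?\<psi> (translate d y z) + L / lam * \<bar>u (translate d y z)\<bar>)"
        unfolding real_norm_def .
    qed
    have "\<bar>u y\<bar> \<le> (\<integral>z. \<bar>?F (translate d y z) (u (translate d y z))\<bar> \<partial>\<mu>)"
      unfolding ufix[OF y] by (rule integral_abs_bound)
    also have "\<dots> \<le> (\<integral>z. K * ?\<psi> (translate d y z) + L / lam * \<bar>u (translate d y z)\<bar> \<partial>\<mu>)"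
      using iF i by (intro integral_mono integrable_abs le) auto
    finally show ?thesis .
  qed
  \<comment> \<open>The a priori bound carries \<open>1 / (1 - Q)\<close>; since
    \<open>\<eta> \<le> 1 - Q\<close>, it is covered by the same
    \<open>a = sqrt B * K / \<eta>\<close> that the recursion uses.\<close>
  have Q\<eta>: "Q \<le> 1 - \<eta>"
  proof -
    have "Q \<le> Q / r" using Q0 r r0 by (simp add: pos_le_divide_eq mult_left_le)
    moreover have "0 \<le> 1 + 1 / r" using r0 by (simp add: add_nonneg_nonneg)
    then have "0 \<le> Q * (1 + 1 / r) * ((1 / sqrt (real M)) / (r - 1 / sqrt (real M)))"
      by (rule mult_nonneg_nonneg[OF mult_nonneg_nonneg[OF Q0] divide_nonneg_nonneg]) (use m0 r in auto)
    ultimately show ?thesis using rate by linarith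
  qed
  have a0: "0 \<le> a" using B K \<eta> by (simp add: a)
  have uba: "\<bar>u y\<bar> \<le> a * ?\<psi> y" if y: "y \<in> Rd d" for y
  proof -
    have "\<bar>u y\<bar> \<le> K * sqrt B / (1 - L / lam * sqrt B) * ?\<psi> y"
      by (rule solution_bound[OF um L K _ _ \<psi>0 \<psi>L2 ub fp y]) (use B Q\<eta> \<eta> Q in auto)
    also have "\<dots> \<le> a * ?\<psi> y"
    proof (rule mult_right_mono[OF _ \<psi>0])
      have "\<eta> \<le> 1 - L / lam * sqrt B" using Q\<eta> Q by simp
      then show "K * sqrt B / (1 - L / lam * sqrt B) \<le> a"
        unfolding a mult.commute[of "sqrt B" K] using \<eta> K B by (intro divide_left_mono mult_pos_pos) auto
    qed
    finally show ?thesis .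
  qed
  show ?thesis
  proof (rule S.L2_error[OF um q0 _ K a0 r0 measurable_poly_weight \<psi>0 \<psi>L2 Flip F0 ufix uba _ x])
    show "0 \<le> sqrt B" using B by simp
    fix n :: nat assume n: "1 \<le> n"
    have "0 \<le> sqrt B * K" using B K by simp
    from recursion_bound[OF M Q0 this r \<eta> rate a n]
    show "(\<Sum>k\<in>{0..<n}. (if k = 0 then sqrt B * K else L / lam * sqrt B * a * (r ^ k + r ^ (k - 1))) / sqrt (real (M ^ (n - k))))
        + L / lam * sqrt B * a * r ^ (n - 1) \<le> a * r ^ n"
      unfolding Q .
  qed
qed

end

text \<open>The hypothesis concerns closed tails at positive levels, the distribution function needs
  open tails at every \<open>a \<ge> 0\<close>. The open tail is the increasing limit of the closed
  tails at \<open>a + 1 / (n + 1)\<close>, which also reaches \<open>a = 0\<close>.\<close>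

lemma (in prob_space) exponential_distributedI_tail:
  assumes X: "X \<in> borel_measurable M" and lam: "0 < lam"
    and tail: "\<And>\<epsilon>. 0 < \<epsilon> \<Longrightarrow> prob {\<omega> \<in> space M. X \<omega> \<ge> \<epsilon>} = exp (- lam * \<epsilon>)"
  shows "distributed M lborel X (exponential_density lam)"
  unfolding exponential_distributed_iff[OF lam]
proof (intro conjI allI impI X)
  note X[measurable]
  fix a :: real assume a: "0 \<le> a"
  define E where "E n = {\<omega> \<in> space M. X \<omega> \<ge> a + 1 / real (Suc n)}" for n
  have inc: "incseq E"
  proof (rule incseq_SucI)
    fix n
    have "1 / real (Suc (Suc n)) \<le> 1 / real (Suc n)" by (simp add: field_simps)
    then show "E n \<subseteq> E (Suc n)" unfolding E_def by (auto intro: order_trans[OF add_left_mono])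
  qed
  have EU: "(\<Union>n. E n) = {\<omega> \<in> space M. a < X \<omega>}"
  proof safe
    fix \<omega> n assume "\<omega> \<in> E n"
    then have "\<omega> \<in> space M" "a + 1 / real (Suc n) \<le> X \<omega>" by (auto simp: E_def)
    moreover have "0 < 1 / real (Suc n)" by simp
    ultimately show "\<omega> \<in> space M" "a < X \<omega>" by linarith+
  next
    fix \<omega> assume "\<omega> \<in> space M" "a < X \<omega>"
    then obtain n where "inverse (real (Suc n)) < X \<omega> - a" using reals_Archimedean[of "X \<omega> - a"] by auto
    then show "\<omega> \<in> (\<Union>n. E n)" using \<open>\<omega> \<in> space M\<close> by (auto simp: E_def inverse_eq_divide intro!: exI[of _ n])
  qed
  have "(\<lambda>n. prob (E n)) \<longlonglongrightarrow> prob (\<Union>n. E n)"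
    by (rule finite_Lim_measure_incseq[OF _ inc]) (auto simp: E_def)
  moreover have "prob (E n) = exp (- lam * (a + 1 / real (Suc n)))" for n
    unfolding E_def by (rule tail) (use a in \<open>simp add: add_nonneg_pos\<close>)
  moreover have "(\<lambda>n. exp (- lam * (a + 1 / real (Suc n)))) \<longlonglongrightarrow> exp (- lam * (a + 0))"
    by (intro tendsto_intros LIMSEQ_Suc[OF lim_1_over_n])
  ultimately have "prob {\<omega> \<in> space M. a < X \<omega>} = exp (- lam * a)"
    unfolding EU using LIMSEQ_unique by force
  moreover have "{\<omega> \<in> space M. X \<omega> \<le> a} = space M - {\<omega> \<in> space M. a < X \<omega>}" by auto
  ultimately show "prob {\<omega> \<in> space M. X \<omega> \<le> a} = 1 - exp (- a * lam)"
    by (simp add: prob_compl mult.commute)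
qed

lemma distributed_cong_distr:
  assumes "distributed M lborel X f" "Y \<in> borel_measurable M" "distr M borel X = distr M borel Y"
  shows "distributed M lborel Y f"
proof -
  have "distr M lborel Z = distr M borel Z" for Z by (rule distr_cong) auto
  then have "distr M lborel Y = distr M lborel X" using assms(3) by metis
  then show ?thesis using assms(1,2) by (simp add: distributed_def)
qed

lemma (in prob_space) resolvent_stopped:
  assumes bm: "std_brownian_motion M d B" and lam: "0 < lam"
    and T0: "\<And>\<omega>. \<omega> \<in> space M \<Longrightarrow> 0 \<le> T \<omega>"
    and T: "distributed M lborel T (exponential_density lam)"
    and ind: "indep_set (sets (vimage_algebra (space M) T borel)) (sets (path_algebra M d B))"
  shows "resolvent d lam (distr M (borel_Rd d) (stopped d B T))"
proof -
  have Tm: "T \<in> borel_measurable M" using distributed_measurable[OF T] by simp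
  have m: "stopped d B T \<in> measurable M (borel_Rd d)"
    by (rule measurable_stopped[OF std_brownian_motionD(1)[OF bm] std_brownian_motionD(3)[OF bm] Tm T0])
  have tr: "(\<lambda>z. translate d x z) \<in> measurable (borel_Rd d) (borel_Rd d)" for x
  proof -
    have "(\<lambda>z. x j + z j) \<in> borel_measurable (borel_Rd d)" if "j \<in> {1..d}" for j
      using measurable_coord[OF that] by measurable
    then show ?thesis unfolding translate_def by (rule measurable_restrict)
  qed
  show ?thesis
  proof (rule resolvent.intro)
    show "0 < lam" by fact
    show "prob_space (distr M (borel_Rd d) (stopped d B T))" by (rule prob_space_distr[OF m])
    show "sets (distr M (borel_Rd d) (stopped d B T)) = sets (borel_Rd d)" by simp
    fix h :: "(nat \<Rightarrow> real) \<Rightarrow> real" and x assume h: "h \<in> borel_measurable (borel_Rd d)"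
    have hx: "(\<lambda>z. h (translate d x z)) \<in> borel_measurable (borel_Rd d)" by (rule measurable_compose[OF tr h])
    have hx': "(\<lambda>z. ennreal (h (translate d x z))) \<in> borel_measurable (distr M (borel_Rd d) (stopped d B T))"
      using hx by simp
    show "(\<integral>\<^sup>+z. ennreal (h (translate d x z)) \<partial>distr M (borel_Rd d) (stopped d B T))
      = (\<integral>\<^sup>+t. (if 0 < t then \<integral>\<^sup>+y. ennreal (h y) \<partial>heat_measure d t x else 0) \<partial>density lborel (exponential_density lam))"
      unfolding nn_integral_distr[OF m hx'] by (rule nn_integral_stopped[OF bm lam T0 T ind h])
    assume "integrable (distr M (borel_Rd d) (stopped d B T)) (\<lambda>z. h (translate d x z))"
    then have i: "integrable M (\<lambda>\<omega>. h (translate d x (stopped d B T \<omega>)))"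
      unfolding integrable_distr_eq[OF m hx] .
    show "(\<integral>z. h (translate d x z) \<partial>distr M (borel_Rd d) (stopped d B T))
      = (\<integral>t. (if 0 < t then \<integral>y. h y \<partial>heat_measure d t x else 0) \<partial>density lborel (exponential_density lam))"
      unfolding integral_distr[OF m hx] by (rule integral_stopped[OF bm lam T0 T ind h i])
  qed
qed

text \<open>A pathwise identification: after division by \<open>lam\<close>, the bracket of the
  scheme is a difference of values of \<open>F\<close>, and the iterate at a longer tuple reads a
  subfamily of a subfamily.\<close>

lemma mlp_eq_Phi:
  fixes U :: "int list \<Rightarrow> nat \<Rightarrow> (nat \<Rightarrow> real) \<Rightarrow> real" and Z :: "int list \<Rightarrow> nat \<Rightarrow> real"
  assumes S: "mlp_scheme d \<mu> (\<lambda>y v. v - f y v / lam) M" and lam: "0 < lam"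
    and U0: "\<And>\<theta> x. \<theta> \<in> Theta \<Longrightarrow> x \<in> Rd d \<Longrightarrow> U \<theta> 0 x = 0"
    and Urec: "\<And>n \<theta> x. 1 \<le> n \<Longrightarrow> \<theta> \<in> Theta \<Longrightarrow> x \<in> Rd d \<Longrightarrow>
      U \<theta> n x = - 1 / (lam * real M ^ n) * (\<Sum>m=1..M ^ n. f (translate d x (Z (\<theta> @ [0, int m]))) 0)
        + (\<Sum>k\<in>{1..<n}. 1 / (lam * real M ^ (n - k)) * (\<Sum>m=1..M ^ (n - k).
            let y = translate d x (Z (\<theta> @ [int k, int m]));
                v = U (\<theta> @ [int k, int m]) k y; v' = U (\<theta> @ [int k, - int m]) (k - 1) y
            in lam * (v - v') - (f y v - f y v')))"
    and \<theta>: "\<theta> \<in> Theta" and x: "x \<in> Rd d"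
  shows "U \<theta> n x = mlp_scheme.Phi d (\<lambda>y v. v - f y v / lam) M n x (subfamily \<theta> Z)"
  using \<theta> x
proof (induction n arbitrary: \<theta> x rule: less_induct)
  case (less n)
  let ?F = "\<lambda>y v. v - f y v / lam"
  interpret mlp_scheme d \<mu> ?F M by (rule S)
  note \<theta> = less.prems(1) and x = less.prems(2)
  show ?case
  proof (cases "n = 0")
    case True then show ?thesis using U0[OF \<theta> x] by (simp add: Phi_0)
  next
    case False
    have sub: "subfamily \<theta> Z [k, m] = Z (\<theta> @ [k, m])" for k m by (simp add: subfamily_def)
    have a\<theta>: "\<theta> @ [k, m] \<in> Theta" for k m by (simp add: Theta_def)
    let ?y = "\<lambda>k m. translate d x (Z (\<theta> @ [int k, int m]))"
    have i0: "incr 0 m x (subfamily \<theta> Z) = - f (translate d x (Z (\<theta> @ [0, int m]))) 0 / lam" for m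
      by (simp add: incr_def sub)
    have ik: "incr k m x (subfamily \<theta> Z) = (let y = ?y k m; v = U (\<theta> @ [int k, int m]) k y; v' = U (\<theta> @ [int k, - int m]) (k - 1) y
       in lam * (v - v') - (f y v - f y v')) / lam" if k: "k \<in> {1..<n}" for k m
    proof -
      have "U (\<theta> @ [int k, int m]) k (?y k m) = Phi k (?y k m) (subfamily (\<theta> @ [int k, int m]) Z)"
        using k by (intro less.IH a\<theta>) auto
      moreover have "U (\<theta> @ [int k, - int m]) (k - 1) (?y k m) = Phi (k - 1) (?y k m) (subfamily (\<theta> @ [int k, - int m]) Z)"
        using k by (intro less.IH a\<theta>) auto
      moreover have "k \<noteq> 0" using k by simp
      ultimately show ?thesis
        using lam by (simp add: incr_def sub subfamily_subfamily Let_def diff_divide_distrib right_diff_distrib)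
    qed
    have "Phi n x (subfamily \<theta> Z) = (\<Sum>m\<in>{1..M ^ n}. incr 0 m x (subfamily \<theta> Z)) / real (M ^ n)
      + (\<Sum>k\<in>{1..<n}. (\<Sum>m\<in>{1..M ^ (n - k)}. incr k m x (subfamily \<theta> Z)) / real (M ^ (n - k)))"
      unfolding Phi_eq using False by (subst sum.atLeast_Suc_lessThan) auto
    also have "(\<Sum>m\<in>{1..M ^ n}. incr 0 m x (subfamily \<theta> Z)) / real (M ^ n)
      = - 1 / (lam * real M ^ n) * (\<Sum>m=1..M ^ n. f (translate d x (Z (\<theta> @ [0, int m]))) 0)"
      unfolding i0 by (simp add: sum_divide_distrib[symmetric] sum_negf)
    also have "(\<Sum>k\<in>{1..<n}. (\<Sum>m\<in>{1..M ^ (n - k)}. incr k m x (subfamily \<theta> Z)) / real (M ^ (n - k)))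
      = (\<Sum>k\<in>{1..<n}. 1 / (lam * real M ^ (n - k)) * (\<Sum>m=1..M ^ (n - k).
            let y = ?y k m; v = U (\<theta> @ [int k, int m]) k y; v' = U (\<theta> @ [int k, - int m]) (k - 1) y
            in lam * (v - v') - (f y v - f y v')))"
    proof (rule sum.cong[OF refl])
      fix k assume k: "k \<in> {1..<n}"
      show "(\<Sum>m\<in>{1..M ^ (n - k)}. incr k m x (subfamily \<theta> Z)) / real (M ^ (n - k))
        = 1 / (lam * real M ^ (n - k)) * (\<Sum>m=1..M ^ (n - k).
            let y = ?y k m; v = U (\<theta> @ [int k, int m]) k y; v' = U (\<theta> @ [int k, - int m]) (k - 1) y
            in lam * (v - v') - (f y v - f y v'))"
        unfolding ik[OF k] sum_divide_distrib[symmetric] by simp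
    qed
    finally show ?thesis using Urec[OF _ \<theta> x, of n] False by simp
  qed
qed

text \<open>Prefixing \<open>\<theta>\<close> is an injective reindexing of an i.i.d. family, so the
  noise below any tuple has the law of the whole.\<close>

lemma (in prob_space) law_subfamily:
  fixes Z :: "int list \<Rightarrow> 'a \<Rightarrow> nat \<Rightarrow> real"
  assumes ind: "indep_vars (\<lambda>_. N) Z Theta" and law: "\<And>\<theta>. \<theta> \<in> Theta \<Longrightarrow> distr M N (Z \<theta>) = \<mu>"
  shows "(\<lambda>\<omega>. subfamily \<theta> (\<lambda>\<eta>. Z \<eta> \<omega>)) \<in> measurable M (Pi\<^sub>M Theta (\<lambda>_. \<mu>))"
    and "distr M (Pi\<^sub>M Theta (\<lambda>_. \<mu>)) (\<lambda>\<omega>. subfamily \<theta> (\<lambda>\<eta>. Z \<eta> \<omega>)) = Pi\<^sub>M Theta (\<lambda>_. \<mu>)"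
proof -
  have ne: "Theta \<noteq> {}" using pair_in_Theta by blast
  have Zm: "Z \<eta> \<in> measurable M N" if "\<eta> \<in> Theta" for \<eta> using ind that by (auto simp: indep_vars_def2)
  have sets: "sets \<mu> = sets N" using law[of "[0]"] by (auto simp: Theta_def)
  have pm: "prob_space \<mu>" using law[of "[0]"] prob_space_distr[OF Zm, of "[0]"] by (simp add: Theta_def)
  have sP: "sets (Pi\<^sub>M Theta (\<lambda>_. \<mu>)) = sets (Pi\<^sub>M Theta (\<lambda>_. N))"
    by (rule sets_PiM_cong) (auto simp: sets)
  let ?X = "\<lambda>\<omega>. \<lambda>\<eta>\<in>Theta. Z \<eta> \<omega>"
  have "distr M (Pi\<^sub>M Theta (\<lambda>_. N)) ?X = Pi\<^sub>M Theta (\<lambda>\<eta>. distr M N (Z \<eta>))"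
    using ind indep_vars_iff_distr_eq_PiM'[OF ne Zm] by simp
  also have "\<dots> = Pi\<^sub>M Theta (\<lambda>_. \<mu>)" by (rule PiM_cong) (auto simp: law)
  finally have X: "distr M (Pi\<^sub>M Theta (\<lambda>_. N)) ?X = Pi\<^sub>M Theta (\<lambda>_. \<mu>)" .
  have Xm: "?X \<in> measurable M (Pi\<^sub>M Theta (\<lambda>_. \<mu>))"
    unfolding measurable_cong_sets[OF refl sP] by (rule measurable_restrict[OF Zm])
  have X': "distr M (Pi\<^sub>M Theta (\<lambda>_. \<mu>)) ?X = Pi\<^sub>M Theta (\<lambda>_. \<mu>)"
    using X by (subst distr_cong[OF refl sP refl])
  have sm: "subfamily \<theta> \<in> measurable (Pi\<^sub>M Theta (\<lambda>_. \<mu>)) (Pi\<^sub>M Theta (\<lambda>_. \<mu>))"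
    unfolding subfamily_def by (intro measurable_restrict measurable_component_singleton append_in_Theta)
  have e: "subfamily \<theta> (?X \<omega>) = subfamily \<theta> (\<lambda>\<eta>. Z \<eta> \<omega>)" for \<omega>
    by (auto simp: subfamily_def append_in_Theta fun_eq_iff)
  show "(\<lambda>\<omega>. subfamily \<theta> (\<lambda>\<eta>. Z \<eta> \<omega>)) \<in> measurable M (Pi\<^sub>M Theta (\<lambda>_. \<mu>))"
    using measurable_compose[OF Xm sm] unfolding e .
  have "distr M (Pi\<^sub>M Theta (\<lambda>_. \<mu>)) (\<lambda>\<omega>. subfamily \<theta> (\<lambda>\<eta>. Z \<eta> \<omega>))
      = distr (distr M (Pi\<^sub>M Theta (\<lambda>_. \<mu>)) ?X) (Pi\<^sub>M Theta (\<lambda>_. \<mu>)) (subfamily \<theta>)"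
    unfolding distr_distr[OF sm Xm] by (simp add: comp_def e)
  also have "\<dots> = Pi\<^sub>M Theta (\<lambda>_. \<mu>)"
    unfolding X' subfamily_def
    by (rule distr_PiM_reindex[where M="\<lambda>_. \<mu>"]) (auto simp: pm append_in_Theta inj_on_def)
  finally show "distr M (Pi\<^sub>M Theta (\<lambda>_. \<mu>)) (\<lambda>\<omega>. subfamily \<theta> (\<lambda>\<eta>. Z \<eta> \<omega>)) = Pi\<^sub>M Theta (\<lambda>_. \<mu>)" .
qed

text \<open>With \<open>s ^ p = sqrt S\<close>, the number \<open>s\<close> dominates 1 and every
  \<open>\<bar>y j\<bar>\<close>, so that \<open>1 + l1norm d y \<le> (real d + 1) * s\<close>. The
  loss is polynomial in \<open>d\<close>.\<close>

lemma one_plus_l1norm_power_le: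
  assumes p: "0 < p"
  shows "(1 + l1norm d y) ^ p \<le> (real d + 1) ^ p * sqrt (1 + (\<Sum>j\<in>{1..d}. y j ^ (2 * p)))"
proof -
  define S where "S = 1 + (\<Sum>j\<in>{1..d}. y j ^ (2 * p))"
  have S1: "1 \<le> S" by (simp add: S_def sum_nonneg)
  define s where "s = root p (sqrt S)"
  have sp: "s ^ p = sqrt S" using p S1 by (simp add: s_def)
  have s1: "1 \<le> s" using p S1 by (simp add: s_def)
  have comp: "\<bar>y j\<bar> \<le> s" if j: "j \<in> {1..d}" for j
  proof -
    have "(\<bar>y j\<bar> ^ p)\<^sup>2 = y j ^ (2 * p)" by (simp add: power_mult[symmetric] mult.commute power_even_abs)
    also have "\<dots> \<le> (\<Sum>j\<in>{1..d}. y j ^ (2 * p))" using j by (intro member_le_sum) auto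
    also have "\<dots> \<le> S" by (simp add: S_def)
    finally have "\<bar>y j\<bar> ^ p \<le> sqrt S" by (rule real_le_rsqrt)
    then have "\<bar>y j\<bar> ^ p \<le> s ^ p" by (simp add: sp)
    then show ?thesis using p s1 by (simp add: power_mono_iff)
  qed
  have "l1norm d y \<le> (\<Sum>j\<in>{1..d}. s)" unfolding l1norm_def by (rule sum_mono) (rule comp)
  then have "1 + l1norm d y \<le> (real d + 1) * s" using s1 by (simp add: distrib_right)
  then have "(1 + l1norm d y) ^ p \<le> ((real d + 1) * s) ^ p" by (rule power_mono) simp
  then show ?thesis by (simp add: power_mult_distrib sp S_def)
qed

text \<open>With \<open>a = sqrt lam\<close> and \<open>b = sqrt L\<close>, the condition on
  \<open>M\<close> says \<open>a + b < sqrt M * (a - b)\<close>. Collecting \<open>a\<close> and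
  \<open>b\<close> on different sides and dividing by \<open>a * sqrt M\<close> gives the
  claim.\<close>

lemma rate_condition:
  fixes L lam :: real and M :: nat
  assumes L: "0 \<le> L" "L < lam" and M: "(sqrt lam + sqrt L)\<^sup>2 / (sqrt lam - sqrt L)\<^sup>2 < real M"
  shows "1 < M" "sqrt (L / lam) * (1 + 1 / sqrt (real M)) < 1 - 1 / sqrt (real M)"
proof -
  define a b where "a = sqrt lam" and "b = sqrt L"
  have ab: "0 \<le> b" "b < a" "0 < a" using L by (auto simp: a_def b_def)
  have "((a + b) / (a - b))\<^sup>2 < real M" using M by (simp add: a_def b_def power_divide)
  then have sM: "(a + b) / (a - b) < sqrt (real M)" by (rule real_less_rsqrt)
  have "1 \<le> (a + b) / (a - b)" using ab by simp
  then have s1: "1 < sqrt (real M)" using sM by linarith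
  then show "1 < M" by simp
  have "a + b < sqrt (real M) * (a - b)" using sM ab by (simp add: pos_divide_less_eq)
  then have *: "b * (sqrt (real M) + 1) < a * (sqrt (real M) - 1)" by (simp add: algebra_simps)
  have "sqrt (L / lam) = b / a" by (simp add: a_def b_def real_sqrt_divide)
  moreover have "b / a * (1 + 1 / sqrt (real M)) < 1 - 1 / sqrt (real M)"
  proof -
    have "b / a * (1 + 1 / sqrt (real M)) = b * (sqrt (real M) + 1) / (a * sqrt (real M))"
      using s1 by (simp add: field_simps)
    also have "\<dots> < a * (sqrt (real M) - 1) / (a * sqrt (real M))"
      using * ab s1 by (intro divide_strict_right_mono mult_pos_pos) auto
    also have "\<dots> = 1 - 1 / sqrt (real M)" using ab s1 by (simp add: field_simps)
    finally show ?thesis .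
  qed
  ultimately show "sqrt (L / lam) * (1 + 1 / sqrt (real M)) < 1 - 1 / sqrt (real M)" by simp
qed

section \<open>From the hypotheses of the theorem to bounds and i.i.d. samples\<close>

lemma SUP_growth_bound:
  assumes "(SUP y\<in>Rd d. ereal (\<bar>u y\<bar> * exp (- b * (\<Sum>j=1..d. \<bar>y j\<bar>)))) < \<infinity>"
  shows "\<exists>C. \<forall>y\<in>Rd d. \<bar>u y\<bar> \<le> C * exp (b * l1norm d y)"
proof -
  obtain C where C: "(SUP y\<in>Rd d. ereal (\<bar>u y\<bar> * exp (- b * (\<Sum>j=1..d. \<bar>y j\<bar>)))) \<le> ereal C"
    using assms by (cases "SUP y\<in>Rd d. ereal (\<bar>u y\<bar> * exp (- b * (\<Sum>j=1..d. \<bar>y j\<bar>)))") auto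
  have "\<bar>u y\<bar> \<le> C * exp (b * l1norm d y)" if "y \<in> Rd d" for y
  proof -
    have "ereal (\<bar>u y\<bar> * exp (- b * (\<Sum>j=1..d. \<bar>y j\<bar>))) \<le> ereal C"
      using C SUP_upper[OF that] by (meson order_trans)
    then have "\<bar>u y\<bar> * exp (- (b * l1norm d y)) \<le> C" by (simp add: l1norm_def)
    then show ?thesis by (simp add: exp_minus field_simps)
  qed
  then show ?thesis by blast
qed

lemma (in prob_space) indep_sets_reindex:
  assumes ind: "indep_sets F (g ` I)" and g: "inj_on g I"
  shows "indep_sets (\<lambda>i. F (g i)) I"
proof (rule indep_setsI)
  show "F (g i) \<subseteq> events" if "i \<in> I" for i using ind that unfolding indep_sets_def by blast
  fix A J assume J: "J \<noteq> {}" "J \<subseteq> I" "finite J" and A: "\<forall>j\<in>J. A j \<in> F (g j)"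
  have inj: "inj_on g J" using g J(2) by (rule inj_on_subset)
  have inv: "the_inv_into J g (g j) = j" if "j \<in> J" for j by (rule the_inv_into_f_f[OF inj that])
  have "prob (\<Inter>i\<in>g ` J. A (the_inv_into J g i)) = (\<Prod>i\<in>g ` J. prob (A (the_inv_into J g i)))"
    by (rule indep_setsD[OF ind]) (use J A inv in auto)
  then show "prob (\<Inter>j\<in>J. A j) = (\<Prod>j\<in>J. prob (A j))"
    by (simp add: prod.reindex[OF inj] inv)
qed

lemma (in prob_space) indep_set_mono:
  assumes "indep_set A B" "A' \<subseteq> A" "B' \<subseteq> B"
  shows "indep_set A' B'"
  using indep_setD_ev1[OF assms(1)] indep_setD_ev2[OF assms(1)] indep_setD[OF assms(1)] assms(2,3)
  by (intro indep_setI) blast+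

lemma sets_vimage_algebra_subset:
  assumes "f \<in> measurable V N" "space V = X"
  shows "sets (vimage_algebra X f N) \<subseteq> sets V"
proof -
  have "f \<in> X \<rightarrow> space N" using measurable_space[OF assms(1)] assms(2) by auto
  then show ?thesis using measurable_sets[OF assms(1)] assms(2) by (auto simp: sets_vimage_algebra2)
qed

text \<open>For one fixed \<open>d\<close>, three independence hypotheses are combined: among the
  times, among the paths, and between the two families. The last one also gives, for each single
  \<open>\<theta>\<close>, the independence of time and path behind the law of the stopped
  position.\<close>

lemma (in prob_space) iid_stopped:
  fixes W :: "nat \<Rightarrow> int list \<Rightarrow> real \<Rightarrow> 'a \<Rightarrow> nat \<Rightarrow> real" and R :: "int list \<Rightarrow> 'a \<Rightarrow> real"
  assumes lam: "0 < lam" and d: "1 \<le> d"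
    and bm: "\<And>d \<theta>. 1 \<le> d \<Longrightarrow> \<theta> \<in> Theta \<Longrightarrow> std_brownian_motion M d (W d \<theta>)"
    and indW: "indep_vars (\<lambda>(d, \<theta>). path_space d) (\<lambda>(d, \<theta>). sample_path (W d \<theta>)) ({1..} \<times> Theta)"
    and R0: "\<And>\<theta> \<omega>. \<theta> \<in> Theta \<Longrightarrow> \<omega> \<in> space M \<Longrightarrow> 0 \<le> R \<theta> \<omega>"
    and indR: "indep_vars (\<lambda>_. borel) R Theta"
    and Rd: "\<And>\<theta> \<eta>. \<theta> \<in> Theta \<Longrightarrow> \<eta> \<in> Theta \<Longrightarrow> distr M borel (R \<theta>) = distr M borel (R \<eta>)"
    and ind: "indep_set
           (sets (vimage_algebra (space M) (\<lambda>\<omega>. \<lambda>\<theta>\<in>Theta. R \<theta> \<omega>) (Pi\<^sub>M Theta (\<lambda>_. borel))))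
           (sets (vimage_algebra (space M)
              (\<lambda>\<omega>. \<lambda>(d, \<theta>)\<in>{1..} \<times> Theta. sample_path (W d \<theta>) \<omega>)
              (Pi\<^sub>M ({1..} \<times> Theta) (\<lambda>(d, \<theta>). path_space d))))"
    and tail: "\<And>\<epsilon>. 0 < \<epsilon> \<Longrightarrow> prob {\<omega> \<in> space M. R [0] \<omega> \<ge> \<epsilon>} = exp (- lam * \<epsilon>)"
  shows "indep_vars (\<lambda>_. borel_Rd d) (\<lambda>\<theta>. stopped d (W d \<theta>) (R \<theta>)) Theta"
    and "\<theta> \<in> Theta \<Longrightarrow> distr M (borel_Rd d) (stopped d (W d \<theta>) (R \<theta>)) = distr M (borel_Rd d) (stopped d (W d [0]) (R [0]))"
    and "resolvent d lam (distr M (borel_Rd d) (stopped d (W d [0]) (R [0])))"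
proof -
  have T0: "[0] \<in> Theta" by (simp add: Theta_def)
  let ?VR = "vimage_algebra (space M) (\<lambda>\<omega>. \<lambda>\<theta>\<in>Theta. R \<theta> \<omega>) (Pi\<^sub>M Theta (\<lambda>_. borel))"
  let ?VW = "vimage_algebra (space M) (\<lambda>\<omega>. \<lambda>(d, \<theta>)\<in>{1..} \<times> Theta. sample_path (W d \<theta>) \<omega>)
              (Pi\<^sub>M ({1..} \<times> Theta) (\<lambda>(d, \<theta>). path_space d))"
  have Rm: "R \<theta> \<in> borel_measurable M" if "\<theta> \<in> Theta" for \<theta>
    using indR that by (auto simp: indep_vars_def2)
  have VR: "R \<theta> \<in> measurable ?VR borel" if "\<theta> \<in> Theta" for \<theta>
  proof -
    have "(\<lambda>\<omega>. \<lambda>\<theta>\<in>Theta. R \<theta> \<omega>) \<in> measurable ?VR (Pi\<^sub>M Theta (\<lambda>_. borel))"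
      by (rule measurable_vimage_algebra1) (auto simp: space_PiM)
    from measurable_compose[OF this measurable_component_singleton[OF that]] show ?thesis using that by simp
  qed
  have VW: "sample_path (W d \<theta>) \<in> measurable ?VW (path_space d)" if \<theta>: "\<theta> \<in> Theta" for \<theta>
  proof -
    have "(\<lambda>\<omega>. \<lambda>(d, \<theta>)\<in>{1..} \<times> Theta. sample_path (W d \<theta>) \<omega>) \<in> space M \<rightarrow> space (Pi\<^sub>M ({1..} \<times> Theta) (\<lambda>(d, \<theta>). path_space d))"
      unfolding space_PiM
    proof (intro funcsetI PiE_I)
      fix \<omega> and i :: "nat \<times> int list" assume "\<omega> \<in> space M" "i \<in> {1..} \<times> Theta"
      then show "(\<lambda>(d, \<theta>)\<in>{1..} \<times> Theta. sample_path (W d \<theta>) \<omega>) i \<in> space (case i of (d, \<theta>) \<Rightarrow> path_space d)"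
        using measurable_space[OF measurable_sample_path[OF bm]] by (cases i) (auto simp del: One_nat_def)
    qed auto
    then have m: "(\<lambda>\<omega>. \<lambda>(d, \<theta>)\<in>{1..} \<times> Theta. sample_path (W d \<theta>) \<omega>) \<in> measurable ?VW (Pi\<^sub>M ({1..} \<times> Theta) (\<lambda>(d, \<theta>). path_space d))"
      by (rule measurable_vimage_algebra1)
    have i: "(d, \<theta>) \<in> {1..} \<times> Theta" using d \<theta> by simp
    from measurable_compose[OF m measurable_component_singleton[OF i]] show ?thesis using i by (simp del: One_nat_def)
  qed
  have indW': "indep_vars (\<lambda>_. path_space d) (\<lambda>\<theta>. sample_path (W d \<theta>)) Theta"
  proof -
    have sub: "Pair d ` Theta \<subseteq> {1..} \<times> Theta" using d by auto
    have "indep_sets (\<lambda>i. {(\<lambda>(d, \<theta>). sample_path (W d \<theta>)) i -` A \<inter> space M | A. A \<in> sets ((\<lambda>(d, \<theta>). path_space d) i)}) (Pair d ` Theta)"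
      using indW unfolding indep_vars_def2 by (blast intro: indep_sets_mono_index[OF sub])
    from indep_sets_reindex[OF this] show ?thesis
      unfolding indep_vars_def2 using measurable_sample_path[OF bm[OF d]] by (simp add: inj_on_def)
  qed
  \<comment> \<open>The tail is prescribed for the tuple \<open>[0]\<close> only; equality in law
    carries it to all others.\<close>
  have exp: "distributed M lborel (R \<theta>) (exponential_density lam)" if "\<theta> \<in> Theta" for \<theta>
    by (rule distributed_cong_distr[OF exponential_distributedI_tail[OF Rm[OF T0] lam tail] Rm[OF that] Rd[OF T0 that]])
  have ind\<theta>: "indep_set (sets (vimage_algebra (space M) (R \<theta>) borel)) (sets (path_algebra M d (W d \<theta>)))" if "\<theta> \<in> Theta" for \<theta>
    by (rule indep_set_mono[OF ind]; rule sets_vimage_algebra_subset) (use VR[OF that] VW[OF that] in auto)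
  show "indep_vars (\<lambda>_. borel_Rd d) (\<lambda>\<theta>. stopped d (W d \<theta>) (R \<theta>)) Theta"
    by (rule indep_stopped[OF bm[OF d] R0 indR indW' ind _ _ VR VW]) auto
  show "distr M (borel_Rd d) (stopped d (W d \<theta>) (R \<theta>)) = distr M (borel_Rd d) (stopped d (W d [0]) (R [0]))" if "\<theta> \<in> Theta"
    by (rule distr_stopped_eqI[OF bm[OF d that] bm[OF d T0] lam R0[OF that] R0[OF T0] exp[OF that] exp[OF T0] ind\<theta>[OF that] ind\<theta>[OF T0]])
  show "resolvent d lam (distr M (borel_Rd d) (stopped d (W d [0]) (R [0])))"
    by (rule resolvent_stopped[OF bm[OF d T0] lam R0[OF T0] exp[OF T0] ind\<theta>[OF T0]])
qed

theorem theorem1p1: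
  fixes c L lam :: real and M :: nat
    and u :: "nat \<Rightarrow> (nat \<Rightarrow> real) \<Rightarrow> real"
    and f :: "nat \<Rightarrow> (nat \<Rightarrow> real) \<Rightarrow> real \<Rightarrow> real"
    and P :: "'w measure"
    and W :: "nat \<Rightarrow> int list \<Rightarrow> real \<Rightarrow> 'w \<Rightarrow> nat \<Rightarrow> real"
    and R :: "int list \<Rightarrow> 'w \<Rightarrow> real"
    and U :: "nat \<Rightarrow> int list \<Rightarrow> nat \<Rightarrow> (nat \<Rightarrow> real) \<Rightarrow> 'w \<Rightarrow> real"
    and cost :: "nat \<Rightarrow> nat \<Rightarrow> real"
  assumes "0 \<le> c" and "0 \<le> L" and "L < lam"
    and "1 \<le> M" and "(sqrt lam + sqrt L)\<^sup>2 / (sqrt lam - sqrt L)\<^sup>2 < real M"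
    and "\<And>d. 1 \<le> d \<Longrightarrow> C_diff d 2 (u d)"
    and "\<And>d. 1 \<le> d \<Longrightarrow> continuous_on (Rd d \<times> UNIV) (\<lambda>(x, v). f d x v)"
    and "\<And>d x. 1 \<le> d \<Longrightarrow> x \<in> Rd d \<Longrightarrow> Laplacian d (u d) x = f d x (u d x)"
    and "prob_space P"
    and "\<And>d \<theta>. 1 \<le> d \<Longrightarrow> \<theta> \<in> Theta \<Longrightarrow> std_brownian_motion P d (W d \<theta>)"
    and "prob_space.indep_vars P (\<lambda>(d, \<theta>). path_space d) (\<lambda>(d, \<theta>). sample_path (W d \<theta>)) ({1..} \<times> Theta)"
    and "\<And>\<theta> \<omega>. \<theta> \<in> Theta \<Longrightarrow> \<omega> \<in> space P \<Longrightarrow> 0 \<le> R \<theta> \<omega>"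
    and "prob_space.indep_vars P (\<lambda>_. borel) R Theta"
    and "\<And>\<theta> \<eta>. \<theta> \<in> Theta \<Longrightarrow> \<eta> \<in> Theta \<Longrightarrow> distr P borel (R \<theta>) = distr P borel (R \<eta>)"
    and "prob_space.indep_set P
           (sets (vimage_algebra (space P) (\<lambda>\<omega>. \<lambda>\<theta>\<in>Theta. R \<theta> \<omega>) (Pi\<^sub>M Theta (\<lambda>_. borel))))
           (sets (vimage_algebra (space P)
              (\<lambda>\<omega>. \<lambda>(d, \<theta>)\<in>{1..} \<times> Theta. sample_path (W d \<theta>) \<omega>)
              (Pi\<^sub>M ({1..} \<times> Theta) (\<lambda>(d, \<theta>). path_space d))))"
    and "\<And>d x v w. 1 \<le> d \<Longrightarrow> x \<in> Rd d \<Longrightarrow>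
           \<bar>f d x v - f d x w - lam * (v - w)\<bar> \<le> L * \<bar>v - w\<bar>"
    and "\<And>d x. 1 \<le> d \<Longrightarrow> x \<in> Rd d \<Longrightarrow>
           \<bar>f d x 0\<bar> \<le> c * real d powr c * (1 + (\<Sum>j=1..d. \<bar>x j\<bar>)) powr c"
    and "\<And>d \<epsilon>. 1 \<le> d \<Longrightarrow> 0 < \<epsilon> \<Longrightarrow>
           (SUP y\<in>Rd d. ereal (\<bar>u d y\<bar> * exp (- \<epsilon> * (\<Sum>j=1..d. \<bar>y j\<bar>)))) < \<infinity>"
    and "\<And>\<epsilon>. 0 < \<epsilon> \<Longrightarrow> measure P {\<omega> \<in> space P. R [0] \<omega> \<ge> \<epsilon>} = exp (- lam * \<epsilon>)"
    and "\<And>d \<theta> x \<omega>. 1 \<le> d \<Longrightarrow> \<theta> \<in> Theta \<Longrightarrow> x \<in> Rd d \<Longrightarrow> \<omega> \<in> space P \<Longrightarrow> U d \<theta> 0 x \<omega> = 0"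
    and "\<And>d n \<theta> x \<omega>. 1 \<le> d \<Longrightarrow> 1 \<le> n \<Longrightarrow> \<theta> \<in> Theta \<Longrightarrow> x \<in> Rd d \<Longrightarrow> \<omega> \<in> space P \<Longrightarrow>
           U d \<theta> n x \<omega> =
             (let Y = (\<lambda>(k::nat) (m::nat). \<lambda>j\<in>{1..d}.
                    x j + sqrt 2 * W d (\<theta> @ [int k, int m]) (R (\<theta> @ [int k, int m]) \<omega>) \<omega> j);
                  V = (\<lambda>(k::nat) (m::nat). U d (\<theta> @ [int k, int m]) k (Y k m) \<omega>);
                  V' = (\<lambda>(k::nat) (m::nat). U d (\<theta> @ [int k, - int m]) (k - 1) (Y k m) \<omega>)
              in - 1 / (lam * real M ^ n) * (\<Sum>m=1..M ^ n. f d (Y 0 m) 0)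
                 + (\<Sum>k\<in>{1..<n}. 1 / (lam * real M ^ (n - k)) *
                     (\<Sum>m=1..M ^ (n - k).
                        lam * (V k m - V' k m)
                        - (f d (Y k m) (V k m) - f d (Y k m) (V' k m)))))"
    and "\<And>d n. cost d n \<le> (real d + 1) * real M ^ n
           + (\<Sum>k\<in>{1..<n}. real M ^ (n - k) * (real d + 1 + cost d k + cost d (k - 1)))"
  shows "\<exists>(\<kappa>::real) (N :: real \<Rightarrow> nat \<Rightarrow> nat).
           (\<forall>\<epsilon>\<in>{0<..1}. \<forall>d\<ge>1. 1 \<le> N \<epsilon> d) \<and>
           (\<forall>\<epsilon>\<in>{0<..1}. \<forall>d\<ge>1.
              cost d (N \<epsilon> d) \<le> \<kappa> * real d powr \<kappa> * \<epsilon> powr (- \<kappa>) \<and>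
              (\<forall>x\<in>{1..d} \<rightarrow>\<^sub>E {- c..c}. integrable P (\<lambda>\<omega>. \<bar>u d x - U d [0] (N \<epsilon> d) x \<omega>\<bar>\<^sup>2)) \<and>
              (SUP x\<in>{1..d} \<rightarrow>\<^sub>E {- c..c}.
                 ereal (sqrt (\<integral>\<omega>. \<bar>u d x - U d [0] (N \<epsilon> d) x \<omega>\<bar>\<^sup>2 \<partial>P))) \<le> ereal \<epsilon>)"
proof -
  interpret prob_space P by (rule assms(9))
  note c = assms(1) and L = assms(2,3)
  have lam: "0 < lam" using L by linarith
  \<comment> \<open>A positive integer not below \<open>c\<close>: the weight is built from integer
    powers, whereas \<open>f\<close> grows with a real exponent.\<close>
  define p where "p = Suc (nat \<lceil>c\<rceil>)"
  have p: "0 < p" "c \<le> real p" by (auto simp: p_def) linarith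
  \<comment> \<open>With \<open>lam / L\<close> the contraction factor
    \<open>L / lam * sqrt B\<close> becomes \<open>sqrt (L / lam)\<close>, the quantity in the
    condition on \<open>M\<close>. For \<open>L = 0\<close> the factor is 0 whatever
    \<open>B\<close> is, and 2 is a convenient value above 1.\<close>
  define B where "B = (if L = 0 then 2 else lam / L)"
  have B: "1 < B" using L by (auto simp: B_def)
  define Q where "Q = L / lam * sqrt B"
  have Q: "Q = sqrt (L / lam)"
  proof (cases "L = 0")
    case False
    then have "L / lam * sqrt (lam / L) = sqrt (L / lam)"
      using L lam by (simp add: real_sqrt_divide field_simps)
    then show ?thesis using False by (simp add: Q_def B_def)
  qed (simp add: Q_def)
  have Q0: "0 \<le> Q" unfolding Q using L lam by simp
  note M = rate_condition[OF L assms(5)]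
  have "1 / sqrt (real M) < 1" "0 < 1 / sqrt (real M)" using M(1) by auto
  then obtain r \<eta> where r: "1 / sqrt (real M) < r" "r < 1" and \<eta>: "0 < \<eta>"
    and rate: "Q / r + Q * (1 + 1 / r) * ((1 / sqrt (real M)) / (r - 1 / sqrt (real M))) \<le> 1 - \<eta>"
    using rate_exists[OF Q0 _ _ M(2)[folded Q]] by blast
  have r0: "0 < r" using r(1) \<open>0 < 1 / sqrt (real M)\<close> by linarith
  obtain C where C: "0 \<le> C" and CB: "\<And>x y :: real. \<bar>x + y\<bar> ^ (2 * p) \<le> B * \<bar>x\<bar> ^ (2 * p) + C * \<bar>y\<bar> ^ (2 * p)"
    using power_add_le[OF B, of "2 * p"] p by auto
  define D where "D = 4 * (real (2 * p) / sqrt (lam / 2)) ^ (2 * p)"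
  have D0: "0 \<le> D" using lam by (simp add: D_def)
  have CD: "0 \<le> C * D / (B - 1)" using C D0 B by simp
  \<comment> \<open>The summand 1 ensures \<open>1 \<le> A d\<close> for positive \<open>d\<close>,
    so the weight dominates \<open>sqrt (1 + (\<Sum>j\<in>{1..d}. y j ^ (2 * p)))\<close>.\<close>
  define A where "A d = real d * (C * D / (B - 1) + 1)" for d
  \<comment> \<open>The growth constant of \<open>f d y 0 / lam\<close>, times the factor
    \<open>(real d + 1) ^ p\<close> lost in passing from the sum norm to the weight.\<close>
  define K where "K d = c / lam * real d powr c * (real d + 1) ^ p" for d
  define a where "a d = sqrt B * K d / \<eta>" for d
  have K0: "0 \<le> K d" for d using c lam by (simp add: K_def)
  have a0: "0 \<le> a d" for d using K0[of d] B \<eta> by (simp add: a_def)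
  have f0: "\<bar>f d y 0\<bar> \<le> c * real d powr c * (1 + l1norm d y) ^ p" if d: "1 \<le> d" and y: "y \<in> Rd d" for d y
  proof -
    have l: "1 \<le> 1 + l1norm d y" by simp
    have "(1 + l1norm d y) powr c \<le> (1 + l1norm d y) powr real p" by (rule powr_mono[OF p(2) l])
    also have "\<dots> = (1 + l1norm d y) ^ p" using l by (intro powr_realpow) linarith
    finally have "c * real d powr c * (1 + l1norm d y) powr c \<le> c * real d powr c * (1 + l1norm d y) ^ p"
      using c by (intro mult_left_mono) auto
    then show ?thesis using assms(17)[OF d y] by (simp add: l1norm_def)
  qed
  \<comment> \<open>The rate \<open>r\<close> is the same for all dimensions; \<open>d\<close>
    enters only through \<open>a d\<close> and the weight.\<close>
  have error: "L2_le P (\<lambda>\<omega>. U d [0] n x \<omega> - u d x) (a d * r ^ n * poly_weight d p (A d) x)"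
    if d: "1 \<le> d" and x: "x \<in> Rd d" for d n x
  proof -
    define Z where "Z \<theta> = stopped d (W d \<theta>) (R \<theta>)" for \<theta>
    define \<mu> where "\<mu> = distr P (borel_Rd d) (Z [0])"
    have indZ: "indep_vars (\<lambda>_. borel_Rd d) Z Theta"
      unfolding Z_def by (rule iid_stopped(1)[OF lam d assms(10-15,19)])
    have law: "distr P (borel_Rd d) (Z \<theta>) = \<mu>" if "\<theta> \<in> Theta" for \<theta>
      unfolding \<mu>_def Z_def by (rule iid_stopped(2)[OF lam d assms(10-15,19) that])
    interpret resolvent d lam \<mu>
      unfolding \<mu>_def Z_def by (rule iid_stopped(3)[OF lam d assms(10-15,19)])
    let ?z = "\<lambda>\<omega>. subfamily [0] (\<lambda>\<eta>. Z \<eta> \<omega>)"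
    have zm: "?z \<in> measurable P (Pi\<^sub>M Theta (\<lambda>_. \<mu>))" by (rule law_subfamily(1)[OF indZ law])
    have zd: "distr P (Pi\<^sub>M Theta (\<lambda>_. \<mu>)) ?z = Pi\<^sub>M Theta (\<lambda>_. \<mu>)" by (rule law_subfamily(2)[OF indZ law])
    let ?F = "\<lambda>y v. v - f d y v / lam"
    have S: "mlp_scheme d \<mu> ?F M" by (rule mlp_scheme_resolvent[OF assms(7)[OF d] assms(4)])
    have fK: "\<bar>f d y 0\<bar> \<le> lam * K d * poly_weight d p (A d) y" if y: "y \<in> Rd d" for y
    proof -
      have "1 * 1 \<le> A d" unfolding A_def using d CD by (intro mult_mono) auto
      then have "sqrt (1 + (\<Sum>j\<in>{1..d}. y j ^ (2 * p))) \<le> poly_weight d p (A d) y"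
        unfolding poly_weight_def by simp
      then have "(1 + l1norm d y) ^ p \<le> (real d + 1) ^ p * poly_weight d p (A d) y"
        using one_plus_l1norm_power_le[OF p(1), of d y] by (meson mult_left_mono order_trans zero_le_power of_nat_0_le_iff add_nonneg_nonneg zero_le_one)
      then have "c * real d powr c * (1 + l1norm d y) ^ p \<le> c * real d powr c * ((real d + 1) ^ p * poly_weight d p (A d) y)"
        using c by (intro mult_left_mono) auto
      also have "\<dots> = lam * K d * poly_weight d p (A d) y" using lam by (simp add: K_def)
      finally show ?thesis using f0[OF d y] by linarith
    qed
    have fb: "\<exists>C. \<forall>y\<in>Rd d. \<bar>f d y 0\<bar> \<le> C * exp (b * l1norm d y)" if b: "0 < b" for b
    proof -
      have "\<bar>f d y 0\<bar> \<le> (c * real d powr c * ((real p / b) ^ p * exp b)) * exp (b * l1norm d y)" if y: "y \<in> Rd d" for y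
      proof -
        have "(1 + l1norm d y) ^ p \<le> (real p / b) ^ p * exp (b * (1 + l1norm d y))"
          by (rule power_le_exp[OF b p(1)]) (simp add: add_nonneg_nonneg)
        then have "c * real d powr c * (1 + l1norm d y) ^ p \<le> c * real d powr c * ((real p / b) ^ p * exp (b * (1 + l1norm d y)))"
          using c by (intro mult_left_mono) auto
        also have "\<dots> = (c * real d powr c * ((real p / b) ^ p * exp b)) * exp (b * l1norm d y)"
          by (simp add: distrib_left exp_add)
        finally show ?thesis using f0[OF d y] by linarith
      qed
      then show ?thesis by blast
    qed
    have ub: "\<exists>C. \<forall>y\<in>Rd d. \<bar>u d y\<bar> \<le> C * exp (b * l1norm d y)" if "0 < b" for b
      by (rule SUP_growth_bound[OF assms(18)[OF d that]])
    have AA: "real d * (C * D / (B - 1)) \<le> A d" by (simp add: A_def distrib_left)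
    have main: "L2_le (Pi\<^sub>M Theta (\<lambda>_. \<mu>)) (\<lambda>z. mlp_scheme.Phi d ?F M n x z - u d x) (a d * r ^ n * poly_weight d p (A d) x)"
      by (rule mlp_error[OF assms(6)[OF d] assms(7)[OF d] assms(8)[OF d] L assms(16)[OF d] ub fb p(1) B C CB D_def AA
            K0 fK M(1) Q_def r \<eta> rate a_def x])
    have UZ: "U d [0] n x \<omega> = mlp_scheme.Phi d ?F M n x (subfamily [0] (\<lambda>\<eta>. Z \<eta> \<omega>))" if \<omega>: "\<omega> \<in> space P" for \<omega>
    proof (rule mlp_eq_Phi[OF S lam, of "\<lambda>\<theta> n x. U d \<theta> n x \<omega>"])
      show "U d \<theta> 0 x \<omega> = 0" if "\<theta> \<in> Theta" "x \<in> Rd d" for \<theta> x by (rule assms(20)[OF d that \<omega>])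
      have tr: "(\<lambda>j\<in>{1..d}. y j + sqrt 2 * W d \<theta> (R \<theta> \<omega>) \<omega> j) = translate d y (Z \<theta> \<omega>)" for y \<theta>
        by (auto simp: translate_def Z_def stopped_def)
      show "U d \<theta> n x \<omega> = - 1 / (lam * real M ^ n) * (\<Sum>m=1..M ^ n. f d (translate d x (Z (\<theta> @ [0, int m]) \<omega>)) 0)
        + (\<Sum>k\<in>{1..<n}. 1 / (lam * real M ^ (n - k)) * (\<Sum>m=1..M ^ (n - k).
            let y = translate d x (Z (\<theta> @ [int k, int m]) \<omega>);
                v = U d (\<theta> @ [int k, int m]) k y \<omega>; v' = U d (\<theta> @ [int k, - int m]) (k - 1) y \<omega>
            in lam * (v - v') - (f d y v - f d y v')))" if "1 \<le> n" "\<theta> \<in> Theta" "x \<in> Rd d" for n \<theta> x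
        using assms(21)[OF d that \<omega>] unfolding tr Let_def by simp
    qed (use x in \<open>auto simp: Theta_def\<close>)
    have "L2_le P (\<lambda>\<omega>. mlp_scheme.Phi d ?F M n x (subfamily [0] (\<lambda>\<eta>. Z \<eta> \<omega>)) - u d x) (a d * r ^ n * poly_weight d p (A d) x)"
      using L2_le_distr[OF zm L2_leD(1)[OF main]] main unfolding zd by simp
    moreover have "L2_le P (\<lambda>\<omega>. mlp_scheme.Phi d ?F M n x (subfamily [0] (\<lambda>\<eta>. Z \<eta> \<omega>)) - u d x) (a d * r ^ n * poly_weight d p (A d) x)
        \<longleftrightarrow> L2_le P (\<lambda>\<omega>. U d [0] n x \<omega> - u d x) (a d * r ^ n * poly_weight d p (A d) x)"
      unfolding L2_le_def using UZ by (simp cong: measurable_cong nn_integral_cong)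
    ultimately show ?thesis by simp
  qed
  \<comment> \<open>On the cube, \<open>real d * E\<close> bounds the square of the weight, as each
    of the \<open>d\<close> summands is at most \<open>c ^ (2 * p)\<close>.\<close>
  define E where "E = C * D / (B - 1) + 1 + c ^ (2 * p)"
  have E0: "0 \<le> E" using CD by (simp add: E_def add_nonneg_nonneg)
  \<comment> \<open>The leading 1 keeps \<open>H\<close> at least 1, and with it the ratio
    \<open>X\<close> below, as \<open>number_of_levels\<close> demands.\<close>
  define H where "H = 1 + sqrt B * c / lam / \<eta> * 2 ^ p * sqrt E"
  have H1: "1 \<le> H" using B c lam \<eta> E0 by (simp add: H_def)
  \<comment> \<open>The exponents add up: \<open>c\<close> from the growth constant,
    \<open>p\<close> from \<open>(2 * real d) ^ p\<close>, and 1 from the weight on the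
    cube.\<close>
  define h where "h = c + real p + 1"
  have h0: "0 \<le> h" using c by (simp add: h_def)
  have weight: "a d * poly_weight d p (A d) x \<le> H * real d powr h"
    if d: "1 \<le> d" and x: "x \<in> {1..d} \<rightarrow>\<^sub>E {- c..c}" for d x
  proof -
    have d1: "1 \<le> real d" using d by simp
    have "(\<Sum>j\<in>{1..d}. x j ^ (2 * p)) \<le> (\<Sum>j\<in>{1..d}. c ^ (2 * p))"
    proof (rule sum_mono)
      fix j assume "j \<in> {1..d}"
      then have "x j \<in> {- c..c}" using x by (rule PiE_mem[rotated])
      then have "\<bar>x j\<bar> ^ (2 * p) \<le> c ^ (2 * p)" by (intro power_mono) auto
      then show "x j ^ (2 * p) \<le> c ^ (2 * p)" by (simp add: power_even_abs)
    qed
    then have "A d + (\<Sum>j\<in>{1..d}. x j ^ (2 * p)) \<le> real d * E"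
      by (simp add: A_def E_def algebra_simps)
    then have "poly_weight d p (A d) x \<le> sqrt (real d) * sqrt E"
      unfolding poly_weight_def real_sqrt_mult[symmetric] by (rule real_sqrt_le_mono)
    also have "\<dots> \<le> real d * sqrt E"
    proof (rule mult_right_mono)
      have "sqrt (real d) \<le> sqrt ((real d)\<^sup>2)" using d1 by (intro real_sqrt_le_mono) (simp add: power2_eq_square)
      then show "sqrt (real d) \<le> real d" by simp
    qed (use E0 in simp)
    finally have w: "poly_weight d p (A d) x \<le> real d * sqrt E" .
    have "(real d + 1) ^ p \<le> (2 * real d) ^ p" using d1 by (intro power_mono) auto
    then have "K d \<le> c / lam * real d powr c * (2 * real d) ^ p" unfolding K_def using c lam by (intro mult_left_mono) auto
    then have "a d \<le> sqrt B * (c / lam * real d powr c * (2 * real d) ^ p) / \<eta>"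
      unfolding a_def using B \<eta> by (intro divide_right_mono mult_left_mono) auto
    then have "a d * poly_weight d p (A d) x \<le> (sqrt B * (c / lam * real d powr c * (2 * real d) ^ p) / \<eta>) * (real d * sqrt E)"
      using w a0[of d] E0 order_trans[OF a0[of d]] CD
      by (intro mult_mono poly_weight_nonneg) (auto simp: A_def)
    also have "\<dots> = (H - 1) * (real d powr c * real d ^ p * real d)"
      by (simp add: H_def power_mult_distrib)
    also have "real d powr c * real d ^ p * real d = real d powr h"
      using d1 by (simp add: h_def powr_add powr_realpow)
    also have "(H - 1) * real d powr h \<le> H * real d powr h" by (intro mult_right_mono) auto
    finally show ?thesis .
  qed
  define \<beta> where "\<beta> = 5 * real M"
  have \<beta>: "1 \<le> \<beta>" using assms(4) by (simp add: \<beta>_def)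
  define s where "s = ln \<beta> / ln (1 / r)"
  have s0: "0 \<le> s" unfolding s_def using \<beta> r r0 by (intro divide_nonneg_nonneg) auto
  \<comment> \<open>The initial error bound divided by the accuracy. After
    \<open>N \<epsilon> d\<close> levels, \<open>r ^ N \<epsilon> d * X \<epsilon> d \<le> 1\<close>
    says that the error is at most \<open>\<epsilon>\<close>.\<close>
  define X where "X \<epsilon> d = H * real d powr h / \<epsilon>" for \<epsilon> :: real and d :: nat
  have X1: "1 \<le> X \<epsilon> d" if "\<epsilon> \<in> {0<..1}" "1 \<le> d" for \<epsilon> d
  proof -
    have "1 * 1 \<le> H * real d powr h" using H1 h0 that by (intro mult_mono) (auto intro: ge_one_powr_ge_zero)
    then show ?thesis using that unfolding X_def by (simp add: pos_le_divide_eq)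
  qed
  define N where "N \<epsilon> d = Suc (nat \<lfloor>ln (X \<epsilon> d) / ln (1 / r)\<rfloor>)" for \<epsilon> d
  note levels = number_of_levels[OF r0 r(2) \<beta> X1, folded N_def s_def]
  \<comment> \<open>The coefficient, the exponent of \<open>d\<close> and the exponent of
    \<open>1 / \<epsilon>\<close> in the cost bound are nonnegative, so their sum dominates each of
    them.\<close>
  define \<kappa> where "\<kappa> = 2 * \<beta> * H powr s + (1 + h * s) + s"
  have \<kappa>: "2 * \<beta> * H powr s \<le> \<kappa>" "1 + h * s \<le> \<kappa>" "s \<le> \<kappa>" "0 \<le> \<kappa>"
    using \<beta> s0 h0 by (auto simp: \<kappa>_def add_nonneg_nonneg)
  show ?thesis
  proof (intro exI[of _ \<kappa>] exI[of _ N] conjI ballI allI impI)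
    fix \<epsilon> :: real and d :: nat assume \<epsilon>: "\<epsilon> \<in> {0<..1}" and d: "1 \<le> d"
    show "1 \<le> N \<epsilon> d" by (simp add: N_def)
    have d1: "1 \<le> real d" using d by simp
    have \<epsilon>0: "0 < \<epsilon>" "\<epsilon> \<le> 1" using \<epsilon> by auto
    show "cost d (N \<epsilon> d) \<le> \<kappa> * real d powr \<kappa> * \<epsilon> powr (- \<kappa>)"
    proof -
      have "cost d (N \<epsilon> d) \<le> (real d + 1) * \<beta> ^ N \<epsilon> d"
        unfolding \<beta>_def by (rule cost_bound[OF assms(4) _ assms(22)]) simp
      also have "\<dots> \<le> (2 * real d) * (\<beta> * X \<epsilon> d powr s)"
        using d1 levels(2)[OF \<epsilon> d] \<beta> by (intro mult_mono) auto
      also have "X \<epsilon> d powr s = H powr s * real d powr (h * s) * \<epsilon> powr (- s)"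
        unfolding X_def using H1 d1 \<epsilon>0
        by (simp add: powr_divide powr_mult powr_powr powr_minus_divide)
      also have "(2 * real d) * (\<beta> * (H powr s * real d powr (h * s) * \<epsilon> powr (- s)))
          = (2 * \<beta> * H powr s) * real d powr (1 + h * s) * \<epsilon> powr (- s)"
        using d1 by (simp add: powr_add)
      also have "\<dots> \<le> \<kappa> * real d powr \<kappa> * \<epsilon> powr (- \<kappa>)"
      proof (intro mult_mono)
        show "real d powr (1 + h * s) \<le> real d powr \<kappa>" using \<kappa>(2) d1 by (rule powr_mono)
        show "\<epsilon> powr (- s) \<le> \<epsilon> powr (- \<kappa>)" using \<kappa>(3) \<epsilon>0 by (intro powr_mono') auto
      qed (use \<kappa> in auto)
      finally show ?thesis .
    qed
    have box: "x \<in> Rd d" if "x \<in> {1..d} \<rightarrow>\<^sub>E {- c..c}" for x using that by (auto simp: Rd_def PiE_def)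
    have sq: "\<bar>u d x - U d [0] (N \<epsilon> d) x \<omega>\<bar>\<^sup>2 = (U d [0] (N \<epsilon> d) x \<omega> - u d x)\<^sup>2" for x \<omega>
      by (simp add: power2_commute)
    have L2: "L2_le P (\<lambda>\<omega>. U d [0] (N \<epsilon> d) x \<omega> - u d x) \<epsilon>" if x: "x \<in> {1..d} \<rightarrow>\<^sub>E {- c..c}" for x
    proof (rule L2_le_mono[OF error[OF d box[OF x]]])
      have "a d * r ^ N \<epsilon> d * poly_weight d p (A d) x = r ^ N \<epsilon> d * (a d * poly_weight d p (A d) x)" by simp
      also have "\<dots> \<le> r ^ N \<epsilon> d * (H * real d powr h)" using weight[OF d x] r0 by (intro mult_left_mono) auto
      also have "\<dots> = (r ^ N \<epsilon> d * X \<epsilon> d) * \<epsilon>" using \<epsilon>0 by (simp add: X_def)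
      also have "\<dots> \<le> 1 * \<epsilon>" using levels(1)[OF \<epsilon> d] \<epsilon>0 by (intro mult_right_mono) auto
      finally show "a d * r ^ N \<epsilon> d * poly_weight d p (A d) x \<le> \<epsilon>" by simp
    qed
    show "integrable P (\<lambda>\<omega>. \<bar>u d x - U d [0] (N \<epsilon> d) x \<omega>\<bar>\<^sup>2)" if "x \<in> {1..d} \<rightarrow>\<^sub>E {- c..c}" for x
      unfolding sq by (rule L2_le_integrable_square(1)[OF L2[OF that]])
    show "(SUP x\<in>{1..d} \<rightarrow>\<^sub>E {- c..c}. ereal (sqrt (\<integral>\<omega>. \<bar>u d x - U d [0] (N \<epsilon> d) x \<omega>\<bar>\<^sup>2 \<partial>P))) \<le> ereal \<epsilon>"
    proof (rule SUP_least)
      fix x assume "x \<in> {1..d} \<rightarrow>\<^sub>E {- c..c}"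
      from L2_le_integrable_square(2)[OF L2[OF this]]
      have "sqrt (\<integral>\<omega>. (U d [0] (N \<epsilon> d) x \<omega> - u d x)\<^sup>2 \<partial>P) \<le> sqrt (\<epsilon>\<^sup>2)" by (rule real_sqrt_le_mono)
      then show "ereal (sqrt (\<integral>\<omega>. \<bar>u d x - U d [0] (N \<epsilon> d) x \<omega>\<bar>\<^sup>2 \<partial>P)) \<le> ereal \<epsilon>"
        unfolding sq using \<epsilon>0 by simp
    qed
  qed
qed

end
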